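(* Let $f^0=f^0(v)$, $v\in\mathbb R$, be a spatially homogeneous stationary solution and let $h_0=h_0(x,v)$ be an initial perturbation, $2\pi$-periodic in $x$. Assume that: (1) $f^0$ and $h_0$ are analytic functions; (2) $(f^0)'(v)=O(1/|v|)$ for large enough values of $|v|$; (3) (Penrose stability condition) if $\omega\in\mathbb R$ is such that $(f^0)'(\omega)=0$, then $$\mathrm{p.v.}\int_{-\infty}^{\infty}\frac{(f^0)'(v)}{v-\omega}\,dv>-1 .$$ Let $h$ be the solution with $h(0,\cdot,\cdot)=h_0$ of the linearized system $$\begin{cases}\partial_t h+v\,\partial_x h+F(t,x)\,(f^0)'(v)=0,\\ F=W*\partial_x\rho,\\ \rho(t,x)=\int_{\mathbb R}h(t,x,v)\,dv,\end{cases}$$ where $W(x)=\frac1{2\pi}\log|\cot(x/2)|$ and $*$ is $2\pi$-periodic convolution in $x$. Let $r\ge1$ be an integer. Then there exist positive constants $\delta$ and $C$, depending on the initial data, such that for all $t\ge1$ $$\left\|\rho(t,\cdot)-\frac1{2\pi}\int_{\mathbb R}\int_0^{2\pi}h_0(x,v)\,dx\,dv\right\|_{C^r(0,2\pi)}\le Ce^{-\delta t}\quad\text{and}\quad \|F(t,\cdot)\|_{C^r(0,2\pi)}\le Ce^{-\delta t}.$$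
   Context: The setting is the Vlasov-Poisson system restricted to a great circle of the unit sphere $\mathbb S^2$: $\partial_tf+v\partial_xf+F\partial_vf=0$, $F=W*\partial_x\rho$, $\rho=\int_{\mathbb R}f\,dv$, with $x\in[0,2\pi)$ (periodic), $v\in\mathbb R$, $W(x)=\frac1{2\pi}\log|\cot(x/2)|$. Every $f^0(v)$ is a stationary solution of it, and the linearized system in the claim is obtained for the fluctuation $h=f-f^0$ by dropping the nonlinear term $F\,\partial_vh$. The norm is $\|u\|_{C^r(0,2\pi)}=\max_{0\le n\le r,\ 0<x<2\pi}|\partial_x^nu(x)|$; p.v. denotes the Cauchy principal value.
   Formalization: "Analytic" means holomorphic extension to a complex strip, with the extension of h_0 having uniformly bounded L^1 norms on horizontal lines in v, and (2) holds on the strip; with real analyticity alone the claim fails for f^0=0, h_0=cos x cos(v^2)/(1+v^2). *)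

theory Defs
  imports "HOL-Complex_Analysis.Complex_Analysis" "HOL-Library.Landau_Symbols"
begin

section \<open>Analytic data\<close>

definition strip :: "real \<Rightarrow> complex set" where
  "strip a = {z. \<bar>Im z\<bar> < a}"

definition holomorphic_extension :: "real \<Rightarrow> (real \<Rightarrow> real) \<Rightarrow> (complex \<Rightarrow> complex) \<Rightarrow> bool" where
  "holomorphic_extension a f G \<longleftrightarrow>
     G holomorphic_on strip a \<and> (\<forall>v. G (complex_of_real v) = complex_of_real (f v))"

text \<open>
  Holomorphy in two complex variables: joint continuity together with holomorphy in each
  variable separately (Osgood).
\<close>

definition holomorphic_extension2 ::
  "real \<Rightarrow> (real \<Rightarrow> real \<Rightarrow> real) \<Rightarrow> (complex \<Rightarrow> complex \<Rightarrow> complex) \<Rightarrow> bool" where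
  "holomorphic_extension2 a h H \<longleftrightarrow>
     continuous_on (strip a \<times> strip a) (\<lambda>(z, w). H z w) \<and>
     (\<forall>w\<in>strip a. (\<lambda>z. H z w) holomorphic_on strip a) \<and>
     (\<forall>z\<in>strip a. (\<lambda>w. H z w) holomorphic_on strip a) \<and>
     (\<forall>x v. H (complex_of_real x) (complex_of_real v) = complex_of_real (h x v))"

text \<open>
  Bound, uniform over the lines \<open>Im w = \<eta>\<close>, of the \<open>L\<^sup>1\<close> norm of \<open>H\<close> over one period in the
  (real) position variable and the whole line in the velocity variable. At \<open>\<eta> = 0\<close> it says
  that the perturbation itself is integrable. Strip analyticity without a decay condition of
  this kind does not give exponential decay: for the stationary state \<open>0\<close> and the perturbation
  \<open>cos x cos (v\<^sup>2) / (1 + v\<^sup>2)\<close> the density decays only like \<open>1 / t\<^sup>2\<close>.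
\<close>

definition integrable_on_lines :: "real \<Rightarrow> (complex \<Rightarrow> complex \<Rightarrow> complex) \<Rightarrow> bool" where
  "integrable_on_lines a H \<longleftrightarrow>
     (\<exists>M::real. \<forall>\<eta>. \<bar>\<eta>\<bar> < a \<longrightarrow>
        (\<integral>\<^sup>+p\<in>{0..2*pi} \<times> UNIV. ennreal (cmod (H (complex_of_real (fst p)) (Complex (snd p) \<eta>)))
           \<partial>(lborel :: (real \<times> real) measure)) \<le> ennreal M)"

section \<open>Principal values\<close>

definition has_cauchy_pv :: "(real \<Rightarrow> real) \<Rightarrow> real \<Rightarrow> real \<Rightarrow> bool" where
  "has_cauchy_pv g \<omega> P \<longleftrightarrow>
     (\<forall>\<epsilon>>0. set_integrable lborel {v. \<epsilon> < \<bar>v - \<omega>\<bar>} g) \<and>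
     ((\<lambda>\<epsilon>. LINT v:{v. \<epsilon> < \<bar>v - \<omega>\<bar>}|lborel. g v) \<longlongrightarrow> P) (at_right 0)"

section \<open>The linearized system\<close>

definition W :: "real \<Rightarrow> real" where
  "W x = 1 / (2*pi) * ln \<bar>cot (x / 2)\<bar>"

definition periodic_convolution :: "(real \<Rightarrow> real) \<Rightarrow> (real \<Rightarrow> real) \<Rightarrow> real \<Rightarrow> real" where
  "periodic_convolution w g x = (LINT y:{0..2*pi}|lborel. w (x - y) * g y)"

definition mass_density :: "(real \<Rightarrow> real \<Rightarrow> real \<Rightarrow> real) \<Rightarrow> real \<Rightarrow> real \<Rightarrow> real" where
  "mass_density h t x = (LINT v|lborel. h t x v)"

definition force :: "(real \<Rightarrow> real \<Rightarrow> real \<Rightarrow> real) \<Rightarrow> real \<Rightarrow> real \<Rightarrow> real" where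
  "force h t = periodic_convolution W (deriv (mass_density h t))"

text \<open>
  Classical solutions on \<open>[0, \<infinity>)\<close>. The integrability conditions make the density well defined
  and the total mass finite, the condition on the derivative of the density makes the force
  well defined and continuous. In the last clause \<open>ht\<close> and \<open>hx\<close> are the partial derivatives
  of \<open>h\<close> in time (one-sided at \<open>t = 0\<close>) and position.
\<close>

definition linearized_solution ::
  "(real \<Rightarrow> real) \<Rightarrow> (real \<Rightarrow> real \<Rightarrow> real) \<Rightarrow> (real \<Rightarrow> real \<Rightarrow> real \<Rightarrow> real) \<Rightarrow> bool" where
  "linearized_solution f0 h0 h \<longleftrightarrow>
     (\<forall>x v. h 0 x v = h0 x v) \<and>
     (\<forall>t\<ge>0. \<forall>x v. h t (x + 2*pi) v = h t x v) \<and>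
     (\<forall>t\<ge>0. set_integrable (lborel :: (real \<times> real) measure) ({0..2*pi} \<times> UNIV) (\<lambda>(x, v). h t x v)) \<and>
     (\<forall>t\<ge>0. \<forall>x. integrable lborel (\<lambda>v. h t x v)) \<and>
     (\<forall>t\<ge>0. \<forall>x. mass_density h t differentiable (at x)) \<and>
     continuous_on ({0..} \<times> UNIV) (\<lambda>(t, x). deriv (mass_density h t) x) \<and>
     (\<forall>t\<ge>0. \<forall>x v. \<exists>ht hx.
        ((\<lambda>(s, y). h s y v) has_derivative (\<lambda>(s, y). ht * s + hx * y)) (at (t, x) within {0..} \<times> UNIV) \<and>
        ht + v * hx + force h t x * deriv f0 v = 0)"

section \<open>The norm\<close>

text \<open>
  The norm is infinite on functions that are not \<open>r\<close> times continuously differentiable on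
  \<open>(0, 2\<pi>)\<close>, so that a finite bound includes this regularity. The maximum over the open
  interval is read as a supremum.
\<close>

definition Cr_norm :: "nat \<Rightarrow> (real \<Rightarrow> real) \<Rightarrow> ennreal" where
  "Cr_norm r u =
     (if (\<forall>n<r. (deriv ^^ n) u differentiable_on {0<..<2*pi}) \<and>
         continuous_on {0<..<2*pi} ((deriv ^^ r) u)
      then (SUP n\<in>{..r}. SUP x\<in>{0<..<2*pi}. ennreal \<bar>(deriv ^^ n) u x\<bar>)
      else \<infinity>)"

end

theory Submission
  imports Defs "HOL-Probability.Sinc_Integral"
begin

text \<open>
  The \<open>k\<close>-th Fourier coefficient in \<open>x\<close> turns \<open>W * \<partial>\<^sub>x\<close> into multiplication by \<open>\<i>\<close> for odd
  \<open>k > 0\<close> and by \<open>0\<close> for even \<open>k\<close>. Along characteristics the coefficients \<open>\<rho>\<^sub>k\<close> of the density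
  therefore solve, for odd \<open>k\<close> and after the rescaling \<open>\<tau> = k t\<close>, the Volterra equation
  \<open>q(\<tau>) = n(\<tau>) - (\<i> / k) \<integral> f0'(v) \<integral>\<^sub>0\<^sup>\<tau> exp(- \<i> v (\<tau> - s)) q(s) ds dv\<close>, whose source \<open>n\<close> decays
  exponentially because the initial datum is analytic and integrable on the lines of a strip; for
  even \<open>k\<close> one has \<open>q = n\<close>. Since \<open>f0'\<close> is only \<open>O(1 / v)\<close>, its Fourier transform is merely square
  integrable, and the inner integral is controlled by Bessel's inequality instead.

  Laplace transformation gives \<open>(k + \<Lambda>) Q = k N\<close> with \<open>\<Lambda>(\<omega>) = \<integral> f0'(v) / (v - \<omega>) dv\<close>, which continues
  analytically below the real axis by moving the line of integration. The Penrose condition keeps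
  \<open>k + \<Lambda>\<close> away from zero on \<open>Im \<omega> \<ge> - \<delta>\<close>, uniformly in \<open>k \<ge> 1\<close>. Inverting the transform
  \<open>N \<Lambda> / (k + \<Lambda>)\<close> of \<open>n - q\<close>, a product of two square integrable functions on each line, along
  \<open>Im \<omega> = - \<delta>\<close> yields \<open>\<rho>\<^sub>k(t) = O(exp(- \<delta> k t))\<close>. For \<open>t \<ge> 1\<close> the Fourier series of \<open>\<rho>\<close> and \<open>F\<close>
  then converge in a complex neighbourhood of the real line, and Cauchy's inequality bounds all
  derivatives.
\<close>

section \<open>Fourier integrals on the line\<close>

text \<open>The constants have to serve all \<open>k\<close> and every solution at once. The
  rescaling makes this possible: all \<open>k\<close> share one kernel, and \<open>k\<close>
  survives only as a coupling \<open>1 / k \<le> 1\<close>. A rate that is uniform in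
  \<open>k \<ge> 1\<close> then bounds the coefficients by powers of
  \<open>exp (- \<delta> t)\<close>, and for \<open>t \<ge> 1\<close> part of this geometric decay
  can be spent on a complex neighbourhood.

  The difference \<open>n - q\<close> is inverted rather than \<open>q\<close> because
  \<open>q\<close> may start with a jump, which leaves a transform of size
  \<open>1 / \<omega>\<close> that is not integrable; for \<open>n - q\<close> the factor
  \<open>\<Lambda>\<close> supplies the missing decay. Nor is the growth of a solution known in
  advance: a crude exponential bound must be drawn from the Volterra equation before
  \<open>q\<close> has a Laplace transform at all.

  The stability condition speaks only about real \<open>\<omega>\<close> with
  \<open>f0'(\<omega>) = 0\<close>. This is enough because on the real line the imaginary part of
  \<open>\<Lambda>\<close> is \<open>pi * f0'\<close>, so that \<open>\<Lambda>\<close> is real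
  exactly at these points, where the principal value is an ordinary integral.\<close>

lemma cis_measurable [measurable]: "cis \<in> borel_measurable borel"
  by (intro borel_measurable_continuous_onI continuous_intros)

text \<open>For a non-integrable \<open>f\<close> the Bochner integral is \<open>0\<close>, so the
  bound is unconditional and can be applied before integrability has been established.\<close>

lemma norm_integral_le_nn_integral:
  fixes f :: "'b \<Rightarrow> 'a::{banach, second_countable_topology}"
  shows "ennreal (norm (LINT x|M. f x)) \<le> (\<integral>\<^sup>+x. ennreal (norm (f x)) \<partial>M)"
  by (cases "integrable M f") (auto intro: integral_norm_bound_ennreal simp: not_integrable_integral_eq)

lemma norm_integral_le:
  fixes f :: "'b \<Rightarrow> 'a::{banach, second_countable_topology}"
  assumes B: "integrable M B" and le: "AE x in M. norm (f x) \<le> B x"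
  shows "norm (LINT x|M. f x) \<le> (LINT x|M. B x)"
proof -
  have B0: "AE x in M. 0 \<le> B x"
    using le by eventually_elim (rule order_trans[OF norm_ge_zero])
  have "ennreal (norm (LINT x|M. f x)) \<le> (\<integral>\<^sup>+x. ennreal (norm (f x)) \<partial>M)"
    by (rule norm_integral_le_nn_integral)
  also have "\<dots> \<le> (\<integral>\<^sup>+x. ennreal (B x) \<partial>M)"
    using le by (intro nn_integral_mono_AE) (auto elim!: eventually_mono intro: ennreal_leI)
  also have "\<dots> = ennreal (LINT x|M. B x)"
    by (rule nn_integral_eq_integral[OF B B0])
  finally show ?thesis
    using integral_nonneg_AE[OF B0] by simp
qed

text \<open>The Laplace transform of the constant \<open>1\<close>. At
  \<open>z = \<i> * (v - \<omega>)\<close> it produces the kernel \<open>1 / (v - \<omega>)\<close>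
  of the dispersion function.\<close>

lemma has_bochner_integral_exp_half_line:
  fixes z :: complex
  assumes "Re z > 0"
  shows "has_bochner_integral lborel (\<lambda>s. indicator {0..} s *\<^sub>R exp (- (z * of_real s))) (1 / z)"
proof -
  have lim: "((\<lambda>s::real. exp (- (z * of_real s))) \<longlongrightarrow> 0) at_top"
  proof (rule Lim_null_comparison)
    show "\<forall>\<^sub>F s in at_top. norm (exp (- (z * of_real s))) \<le> exp (- (Re z * s))"
      by (intro always_eventually) (simp add: norm_exp_eq_Re)
    show "((\<lambda>s::real. exp (- (Re z * s))) \<longlongrightarrow> 0) at_top"
      using assms by real_asymp
  qed
  have int: "set_integrable lborel {0..} (\<lambda>s::real. exp (- (z * of_real s)))"
  proof -
    have nn: "(\<integral>\<^sup>+s. ennreal (exp (- (Re z * s))) * indicator {0..} s \<partial>lborel) = ennreal (0 - (- 1 / Re z * exp (- (Re z * 0))))"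
    proof (rule nn_integral_FTC_atLeast)
      show "((\<lambda>s::real. - 1 / Re z * exp (- (Re z * s))) \<longlongrightarrow> 0) at_top"
        using assms by real_asymp
      show "\<And>x. 0 \<le> x \<Longrightarrow> DERIV (\<lambda>s. - 1 / Re z * exp (- (Re z * s))) x :> exp (- (Re z * x))"
        using assms by (auto intro!: derivative_eq_intros)
    qed auto
    show ?thesis unfolding set_integrable_def
    proof (rule integrableI_bounded)
      have "(\<integral>\<^sup>+ x. ennreal (norm (indicator {0..} x *\<^sub>R exp (- (z * complex_of_real x)))) \<partial>lborel)
         = (\<integral>\<^sup>+s. ennreal (exp (- (Re z * s))) * indicator {0..} s \<partial>lborel)"
        by (intro nn_integral_cong) (auto simp: indicator_def norm_exp_eq_Re)
      then show "(\<integral>\<^sup>+ x. ennreal (norm (indicator {0..} x *\<^sub>R exp (- (z * complex_of_real x)))) \<partial>lborel) < \<infinity>"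
        unfolding nn by simp
    qed simp
  qed
  have int': "set_integrable lborel (einterval 0 \<infinity>) (\<lambda>s::real. exp (- (z * of_real s)))"
    by (rule set_integrable_subset[OF int]) (auto simp: einterval_def)
  have "(LBINT s=0..\<infinity>. exp (- (z * of_real s))) = 0 - (- (1 / z))"
  proof (rule interval_integral_FTC_integrable[where F = "\<lambda>s. - exp (- (z * of_real s)) / z"])
    show "((\<lambda>s. - exp (- (z * of_real s)) / z) has_vector_derivative exp (- (z * of_real x))) (at x)" for x
    proof -
      have "((\<lambda>w. - exp (- (z * w)) / z) has_field_derivative exp (- (z * of_real x))) (at (of_real x))"
        using assms by (auto intro!: derivative_eq_intros)
      from has_vector_derivative_real_field[OF this] show ?thesis by (simp add: o_def)
    qed
    show "(((\<lambda>s. - exp (- (z * of_real s)) / z) \<circ> real_of_ereal) \<longlongrightarrow> - (1 / z)) (at_right 0)"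
      by (simp add: zero_ereal_def ereal_tendsto_simps)
         (rule tendsto_eq_intros | use assms in force)+
    show "(((\<lambda>s. - exp (- (z * of_real s)) / z) \<circ> real_of_ereal) \<longlongrightarrow> 0) (at_left \<infinity>)"
      unfolding ereal_tendsto_simps
      using tendsto_mult[OF lim tendsto_const[of "- (1 / z)"]] by (simp add: o_def)
  qed (use int' in \<open>auto intro!: continuous_intros\<close>)
  then have "(LINT s:{0<..}|lborel. exp (- (z * of_real s))) = 1 / z"
    by (simp add: interval_lebesgue_integral_0_infty)
  moreover have "(LINT s:{0<..}|lborel. exp (- (z * of_real s))) = (LINT s:{0..}|lborel. exp (- (z * of_real s)))"
    unfolding set_lebesgue_integral_def
    by (rule integral_cong_AE)
       (use AE_lborel_singleton[of 0] in \<open>auto elim!: eventually_mono simp: indicator_def\<close>)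
  ultimately show ?thesis using int
    by (simp add: set_integrable_def has_bochner_integral_iff set_lebesgue_integral_def)
qed

text \<open>The two half lines contribute \<open>1 / (e - \<i> y)\<close> and
  \<open>1 / (e + \<i> y)\<close>, which add up to twice the Poisson kernel. Abel summation of
  Fourier integrals is therefore Poisson averaging.\<close>

lemma has_bochner_integral_exp_abs:
  fixes e :: real
  assumes "e > 0"
  shows "has_bochner_integral lborel (\<lambda>x. exp (- e * \<bar>x\<bar>) *\<^sub>R cis (x * y)) (of_real (2 * e / (e\<^sup>2 + y\<^sup>2)))"
proof -
  let ?p = "Complex e (- y)" and ?q = "Complex e y"
  have p: "has_bochner_integral lborel (\<lambda>s. indicator {0..} s *\<^sub>R exp (- (?p * of_real s))) (1 / ?p)"
    and q: "has_bochner_integral lborel (\<lambda>s. indicator {0..} s *\<^sub>R exp (- (?q * of_real s))) (1 / ?q)"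
    by (rule has_bochner_integral_exp_half_line; use assms in simp)+
  have q': "has_bochner_integral lborel (\<lambda>s. indicator {0..} (- s) *\<^sub>R exp (- (?q * of_real (- s)))) (1 / ?q)"
    using lborel_has_bochner_integral_real_affine_iff[of "-1" "\<lambda>s. indicator {0..} s *\<^sub>R exp (- (?q * of_real s))" "1 / ?q" 0] q
    by simp
  have sum: "has_bochner_integral lborel (\<lambda>s. indicator {0..} s *\<^sub>R exp (- (?p * of_real s)) 
      + indicator {0..} (- s) *\<^sub>R exp (- (?q * of_real (- s)))) (1 / ?p + 1 / ?q)"
    by (rule has_bochner_integral_add[OF p q'])
  have val: "1 / ?p + 1 / ?q = of_real (2 * e / (e\<^sup>2 + y\<^sup>2))"
    using assms by (simp add: complex_eq_iff Re_divide Im_divide power2_eq_square add_divide_distrib)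
  have "exp (- e * \<bar>x\<bar>) *\<^sub>R cis (x * y) = indicator {0..} x *\<^sub>R exp (- (?p * of_real x)) 
      + indicator {0..} (- x) *\<^sub>R exp (- (?q * of_real (- x)))" if "x \<noteq> 0" for x
    using that by (cases "x > 0") (auto simp: exp_eq_polar algebra_simps scaleR_conv_of_real)
  then have "AE x in lborel. exp (- e * \<bar>x\<bar>) *\<^sub>R cis (x * y) = indicator {0..} x *\<^sub>R exp (- (?p * of_real x)) 
      + indicator {0..} (- x) *\<^sub>R exp (- (?q * of_real (- x)))"
    using AE_lborel_singleton[of 0] by (auto elim!: eventually_mono)
  then show ?thesis using sum unfolding val
    by (subst has_bochner_integral_cong_AE) (auto simp: has_bochner_integral_iff borel_measurable_integrable)
qed

lemma integrable_exp_abs: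
  fixes e :: real
  assumes "e > 0"
  shows "integrable lborel (\<lambda>x. exp (- e * \<bar>x\<bar>))"
proof -
  from has_bochner_integral_exp_abs[OF assms, of 0]
  have "integrable lborel (\<lambda>x. norm (exp (- e * \<bar>x\<bar>) *\<^sub>R cis (x * 0)))"
    by (intro integrable_norm) (auto simp: has_bochner_integral_iff)
  then show ?thesis by simp
qed

lemma has_bochner_integral_poisson_kernel:
  fixes e t :: real
  assumes "e > 0"
  shows "has_bochner_integral lborel (\<lambda>x. e / (e\<^sup>2 + (x - t)\<^sup>2)) pi"
proof -
  have *: "has_bochner_integral lborel (\<lambda>x::real. inverse (1 + x\<^sup>2)) pi"
    using integrable_inverse_1_plus_square LBINT_inverse_1_plus_square
    by (simp add: interval_lebesgue_integral_def set_integrable_def has_bochner_integral_iff set_lebesgue_integral_def)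
  have "has_bochner_integral lborel (\<lambda>x. e / (e\<^sup>2 + (x - t)\<^sup>2)) pi \<longleftrightarrow>
     has_bochner_integral lborel (\<lambda>x. e / (e\<^sup>2 + ((t + e * x) - t)\<^sup>2)) (pi /\<^sub>R \<bar>e\<bar>)"
    using assms by (subst lborel_has_bochner_integral_real_affine_iff[of e _ _ t]) auto
  also have "(\<lambda>x. e / (e\<^sup>2 + ((t + e * x) - t)\<^sup>2)) = (\<lambda>x. inverse (1 + x\<^sup>2) / e)"
  proof
    fix x :: real
    have "e\<^sup>2 + ((t + e * x) - t)\<^sup>2 = e * (e * (1 + x\<^sup>2))"
      by (simp add: power2_eq_square algebra_simps)
    then show "e / (e\<^sup>2 + ((t + e * x) - t)\<^sup>2) = inverse (1 + x\<^sup>2) / e"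
      using assms by (simp add: divide_simps)
  qed
  finally show ?thesis using has_bochner_integral_divide_zero[OF *, of e] assms by (simp add: field_simps)
qed

text \<open>Substituting \<open>t + e * x\<close> for \<open>x\<close> freezes the kernel to
  \<open>1 / (1 + x\<^sup>2)\<close> and moves only the argument of \<open>f\<close>, so that
  dominated convergence applies. Besides Fourier inversion, this serves for the boundary values of
  the dispersion function.\<close>

lemma poisson_kernel_tendsto:
  fixes f :: "real \<Rightarrow> complex"
  assumes [measurable]: "f \<in> borel_measurable borel"
    and bnd: "\<And>x. norm (f x) \<le> B" and cont: "isCont f t"
  shows "((\<lambda>e. LINT x|lborel. (e / (e\<^sup>2 + (x - t)\<^sup>2)) *\<^sub>R f x) \<longlongrightarrow> pi *\<^sub>R f t) (at_right 0)"
proof -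
  have *: "has_bochner_integral lborel (\<lambda>x::real. inverse (1 + x\<^sup>2)) pi"
    using has_bochner_integral_poisson_kernel[of 1 0] by (simp add: divide_inverse)
  have eq: "(LINT x|lborel. (e / (e\<^sup>2 + (x - t)\<^sup>2)) *\<^sub>R f x) = (LINT x|lborel. inverse (1 + x\<^sup>2) *\<^sub>R f (t + e * x))"
    if "e > 0" for e
  proof -
    have "(LINT x|lborel. (e / (e\<^sup>2 + (x - t)\<^sup>2)) *\<^sub>R f x) =
      \<bar>e\<bar> *\<^sub>R (LINT x|lborel. (e / (e\<^sup>2 + ((t + e * x) - t)\<^sup>2)) *\<^sub>R f (t + e * x))"
      using that by (subst lborel_integral_real_affine[of e _ t]) auto
    also have "\<dots> = (LINT x|lborel. \<bar>e\<bar> *\<^sub>R ((e / (e\<^sup>2 + ((t + e * x) - t)\<^sup>2)) *\<^sub>R f (t + e * x)))"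
      by (rule integral_scaleR_right[symmetric])
    also have "\<dots> = (LINT x|lborel. inverse (1 + x\<^sup>2) *\<^sub>R f (t + e * x))"
    proof (intro Bochner_Integration.integral_cong refl)
      fix x :: real
      have "e\<^sup>2 + ((t + e * x) - t)\<^sup>2 = e * (e * (1 + x\<^sup>2))"
        by (simp add: power2_eq_square algebra_simps)
      then have "\<bar>e\<bar> * (e / (e\<^sup>2 + ((t + e * x) - t)\<^sup>2)) = inverse (1 + x\<^sup>2)"
        using that by (simp add: divide_simps)
      then show "\<bar>e\<bar> *\<^sub>R ((e / (e\<^sup>2 + ((t + e * x) - t)\<^sup>2)) *\<^sub>R f (t + e * x)) = inverse (1 + x\<^sup>2) *\<^sub>R f (t + e * x)"
        by simp
    qed
    finally show ?thesis .
  qed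
  have "((\<lambda>e. LINT x|lborel. inverse (1 + x\<^sup>2) *\<^sub>R f (t + e * x)) \<longlongrightarrow> pi *\<^sub>R f t) (at_right 0)"
    unfolding tendsto_at_iff_sequentially o_def
  proof safe
    fix X :: "nat \<Rightarrow> real" assume X: "X \<longlonglongrightarrow> 0"
    have "(\<lambda>n. LINT x|lborel. inverse (1 + x\<^sup>2) *\<^sub>R f (t + X n * x)) \<longlonglongrightarrow> (LINT x|lborel. inverse (1 + x\<^sup>2) *\<^sub>R f t)"
    proof (rule integral_dominated_convergence[where w = "\<lambda>x. inverse (1 + x\<^sup>2) * B"])
      show "integrable lborel (\<lambda>x. inverse (1 + x\<^sup>2) * B)"
        using * by (intro integrable_mult_left) (auto simp: has_bochner_integral_iff)
      show "AE x in lborel. (\<lambda>n. inverse (1 + x\<^sup>2) *\<^sub>R f (t + X n * x)) \<longlonglongrightarrow> inverse (1 + x\<^sup>2) *\<^sub>R f t"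
      proof (intro AE_I2 tendsto_intros isCont_tendsto_compose[OF cont])
        fix x show "(\<lambda>n. t + X n * x) \<longlonglongrightarrow> t"
          using tendsto_add[OF tendsto_const[of t] tendsto_mult[OF X tendsto_const[of x]]] by simp
      qed
      show "AE x in lborel. norm (inverse (1 + x\<^sup>2) *\<^sub>R f (t + X n * x)) \<le> inverse (1 + x\<^sup>2) * B" for n
        using bnd by (auto intro!: AE_I2 mult_left_mono)
    qed auto
    also have "(LINT x|lborel. inverse (1 + x\<^sup>2) *\<^sub>R f t) = pi *\<^sub>R f t"
      using has_bochner_integral_scaleR_left[OF *, of "f t"] by (auto simp: has_bochner_integral_iff)
    finally show "(\<lambda>n. LINT x|lborel. inverse (1 + x\<^sup>2) *\<^sub>R f (t + X n * x)) \<longlonglongrightarrow> pi *\<^sub>R f t" .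
  qed
  moreover have "\<forall>\<^sub>F e in at_right (0::real). (LINT x|lborel. inverse (1 + x\<^sup>2) *\<^sub>R f (t + e * x)) =
      (LINT x|lborel. (e / (e\<^sup>2 + (x - t)\<^sup>2)) *\<^sub>R f x)"
    using eq by (intro eventually_at_right_less[THEN eventually_mono]) auto
  ultimately show ?thesis by (rule Lim_transform_eventually)
qed

section \<open>Abel summation, Fourier inversion and Bessel's inequality\<close>

definition fourier :: "(real \<Rightarrow> complex) \<Rightarrow> real \<Rightarrow> complex" where
  "fourier f x = (LINT s|lborel. cis (x * s) * f s)"

lemma fourier_measurable [measurable]:
  assumes [measurable]: "f \<in> borel_measurable borel"
  shows "fourier f \<in> borel_measurable borel"
  unfolding fourier_def[abs_def] by measurable

lemma integrable_cis_mult: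
  assumes "integrable lborel f"
  shows "integrable lborel (\<lambda>s. cis (x * s) * f s)"
proof -
  have [measurable]: "f \<in> borel_measurable borel"
    using assms borel_measurable_integrable by force
  show ?thesis by (rule Bochner_Integration.integrable_bound[OF assms]) (auto simp: norm_mult)
qed

lemma norm_fourier_le:
  assumes "integrable lborel f"
  shows "norm (fourier f x) \<le> (LINT s|lborel. norm (f s))"
  unfolding fourier_def
  by (rule order_trans[OF integral_norm_bound]) (simp add: norm_mult)

text \<open>The factor \<open>exp (- e * \<bar>x\<bar>)\<close> makes the double integral absolutely
  convergent, so the order can be exchanged and the \<open>x\<close>-integral becomes twice the
  Poisson kernel. Both the inversion formula and Bessel's inequality are obtained from this identity
  as \<open>e\<close> tends to \<open>0\<close>.\<close>

lemma fourier_abel: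
  fixes f :: "real \<Rightarrow> complex"
  assumes f: "integrable lborel f" and e: "e > 0"
  shows "(LINT x|lborel. exp (- e * \<bar>x\<bar>) *\<^sub>R (cis (- x * t) * fourier f x)) =
         (LINT s|lborel. (2 * (e / (e\<^sup>2 + (s - t)\<^sup>2))) *\<^sub>R f s)"
proof -
  have [measurable]: "f \<in> borel_measurable borel"
    using f borel_measurable_integrable by force
  have ie: "integrable lborel (\<lambda>x. exp (- e * \<bar>x\<bar>))" by (rule integrable_exp_abs[OF e])
  have int: "integrable (lborel \<Otimes>\<^sub>M lborel) (\<lambda>(x, s). exp (- e * \<bar>x\<bar>) *\<^sub>R (cis (x * (s - t)) * f s))"
  proof (rule lborel_pair.Fubini_integrable)
    show "integrable lborel (\<lambda>x. LINT s|lborel. norm (case (x, s) of (x, s) \<Rightarrow> exp (- e * \<bar>x\<bar>) *\<^sub>R (cis (x * (s - t)) * f s)))"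
      using integrable_mult_left[OF ie, of "LINT s|lborel. norm (f s)"] by (simp add: norm_mult)
    show "AE x in lborel. integrable lborel (\<lambda>s. case (x, s) of (x, s) \<Rightarrow> exp (- e * \<bar>x\<bar>) *\<^sub>R (cis (x * (s - t)) * f s))"
      by (intro AE_I2) (auto intro!: Bochner_Integration.integrable_bound[OF f] AE_I2 mult_left_le_one_le simp: norm_mult e less_imp_le)
  qed measurable
  have "(LINT x|lborel. exp (- e * \<bar>x\<bar>) *\<^sub>R (cis (- x * t) * fourier f x)) =
    (LINT x|lborel. LINT s|lborel. exp (- e * \<bar>x\<bar>) *\<^sub>R (cis (x * (s - t)) * f s))"
  proof (intro Bochner_Integration.integral_cong refl)
    fix x :: real
    have "exp (- e * \<bar>x\<bar>) *\<^sub>R (cis (- x * t) * fourier f x) = (LINT s|lborel. exp (- e * \<bar>x\<bar>) *\<^sub>R (cis (- x * t) * (cis (x * s) * f s)))"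
      unfolding fourier_def by simp
    also have "\<dots> = (LINT s|lborel. exp (- e * \<bar>x\<bar>) *\<^sub>R (cis (x * (s - t)) * f s))"
      by (intro Bochner_Integration.integral_cong refl) (simp add: cis_mult algebra_simps flip: mult.assoc)
    finally show "exp (- e * \<bar>x\<bar>) *\<^sub>R (cis (- x * t) * fourier f x) = (LINT s|lborel. exp (- e * \<bar>x\<bar>) *\<^sub>R (cis (x * (s - t)) * f s))" .
  qed
  also have "\<dots> = (LINT s|lborel. LINT x|lborel. exp (- e * \<bar>x\<bar>) *\<^sub>R (cis (x * (s - t)) * f s))"
    by (rule lborel_pair.Fubini_integral[symmetric, OF int])
  also have "\<dots> = (LINT s|lborel. (2 * (e / (e\<^sup>2 + (s - t)\<^sup>2))) *\<^sub>R f s)"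
  proof (intro Bochner_Integration.integral_cong refl)
    fix s
    have "(LINT x|lborel. exp (- e * \<bar>x\<bar>) *\<^sub>R (cis (x * (s - t)) * f s)) = (LINT x|lborel. (exp (- e * \<bar>x\<bar>) *\<^sub>R cis (x * (s - t))) * f s)"
      by simp
    also have "\<dots> = of_real (2 * e / (e\<^sup>2 + (s - t)\<^sup>2)) * f s"
      using has_bochner_integral_exp_abs[OF e, of "s - t"] 
      by (intro has_bochner_integral_integral_eq has_bochner_integral_mult_left) auto
    finally show "(LINT x|lborel. exp (- e * \<bar>x\<bar>) *\<^sub>R (cis (x * (s - t)) * f s)) = (2 * (e / (e\<^sup>2 + (s - t)\<^sup>2))) *\<^sub>R f s"
      by (simp add: scaleR_conv_of_real)
  qed
  finally show ?thesis .
qed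

text \<open>At a point of continuity the Poisson averages of \<open>fourier_abel\<close> converge to
  \<open>2 * pi\<close> times the value; integrability of the transform removes the Abel factor by
  dominated convergence. The pointwise form suits functions that are cut off at the origin.\<close>

theorem fourier_inversion:
  fixes f :: "real \<Rightarrow> complex"
  assumes f: "integrable lborel f" and bnd: "\<And>x. norm (f x) \<le> B" and cont: "isCont f t"
    and ff: "integrable lborel (fourier f)"
  shows "(LINT x|lborel. cis (- x * t) * fourier f x) = (2 * pi) *\<^sub>R f t"
proof -
  have [measurable]: "f \<in> borel_measurable borel"
    using f borel_measurable_integrable by force
  have "((\<lambda>e. 2 *\<^sub>R (LINT s|lborel. (e / (e\<^sup>2 + (s - t)\<^sup>2)) *\<^sub>R f s)) \<longlongrightarrow> 2 *\<^sub>R (pi *\<^sub>R f t)) (at_right 0)"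
    by (intro tendsto_scaleR tendsto_const poisson_kernel_tendsto[OF _ bnd cont]) auto
  moreover have "\<forall>\<^sub>F e in at_right 0. 2 *\<^sub>R (LINT s|lborel. (e / (e\<^sup>2 + (s - t)\<^sup>2)) *\<^sub>R f s) =
      (LINT x|lborel. exp (- e * \<bar>x\<bar>) *\<^sub>R (cis (- x * t) * fourier f x))"
    using eventually_at_right_less[of 0]
  proof eventually_elim
    case (elim e)
    then show ?case
      by (subst fourier_abel[OF f]) (simp_all only: integral_scaleR_right[symmetric] scaleR_scaleR)
  qed
  ultimately have "((\<lambda>e. LINT x|lborel. exp (- e * \<bar>x\<bar>) *\<^sub>R (cis (- x * t) * fourier f x)) \<longlongrightarrow> 2 *\<^sub>R (pi *\<^sub>R f t)) (at_right 0)"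
    by (rule Lim_transform_eventually)
  moreover have "((\<lambda>e. LINT x|lborel. exp (- e * \<bar>x\<bar>) *\<^sub>R (cis (- x * t) * fourier f x)) \<longlongrightarrow> (LINT x|lborel. cis (- x * t) * fourier f x)) (at_right 0)"
    unfolding tendsto_at_iff_sequentially o_def
  proof safe
    fix X :: "nat \<Rightarrow> real" assume X: "X \<longlonglongrightarrow> 0" "\<forall>i. X i \<in> {0<..} - {0}"
    show "(\<lambda>n. LINT x|lborel. exp (- X n * \<bar>x\<bar>) *\<^sub>R (cis (- x * t) * fourier f x)) \<longlonglongrightarrow> (LINT x|lborel. cis (- x * t) * fourier f x)"
    proof (rule integral_dominated_convergence[where w = "\<lambda>x. norm (fourier f x)"])
      show "AE x in lborel. (\<lambda>n. exp (- X n * \<bar>x\<bar>) *\<^sub>R (cis (- x * t) * fourier f x)) \<longlonglongrightarrow> cis (- x * t) * fourier f x"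
      proof (intro AE_I2)
        fix x
        have "(\<lambda>n. exp (- X n * \<bar>x\<bar>) *\<^sub>R (cis (- x * t) * fourier f x)) \<longlonglongrightarrow> exp (- 0 * \<bar>x\<bar>) *\<^sub>R (cis (- x * t) * fourier f x)"
          by (intro tendsto_intros X)
        then show "(\<lambda>n. exp (- X n * \<bar>x\<bar>) *\<^sub>R (cis (- x * t) * fourier f x)) \<longlonglongrightarrow> cis (- x * t) * fourier f x" by simp
      qed
      show "AE x in lborel. norm (exp (- X n * \<bar>x\<bar>) *\<^sub>R (cis (- x * t) * fourier f x)) \<le> norm (fourier f x)" for n
        using X(2)[rule_format, of n] by (intro AE_I2) (auto simp: norm_mult intro!: mult_left_le_one_le)
    qed (use ff in auto)
  qed
  ultimately have "2 *\<^sub>R (pi *\<^sub>R f t) = (LINT x|lborel. cis (- x * t) * fourier f x)"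
    by (intro tendsto_unique[OF trivial_limit_at_right_real])
  then show ?thesis by simp
qed

text \<open>With the Abel factor inserted, the square integral is a quadratic form in
  \<open>f\<close> whose kernel is twice the Poisson kernel. That kernel is symmetric and has mass
  \<open>2 * pi\<close> in each variable, so Schur's test bounds the form uniformly in
  \<open>e\<close>, and Fatou's lemma lets \<open>e\<close> tend to \<open>0\<close>.\<close>

theorem fourier_bessel:
  fixes f :: "real \<Rightarrow> complex"
  assumes f: "integrable lborel f" and f2: "integrable lborel (\<lambda>x. (norm (f x))\<^sup>2)"
  shows "(\<integral>\<^sup>+x. ennreal ((norm (fourier f x))\<^sup>2) \<partial>lborel) \<le> ennreal (2 * pi * (LINT x|lborel. (norm (f x))\<^sup>2))"
proof -
  have [measurable]: "f \<in> borel_measurable borel"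
    using f borel_measurable_integrable by force
  have [measurable]: "(\<lambda>x. cnj (f x)) \<in> borel_measurable borel"
    using borel_measurable_continuous_on[OF continuous_on_cnj[OF continuous_on_id], of f borel] by simp
  let ?S = "LINT x|lborel. (norm (f x))\<^sup>2"
  have abel: "(\<integral>\<^sup>+x. ennreal (exp (- e * \<bar>x\<bar>) * (norm (fourier f x))\<^sup>2) \<partial>lborel) \<le> ennreal (2 * pi * ?S)"
    if e: "e > 0" for e
  proof -
    have ie: "integrable lborel (\<lambda>x. exp (- e * \<bar>x\<bar>))" by (rule integrable_exp_abs[OF e])
    define N where "N = (LINT s|lborel. norm (f s))"
    have N: "norm (fourier f x) \<le> N" for x unfolding N_def by (rule norm_fourier_le[OF f])
    have N0: "N \<ge> 0" unfolding N_def by simp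
    have ief: "integrable lborel (\<lambda>x. exp (- e * \<bar>x\<bar>) * (norm (fourier f x))\<^sup>2)"
    proof (rule Bochner_Integration.integrable_bound)
      show "integrable lborel (\<lambda>x. exp (- e * \<bar>x\<bar>) * N\<^sup>2)" using ie by (rule integrable_mult_left)
      show "AE x in lborel. norm (exp (- e * \<bar>x\<bar>) * (norm (fourier f x))\<^sup>2) \<le> norm (exp (- e * \<bar>x\<bar>) * N\<^sup>2)"
        using N by (auto intro!: AE_I2 mult_left_mono power_mono)
    qed measurable
    have int: "integrable (lborel \<Otimes>\<^sub>M lborel) (\<lambda>(x, t). exp (- e * \<bar>x\<bar>) *\<^sub>R (cis (- x * t) * fourier f x * cnj (f t)))"
    proof (rule lborel_pair.Fubini_integrable)
      have "integrable lborel (\<lambda>x. exp (- e * \<bar>x\<bar>) * (norm (fourier f x) * N))"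
      proof (rule Bochner_Integration.integrable_bound)
        show "integrable lborel (\<lambda>x. exp (- e * \<bar>x\<bar>) * (N * N))" using ie by (rule integrable_mult_left)
        show "AE x in lborel. norm (exp (- e * \<bar>x\<bar>) * (norm (fourier f x) * N)) \<le> norm (exp (- e * \<bar>x\<bar>) * (N * N))"
          using N N0 by (auto intro!: AE_I2 mult_left_mono mult_right_mono simp: abs_mult)
      qed measurable
      then show "integrable lborel (\<lambda>x. LINT t|lborel. norm (case (x, t) of (x, t) \<Rightarrow> exp (- e * \<bar>x\<bar>) *\<^sub>R (cis (- x * t) * fourier f x * cnj (f t))))"
        by (simp add: norm_mult N_def)
      show "AE x in lborel. integrable lborel (\<lambda>t. case (x, t) of (x, t) \<Rightarrow> exp (- e * \<bar>x\<bar>) *\<^sub>R (cis (- x * t) * fourier f x * cnj (f t)))"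
      proof (intro AE_I2)
        fix x
        have "integrable lborel (\<lambda>t. (exp (- e * \<bar>x\<bar>) *\<^sub>R fourier f x) * (cis (- x * t) * cnj (f t)))"
          by (intro integrable_mult_right integrable_cis_mult integrable_cnj f)
        then show "integrable lborel (\<lambda>t. case (x, t) of (x, t) \<Rightarrow> exp (- e * \<bar>x\<bar>) *\<^sub>R (cis (- x * t) * fourier f x * cnj (f t)))"
          by (simp add: mult_ac)
      qed
    qed measurable
    have "of_real (LINT x|lborel. exp (- e * \<bar>x\<bar>) * (norm (fourier f x))\<^sup>2)
       = (LINT x|lborel. complex_of_real (exp (- e * \<bar>x\<bar>) * (norm (fourier f x))\<^sup>2))"
      by (rule integral_of_real[OF ief, symmetric])
    also have "\<dots> = (LINT x|lborel. LINT t|lborel. exp (- e * \<bar>x\<bar>) *\<^sub>R (cis (- x * t) * fourier f x * cnj (f t)))"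
    proof (intro Bochner_Integration.integral_cong refl)
      fix x
      have "(LINT t|lborel. exp (- e * \<bar>x\<bar>) *\<^sub>R (cis (- x * t) * fourier f x * cnj (f t)))
         = (LINT t|lborel. (exp (- e * \<bar>x\<bar>) *\<^sub>R fourier f x) * cnj (cis (x * t) * f t))"
        by (intro Bochner_Integration.integral_cong refl) (simp add: cis_cnj mult_ac)
      also have "\<dots> = (exp (- e * \<bar>x\<bar>) *\<^sub>R fourier f x) * cnj (fourier f x)"
        unfolding fourier_def by (simp only: integral_mult_right_zero Bochner_Integration.integral_cnj)
      finally show "complex_of_real (exp (- e * \<bar>x\<bar>) * (norm (fourier f x))\<^sup>2) =
         (LINT t|lborel. exp (- e * \<bar>x\<bar>) *\<^sub>R (cis (- x * t) * fourier f x * cnj (f t)))"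
        by (simp only: mult_scaleR_left complex_norm_square of_real_mult scaleR_conv_of_real mult.assoc)
    qed
    also have "\<dots> = (LINT t|lborel. LINT x|lborel. exp (- e * \<bar>x\<bar>) *\<^sub>R (cis (- x * t) * fourier f x * cnj (f t)))"
      by (rule lborel_pair.Fubini_integral[symmetric, OF int])
    also have "\<dots> = (LINT t|lborel. (LINT x|lborel. exp (- e * \<bar>x\<bar>) *\<^sub>R (cis (- x * t) * fourier f x)) * cnj (f t))"
      by (intro Bochner_Integration.integral_cong refl) (simp flip: integral_mult_left_zero)
    also have "\<dots> = (LINT t|lborel. (LINT s|lborel. (2 * (e / (e\<^sup>2 + (s - t)\<^sup>2))) *\<^sub>R f s) * cnj (f t))"
      by (simp only: fourier_abel[OF f e])
    also have "\<dots> = (LINT t|lborel. LINT s|lborel. ((2 * (e / (e\<^sup>2 + (s - t)\<^sup>2))) *\<^sub>R f s) * cnj (f t))"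
      by (simp only: integral_mult_left_zero)
    finally have eq: "complex_of_real (LINT x|lborel. exp (- e * \<bar>x\<bar>) * (norm (fourier f x))\<^sup>2) = \<dots>" .
    define K where "K = (\<lambda>s t::real. 2 * (e / (e\<^sup>2 + (s - t)\<^sup>2)))"
    have [measurable]: "(\<lambda>(s,t). K s t) \<in> borel_measurable (borel \<Otimes>\<^sub>M borel)" unfolding K_def by measurable
    have K0: "K s t \<ge> 0" for s t using e by (simp add: K_def)
    have Kint: "(\<integral>\<^sup>+s. ennreal (K s t) \<partial>lborel) = ennreal (2 * pi)" for t
    proof -
      have "has_bochner_integral lborel (\<lambda>s. K s t) (2 * pi)"
        unfolding K_def by (intro has_bochner_integral_mult_right has_bochner_integral_poisson_kernel e)
      then show ?thesis using K0 by (subst nn_integral_eq_integral) (auto simp: has_bochner_integral_iff)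
    qed
    have Ksym: "K s t = K t s" for s t by (simp add: K_def power2_commute)
    have S: "(\<integral>\<^sup>+s. ennreal ((norm (f s))\<^sup>2) \<partial>lborel) = ennreal ?S"
      using f2 by (subst nn_integral_eq_integral) auto
    have half: "(\<integral>\<^sup>+t. \<integral>\<^sup>+s. ennreal (K s t) * ennreal ((norm (f t))\<^sup>2) \<partial>lborel \<partial>lborel) = ennreal (2 * pi) * ennreal ?S"
      by (simp add: nn_integral_multc Kint nn_integral_cmult S)
    have half': "(\<integral>\<^sup>+t. \<integral>\<^sup>+s. ennreal (K s t) * ennreal ((norm (f s))\<^sup>2) \<partial>lborel \<partial>lborel) = ennreal (2 * pi) * ennreal ?S"
    proof -
      have "(\<integral>\<^sup>+t. \<integral>\<^sup>+s. ennreal (K s t) * ennreal ((norm (f s))\<^sup>2) \<partial>lborel \<partial>lborel) =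
        (\<integral>\<^sup>+s. \<integral>\<^sup>+t. ennreal (K s t) * ennreal ((norm (f s))\<^sup>2) \<partial>lborel \<partial>lborel)"
        by (rule lborel_pair.Fubini') measurable
      also have "\<dots> = (\<integral>\<^sup>+s. \<integral>\<^sup>+t. ennreal (K t s) * ennreal ((norm (f s))\<^sup>2) \<partial>lborel \<partial>lborel)"
        by (subst Ksym) simp
      finally show ?thesis using half by simp
    qed
    have "(\<integral>\<^sup>+x. ennreal (exp (- e * \<bar>x\<bar>) * (norm (fourier f x))\<^sup>2) \<partial>lborel)
       = ennreal (LINT x|lborel. exp (- e * \<bar>x\<bar>) * (norm (fourier f x))\<^sup>2)"
      by (rule nn_integral_eq_integral[OF ief]) simp
    also have "\<dots> = ennreal (norm (complex_of_real (LINT x|lborel. exp (- e * \<bar>x\<bar>) * (norm (fourier f x))\<^sup>2)))"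
      by simp
    also have "\<dots> = ennreal (norm (LINT t|lborel. LINT s|lborel. (K s t *\<^sub>R f s) * cnj (f t)))"
      unfolding eq K_def ..
    also have "\<dots> \<le> (\<integral>\<^sup>+t. norm (LINT s|lborel. (K s t *\<^sub>R f s) * cnj (f t)) \<partial>lborel)"
      by (rule norm_integral_le_nn_integral)
    also have "\<dots> \<le> (\<integral>\<^sup>+t. \<integral>\<^sup>+s. norm ((K s t *\<^sub>R f s) * cnj (f t)) \<partial>lborel \<partial>lborel)"
      by (intro nn_integral_mono norm_integral_le_nn_integral)
    \<comment> \<open>Schur's test: the product \<open>norm (f s) * norm (f t)\<close> is split into
      half the sum of the squares, so that each summand depends on one variable and the kernel
      integrates out in the other.\<close>
    also have "\<dots> \<le> (\<integral>\<^sup>+t. \<integral>\<^sup>+s. (ennreal (K s t) * ennreal ((norm (f t))\<^sup>2) + ennreal (K s t) * ennreal ((norm (f s))\<^sup>2)) * ennreal (1/2) \<partial>lborel \<partial>lborel)"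
    proof (intro nn_integral_mono)
      fix s t
      have "norm (f s) * norm (f t) \<le> ((norm (f t))\<^sup>2 + (norm (f s))\<^sup>2) * (1/2)"
        using sum_squares_bound[of "norm (f s)" "norm (f t)"] by simp
      then have "K s t * (norm (f s) * norm (f t)) \<le> K s t * (((norm (f t))\<^sup>2 + (norm (f s))\<^sup>2) * (1/2))"
        using K0 by (rule mult_left_mono)
      then have "norm ((K s t *\<^sub>R f s) * cnj (f t)) \<le> (K s t * (norm (f t))\<^sup>2 + K s t * (norm (f s))\<^sup>2) * (1/2)"
        using K0[of s t] by (simp add: norm_mult algebra_simps)
      then have "ennreal (norm ((K s t *\<^sub>R f s) * cnj (f t))) \<le> ennreal ((K s t * (norm (f t))\<^sup>2 + K s t * (norm (f s))\<^sup>2) * (1/2))"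
        by (rule ennreal_leI)
      also have "\<dots> = (ennreal (K s t) * ennreal ((norm (f t))\<^sup>2) + ennreal (K s t) * ennreal ((norm (f s))\<^sup>2)) * ennreal (1/2)"
        using K0[of s t] by (simp only: ennreal_mult ennreal_plus mult_nonneg_nonneg add_nonneg_nonneg zero_le_power2 zero_le_divide_1_iff zero_le_numeral)
      finally show "ennreal (norm ((K s t *\<^sub>R f s) * cnj (f t))) \<le> (ennreal (K s t) * ennreal ((norm (f t))\<^sup>2) + ennreal (K s t) * ennreal ((norm (f s))\<^sup>2)) * ennreal (1/2)" .
    qed
    also have "\<dots> = (ennreal (2 * pi) * ennreal ?S + ennreal (2 * pi) * ennreal ?S) * ennreal (1/2)"
      by (subst half[symmetric], subst half'[symmetric]) (simp add: nn_integral_multc nn_integral_add)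
    also have "\<dots> = ennreal (2 * pi * ?S)"
      by (simp only: ennreal_mult[symmetric] ennreal_plus[symmetric] integral_nonneg_AE[OF AE_I2] zero_le_power2
          pi_ge_zero mult_nonneg_nonneg zero_le_numeral add_nonneg_nonneg zero_le_divide_1_iff) simp
    finally show ?thesis .
  qed
  have "(\<integral>\<^sup>+x. ennreal ((norm (fourier f x))\<^sup>2) \<partial>lborel) =
    (\<integral>\<^sup>+x. liminf (\<lambda>n. ennreal (exp (- (1 / real (Suc n)) * \<bar>x\<bar>) * (norm (fourier f x))\<^sup>2)) \<partial>lborel)"
  proof (intro nn_integral_cong)
    fix x
    have "(\<lambda>n. exp (- (1 / real (Suc n)) * \<bar>x\<bar>) * (norm (fourier f x))\<^sup>2) \<longlonglongrightarrow> exp (- 0 * \<bar>x\<bar>) * (norm (fourier f x))\<^sup>2"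
      by (intro tendsto_intros LIMSEQ_Suc[OF lim_1_over_n])
    then have "(\<lambda>n. ennreal (exp (- (1 / real (Suc n)) * \<bar>x\<bar>) * (norm (fourier f x))\<^sup>2)) \<longlonglongrightarrow> ennreal ((norm (fourier f x))\<^sup>2)"
      by (intro tendsto_ennrealI) simp
    from lim_imp_Liminf[OF _ this] 
    show "ennreal ((norm (fourier f x))\<^sup>2) = liminf (\<lambda>n. ennreal (exp (- (1 / real (Suc n)) * \<bar>x\<bar>) * (norm (fourier f x))\<^sup>2))"
      by simp
  qed
  also have "\<dots> \<le> liminf (\<lambda>n. \<integral>\<^sup>+x. ennreal (exp (- (1 / real (Suc n)) * \<bar>x\<bar>) * (norm (fourier f x))\<^sup>2) \<partial>lborel)"
    by (rule nn_integral_liminf) measurable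
  also have "\<dots> \<le> ennreal (2 * pi * ?S)"
    by (rule Liminf_le, simp, intro always_eventually allI abel, simp)
  finally show ?thesis .
qed

section \<open>Holomorphic parameter integrals and shifting lines in a strip\<close>

text \<open>Cauchy's inequality on circles of radius \<open>r / 4\<close> around the points of the
  half disc. A bound on values becomes a bound on difference quotients, which is the majorant needed
  for differentiation under an integral.\<close>

lemma holomorphic_lipschitz_bound:
  fixes f :: "complex \<Rightarrow> complex"
  assumes hol: "f holomorphic_on ball z r" and r: "r > 0"
    and bnd: "\<And>w. w \<in> ball z r \<Longrightarrow> norm (f w) \<le> B"
    and w: "dist w z \<le> r / 2"
  shows "norm (f w - f z) \<le> (4 * B / r) * norm (w - z)"
proof (rule field_differentiable_bound[OF convex_cball[of z "r / 2"]])
  fix u assume u: "u \<in> cball z (r / 2)"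
  have sub: "cball u (r / 4) \<subseteq> ball z r"
  proof
    fix w assume "w \<in> cball u (r / 4)"
    then show "w \<in> ball z r"
      using u r dist_triangle[of z w u] by auto
  qed
  have "norm ((deriv ^^ 1) f u) \<le> fact 1 * B / (r / 4) ^ 1"
  proof (rule Cauchy_inequality)
    show "f holomorphic_on ball u (r / 4)"
      using hol sub ball_subset_cball holomorphic_on_subset by blast
    show "continuous_on (cball u (r / 4)) f"
      using hol sub holomorphic_on_imp_continuous_on holomorphic_on_subset by blast
    show "norm (f x) \<le> B" if "norm (u - x) = r / 4" for x
    proof (rule bnd)
      show "x \<in> ball z r" using that sub by (auto simp: dist_norm)
    qed
  qed (use r in auto)
  then show "norm (deriv f u) \<le> 4 * B / r" by (simp add: mult.commute)
  have "u \<in> ball z r" using u r by auto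
  then show "(f has_field_derivative deriv f u) (at u within cball z (r / 2))"
    using hol holomorphic_derivI[OF hol] by auto
qed (use w r in \<open>auto simp: dist_commute\<close>)

text \<open>A local majorant of the values suffices: \<open>holomorphic_lipschitz_bound\<close>
  turns it, with a factor \<open>4 / r\<close>, into a majorant of the difference quotients, and
  dominated convergence does the rest.\<close>

theorem holomorphic_on_integral:
  fixes f :: "complex \<Rightarrow> 'b \<Rightarrow> complex"
  assumes "open U"
    and meas: "\<And>z. z \<in> U \<Longrightarrow> f z \<in> borel_measurable M"
    and hol: "\<And>x. x \<in> space M \<Longrightarrow> (\<lambda>z. f z x) holomorphic_on U"
    and bnd: "\<And>z. z \<in> U \<Longrightarrow> \<exists>r>0. \<exists>B. integrable M B \<and> ball z r \<subseteq> U \<and>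
                (\<forall>w\<in>ball z r. \<forall>x\<in>space M. norm (f w x) \<le> B x)"
  shows "(\<lambda>z. LINT x|M. f z x) holomorphic_on U"
proof (subst holomorphic_on_open[OF \<open>open U\<close>], intro ballI)
  fix z assume z: "z \<in> U"
  obtain r B where r: "r > 0" and B: "integrable M B" and sub: "ball z r \<subseteq> U"
    and le: "\<And>w x. w \<in> ball z r \<Longrightarrow> x \<in> space M \<Longrightarrow> norm (f w x) \<le> B x"
    using bnd[OF z] by blast
  have int: "integrable M (f w)" if "w \<in> ball z r" for w
    using B by (rule Bochner_Integration.integrable_bound) (use that le sub meas in \<open>auto intro!: AE_I2 order_trans[OF _ abs_ge_self]\<close>)
  define D where "D = (LINT x|M. deriv (\<lambda>z. f z x) z)"
  have "((\<lambda>w. ((LINT x|M. f w x) - (LINT x|M. f z x)) / (w - z)) \<longlongrightarrow> D) (at z within ball z (r / 2))"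
    unfolding tendsto_at_iff_sequentially o_def
  proof safe
    fix X assume X: "\<forall>i. X i \<in> ball z (r / 2) - {z}" "X \<longlonglongrightarrow> z"
    have Xr: "X i \<in> ball z r" "dist (X i) z \<le> r / 2" "X i \<noteq> z" for i
      using X(1)[rule_format, of i] r by (auto simp: dist_commute)
    have zr: "z \<in> ball z r" using r by simp
    have lim: "(\<lambda>n. (f (X n) x - f z x) / (X n - z)) \<longlonglongrightarrow> deriv (\<lambda>z. f z x) z" if "x \<in> space M" for x
    proof -
      have "((\<lambda>z. f z x) has_field_derivative deriv (\<lambda>z. f z x) z) (at z)"
        using holomorphic_derivI[OF hol[OF that] \<open>open U\<close> z] .
      then have "((\<lambda>w. (f w x - f z x) / (w - z)) \<longlongrightarrow> deriv (\<lambda>z. f z x) z) (at z)"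
        by (simp add: has_field_derivative_iff)
      then show ?thesis using X Xr by (auto simp: tendsto_at_iff_sequentially o_def)
    qed
    have "(\<lambda>n. LINT x|M. (f (X n) x - f z x) / (X n - z)) \<longlonglongrightarrow> D"
      unfolding D_def
    proof (rule integral_dominated_convergence[where w = "\<lambda>x. 4 * B x / r"])
      show q: "(\<lambda>x. (f (X n) x - f z x) / (X n - z)) \<in> borel_measurable M" for n
        using meas[of "X n"] meas[OF z] sub Xr(1)[of n] by (intro borel_measurable_divide borel_measurable_diff) auto
      \<comment> \<open>The derivative in the parameter is measurable as a pointwise limit of
        difference quotients.\<close>
      show "(\<lambda>x. deriv (\<lambda>z. f z x) z) \<in> borel_measurable M"
        by (rule borel_measurable_LIMSEQ_metric[OF q lim])
      show "AE x in M. (\<lambda>n. (f (X n) x - f z x) / (X n - z)) \<longlonglongrightarrow> deriv (\<lambda>z. f z x) z"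
        using lim by (auto intro: AE_I2)
      show "AE x in M. norm ((f (X n) x - f z x) / (X n - z)) \<le> 4 * B x / r" for n
      proof (intro AE_I2)
        fix x assume x: "x \<in> space M"
        have "norm (f (X n) x - f z x) \<le> (4 * B x / r) * norm (X n - z)"
          by (rule holomorphic_lipschitz_bound[OF holomorphic_on_subset[OF hol[OF x] sub] r]) (use le x Xr in auto)
        then show "norm ((f (X n) x - f z x) / (X n - z)) \<le> 4 * B x / r"
          using Xr(3)[of n] by (simp add: norm_divide pos_divide_le_eq)
      qed
      show "integrable M (\<lambda>x. 4 * B x / r)" using B by auto
    qed
    moreover have "(\<lambda>n. LINT x|M. (f (X n) x - f z x) / (X n - z)) = (\<lambda>n. ((LINT x|M. f (X n) x) - (LINT x|M. f z x)) / (X n - z))"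
      using int[OF Xr(1)] int[OF zr] by (simp add: fun_eq_iff)
    ultimately show "(\<lambda>n. ((LINT x|M. f (X n) x) - (LINT x|M. f z x)) / (X n - z)) \<longlonglongrightarrow> D" by simp
  qed
  then have "((\<lambda>z. LINT x|M. f z x) has_field_derivative D) (at z within ball z (r / 2))"
    by (simp add: has_field_derivative_iff)
  then have "((\<lambda>z. LINT x|M. f z x) has_field_derivative D) (at z)"
    using r by (subst (asm) at_within_open) auto
  then show "\<exists>f'. ((\<lambda>z. LINT x|M. f z x) has_field_derivative f') (at z)" by blast
qed

section \<open>Moving a line of integration inside a strip\<close>

lemma integrable_on_line:
  assumes "continuous_on UNIV (\<lambda>u. \<phi> (Complex u y))"
    and "(\<integral>\<^sup>+u. ennreal (cmod (\<phi> (Complex u y))) \<partial>lborel) \<le> ennreal M"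
  shows "integrable lborel (\<lambda>u. \<phi> (Complex u y))"
proof (rule integrableI_bounded)
  show "(\<lambda>u. \<phi> (Complex u y)) \<in> borel_measurable lborel"
    using borel_measurable_continuous_onI[OF assms(1)] by simp
  show "(\<integral>\<^sup>+ x. ennreal (cmod (\<phi> (Complex x y))) \<partial>lborel) < \<infinity>"
    using assms(2) by (simp add: order_le_less_trans)
qed

text \<open>
  Integrated over the position of the vertical sides, their contribution is at most the area
  integral of \<open>cmod \<phi>\<close>; hence it cannot tend to a nonzero limit.
\<close>

theorem strip_line_integral_shift:
  fixes \<phi> :: "complex \<Rightarrow> complex"
  assumes hol: "\<phi> holomorphic_on {z. c < Im z \<and> Im z < d}"
    and y: "c < y1" "y1 \<le> y2" "y2 < d"
    and M: "\<And>y. y1 \<le> y \<Longrightarrow> y \<le> y2 \<Longrightarrow> (\<integral>\<^sup>+u. ennreal (cmod (\<phi> (Complex u y))) \<partial>lborel) \<le> ennreal M"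
  shows "(LINT u|lborel. \<phi> (Complex u y1)) = (LINT u|lborel. \<phi> (Complex u y2))"
proof -
  define S where "S = {z. c < Im z \<and> Im z < d}"
  have S: "open S" "convex S"
  proof -
    have "S = {z. Im z > c} \<inter> {z. Im z < d}" by (auto simp: S_def)
    then show "open S" "convex S"
      by (auto intro!: open_Int convex_Int open_halfspace_Im_lt open_halfspace_Im_gt convex_halfspace_Im_lt convex_halfspace_Im_gt)
  qed
  \<comment> \<open>A primitive on the convex strip takes the place of a contour argument: all four
    sides of a rectangle become differences of its values at the corners.\<close>
  obtain \<Phi> where \<Phi>: "\<And>z. z \<in> S \<Longrightarrow> (\<Phi> has_field_derivative \<phi> z) (at z)"
    using holomorphic_convex_primitive'[OF S(2,1)] hol S(1) unfolding S_def[symmetric]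
    by (metis at_within_open)
  have cont: "continuous_on S \<phi>"
    using hol unfolding S_def by (rule holomorphic_on_imp_continuous_on)
  have contl: "continuous_on UNIV (\<lambda>u. \<phi> (Complex u y))" if "y1 \<le> y" "y \<le> y2" for y
    using y that by (intro continuous_on_compose2[OF cont] continuous_intros) (auto simp: S_def)
  have contv: "continuous_on {y1..y2} (\<lambda>y. \<phi> (Complex u y))" for u
    using y by (intro continuous_on_compose2[OF cont] continuous_intros) (auto simp: S_def)
  have int: "integrable lborel (\<lambda>u. \<phi> (Complex u y))" if "y1 \<le> y" "y \<le> y2" for y
    by (rule integrable_on_line[OF contl M]) fact+
  have horiz: "(LINT u:{-R..R}|lborel. \<phi> (Complex u y)) = \<Phi> (Complex R y) - \<Phi> (Complex (-R) y)"
    if "y1 \<le> y" "y \<le> y2" "R \<ge> 0" for y R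
  proof -
    have "((\<lambda>u. \<Phi> (Complex u y)) has_vector_derivative \<phi> (Complex u y)) (at u within {-R..R})" for u
    proof -
      have "((\<lambda>u. Complex u y) has_vector_derivative 1) (at u within {-R..R})"
        unfolding Complex_eq by (auto intro!: derivative_eq_intros)
      moreover have "(\<Phi> has_field_derivative \<phi> (Complex u y)) (at (Complex u y) within (\<lambda>u. Complex u y) ` {-R..R})"
        using \<Phi>[of "Complex u y"] that y by (auto simp: S_def intro: has_field_derivative_at_within)
      ultimately show ?thesis using field_vector_diff_chain_within by (force simp: o_def)
    qed
    then have "(LINT u|lborel. indicator {-R..R} u *\<^sub>R \<phi> (Complex u y)) = \<Phi> (Complex R y) - \<Phi> (Complex (-R) y)"
      using that by (intro integral_FTC_Icc continuous_on_subset[OF contl]) auto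
    then show ?thesis by (simp add: set_lebesgue_integral_def)
  qed
  have vert: "ennreal (cmod (\<Phi> (Complex R y2) - \<Phi> (Complex R y1))) \<le> (\<integral>\<^sup>+y\<in>{y1..y2}. ennreal (cmod (\<phi> (Complex R y))) \<partial>lborel)" for R
  proof -
    have "((\<lambda>u. \<Phi> (Complex R u)) has_vector_derivative \<i> * \<phi> (Complex R u)) (at u within {y1..y2})" if "y1 \<le> u" "u \<le> y2" for u
    proof -
      have "((\<lambda>u. Complex R u) has_vector_derivative \<i>) (at u within {y1..y2})"
        unfolding Complex_eq by (auto intro!: derivative_eq_intros)
      moreover have "(\<Phi> has_field_derivative \<phi> (Complex R u)) (at (Complex R u) within (\<lambda>u. Complex R u) ` {y1..y2})"
        using \<Phi>[of "Complex R u"] that y by (auto simp: S_def intro: has_field_derivative_at_within)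
      ultimately show ?thesis using field_vector_diff_chain_within by (force simp: o_def)
    qed
    then have I: "has_bochner_integral lborel (\<lambda>u. indicator {y1..y2} u *\<^sub>R (\<i> * \<phi> (Complex R u))) (\<Phi> (Complex R y2) - \<Phi> (Complex R y1))"
      using y by (intro has_bochner_integral_FTC_Icc continuous_intros contv) auto
    then have "ennreal (cmod (\<Phi> (Complex R y2) - \<Phi> (Complex R y1))) \<le> (\<integral>\<^sup>+u. norm (indicator {y1..y2} u *\<^sub>R (\<i> * \<phi> (Complex R u))) \<partial>lborel)"
      using integral_norm_bound_ennreal[of lborel "\<lambda>u. indicator {y1..y2} u *\<^sub>R (\<i> * \<phi> (Complex R u))"]
      by (simp add: has_bochner_integral_iff)
    also have "\<dots> = (\<integral>\<^sup>+y\<in>{y1..y2}. ennreal (cmod (\<phi> (Complex R y))) \<partial>lborel)"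
      by (intro nn_integral_cong) (auto simp: norm_mult indicator_def)
    finally show ?thesis .
  qed
  define V where "V R = (LINT u:{-R..R}|lborel. \<phi> (Complex u y2)) - (LINT u:{-R..R}|lborel. \<phi> (Complex u y1))" for R
  define D where "D R = (\<integral>\<^sup>+y\<in>{y1..y2}. ennreal (cmod (\<phi> (Complex R y))) \<partial>lborel)" for R
  have VD: "ennreal (cmod (V R)) \<le> D R + D (- R)" if "R \<ge> 0" for R
  proof -
    have "V R = (\<Phi> (Complex R y2) - \<Phi> (Complex R y1)) - (\<Phi> (Complex (-R) y2) - \<Phi> (Complex (-R) y1))"
      using y that by (simp add: V_def horiz)
    then have "ennreal (cmod (V R)) \<le> ennreal (cmod (\<Phi> (Complex R y2) - \<Phi> (Complex R y1)) + cmod (\<Phi> (Complex (-R) y2) - \<Phi> (Complex (-R) y1)))"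
      by (simp only:) (intro ennreal_leI norm_triangle_ineq4)
    also have "\<dots> \<le> D R + D (- R)"
      unfolding D_def using vert[of R] vert[of "-R"] by (simp add: add_mono)
    finally show ?thesis .
  qed
  \<comment> \<open>Since \<open>\<phi>\<close> is continuous only inside the open strip, joint
    measurability is obtained by cutting it off to the closed set
    \<open>UNIV \<times> {y1..y2}\<close>.\<close>
  have meas: "(\<lambda>(R, y). indicator {y1..y2} y * ennreal (cmod (\<phi> (Complex R y)))) \<in> borel_measurable (lborel \<Otimes>\<^sub>M lborel)"
  proof -
    have "continuous_on (UNIV \<times> {y1..y2}) (\<lambda>(R, y). \<phi> (Complex R y))"
      unfolding case_prod_unfold
      using y by (intro continuous_on_compose2[OF cont] continuous_intros) (auto simp: S_def)
    then have "(\<lambda>p. indicator (UNIV \<times> {y1..y2}) p *\<^sub>R (case p of (R, y) \<Rightarrow> \<phi> (Complex R y))) \<in> borel_measurable borel"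
      by (intro borel_measurable_continuous_on_indicator borel_closed closed_Times) auto
    then have "(\<lambda>p. ennreal (cmod (indicator (UNIV \<times> {y1..y2}) p *\<^sub>R (case p of (R, y) \<Rightarrow> \<phi> (Complex R y))))) \<in> borel_measurable borel"
      by measurable
    also have "(\<lambda>p. ennreal (cmod (indicator (UNIV \<times> {y1..y2}) p *\<^sub>R (case p of (R, y) \<Rightarrow> \<phi> (Complex R y))))) =
       (\<lambda>(R, y). indicator {y1..y2} y * ennreal (cmod (\<phi> (Complex R y))))"
      by (auto simp: fun_eq_iff indicator_def)
    finally show ?thesis by (simp add: lborel_prod)
  qed
  have Dmeas[measurable]: "D \<in> borel_measurable borel"
    using lborel.borel_measurable_nn_integral[OF meas] by (simp add: D_def[abs_def] mult.commute)
  have Dint: "(\<integral>\<^sup>+R. D R \<partial>lborel) \<le> ennreal (y2 - y1) * ennreal M"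
  proof -
    have "(\<integral>\<^sup>+R. D R \<partial>lborel) = (\<integral>\<^sup>+R. \<integral>\<^sup>+y. indicator {y1..y2} y * ennreal (cmod (\<phi> (Complex R y))) \<partial>lborel \<partial>lborel)"
      unfolding D_def by (simp add: mult.commute)
    also have "\<dots> = (\<integral>\<^sup>+y. \<integral>\<^sup>+R. indicator {y1..y2} y * ennreal (cmod (\<phi> (Complex R y))) \<partial>lborel \<partial>lborel)"
      by (rule lborel_pair.Fubini'[symmetric, OF meas])
    also have "\<dots> \<le> (\<integral>\<^sup>+y. ennreal M * indicator {y1..y2} y \<partial>lborel)"
      using M by (intro nn_integral_mono) (auto simp: indicator_def)
    also have "\<dots> = ennreal M * ennreal (y2 - y1)"
      using y by (subst nn_integral_cmult_indicator) auto
    finally show ?thesis by (simp add: mult.commute)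
  qed
  define L where "L = (LINT u|lborel. \<phi> (Complex u y2)) - (LINT u|lborel. \<phi> (Complex u y1))"
  have lim: "((\<lambda>R. LINT u:{-R..R}|lborel. \<phi> (Complex u y)) \<longlongrightarrow> (LINT u|lborel. \<phi> (Complex u y))) at_top"
    if "y1 \<le> y" "y \<le> y2" for y
    unfolding set_lebesgue_integral_def
  proof (rule integral_dominated_convergence_at_top[where w = "\<lambda>u. cmod (\<phi> (Complex u y))"])
    have [measurable]: "(\<lambda>u. \<phi> (Complex u y)) \<in> borel_measurable borel"
      using borel_measurable_continuous_onI[OF contl[OF that]] .
    show "(\<lambda>x. indicat_real {- t..t} x *\<^sub>R \<phi> (Complex x y)) \<in> borel_measurable lborel" for t
      by measurable
    show "AE x in lborel. ((\<lambda>t. indicat_real {- t..t} x *\<^sub>R \<phi> (Complex x y)) \<longlongrightarrow> \<phi> (Complex x y)) at_top"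
    proof (intro AE_I2)
      fix x
      have "\<forall>\<^sub>F t in at_top. \<phi> (Complex x y) = indicat_real {- t..t} x *\<^sub>R \<phi> (Complex x y)"
        using eventually_ge_at_top[of "\<bar>x\<bar>"] by eventually_elim (auto simp: indicator_def)
      then show "((\<lambda>t. indicat_real {- t..t} x *\<^sub>R \<phi> (Complex x y)) \<longlongrightarrow> \<phi> (Complex x y)) at_top"
        by (rule Lim_transform_eventually[OF tendsto_const])
    qed
    show "\<forall>\<^sub>F t in at_top. AE x in lborel. cmod (indicat_real {- t..t} x *\<^sub>R \<phi> (Complex x y)) \<le> cmod (\<phi> (Complex x y))"
      by (intro always_eventually allI AE_I2) (auto simp: indicator_def)
  qed (use int[OF that] in auto)
  have VL: "(V \<longlongrightarrow> L) at_top"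
    unfolding V_def L_def using y by (intro tendsto_diff lim) auto
  have "L = 0"
  proof (rule ccontr)
    assume "L \<noteq> 0"
    then have "\<forall>\<^sub>F R in at_top. dist (V R) L < cmod L / 2"
      using tendstoD[OF VL, of "cmod L / 2"] by simp
    then obtain R0 where R0: "\<And>R. R \<ge> R0 \<Longrightarrow> dist (V R) L < cmod L / 2"
      by (auto simp: eventually_at_top_linorder)
    define R1 where "R1 = max 0 R0"
    have low: "cmod (V R) \<ge> cmod L / 2" if "R \<ge> R1" for R
    proof -
      have "cmod (V R - L) < cmod L / 2" using R0[of R] that by (simp add: R1_def dist_norm)
      moreover have "cmod L \<le> cmod (V R) + cmod (V R - L)"
        by (metis norm_minus_commute norm_triangle_sub)
      ultimately show ?thesis by linarith
    qed
    have "\<infinity> = ennreal (cmod L / 2) * emeasure lborel {R1..}"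
    proof -
      have "emeasure lborel {R1..} = \<infinity>"
      proof (rule ccontr)
        assume "emeasure lborel {R1..} \<noteq> \<infinity>"
        then obtain b where b: "emeasure lborel {R1..} = ennreal b" "b \<ge> 0"
          by (cases "emeasure lborel {R1..}") auto
        have "emeasure lborel {R1..R1 + b + 1} \<le> emeasure lborel {R1..}"
          by (intro emeasure_mono) auto
        then show False using b by (simp add: ennreal_le_iff)
      qed
      then show ?thesis using \<open>L \<noteq> 0\<close> by (simp add: ennreal_mult_top)
    qed
    also have "\<dots> = (\<integral>\<^sup>+R. ennreal (cmod L / 2) * indicator {R1..} R \<partial>lborel)"
      by (rule nn_integral_cmult_indicator[symmetric]) simp
    also have "\<dots> \<le> (\<integral>\<^sup>+R. D R + D (- R) \<partial>lborel)"
    proof (intro nn_integral_mono)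
      fix R
      show "ennreal (cmod L / 2) * indicator {R1..} R \<le> D R + D (- R)"
      proof (cases "R \<ge> R1")
        case True
        then have "R \<ge> 0" by (simp add: R1_def)
        have "ennreal (cmod L / 2) \<le> ennreal (cmod (V R))" by (intro ennreal_leI low True)
        also have "\<dots> \<le> D R + D (- R)" by (rule VD) fact
        finally show ?thesis using True by simp
      qed simp
    qed
    also have "\<dots> = (\<integral>\<^sup>+R. D R \<partial>lborel) + (\<integral>\<^sup>+R. D (- R) \<partial>lborel)"
      by (rule nn_integral_add) auto
    also have "(\<integral>\<^sup>+R. D (- R) \<partial>lborel) = (\<integral>\<^sup>+R. D R \<partial>lborel)"
      using nn_integral_real_affine[of D "-1" 0] by simp
    also have "(\<integral>\<^sup>+R. D R \<partial>lborel) + (\<integral>\<^sup>+R. D R \<partial>lborel) \<le> ennreal (y2 - y1) * ennreal M + ennreal (y2 - y1) * ennreal M"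
      by (intro add_mono Dint)
    also have "\<dots> < \<infinity>" by (simp add: ennreal_mult_less_top)
    finally show False by simp
  qed
  then show ?thesis by (simp add: L_def)
qed

section \<open>The dispersion function\<close>

lemma integrable_weight:
  "integrable lborel (\<lambda>u::real. (1 + \<bar>u\<bar>) powr (- 5 / 4))"
proof -
  have half: "set_integrable lborel {0..} (\<lambda>u::real. (1 + \<bar>u\<bar>) powr (- 5 / 4))"
    unfolding set_integrable_def
  proof (rule integrableI_bounded)
    have nn: "(\<integral>\<^sup>+u. ennreal ((1 + \<bar>u\<bar>) powr (- 5 / 4)) * indicator {0..} u \<partial>lborel) = ennreal (0 - (- 4 * (1 + 0) powr (- 1 / 4)))"
    proof (rule nn_integral_FTC_atLeast)
      show "((\<lambda>u::real. - 4 * (1 + u) powr (- 1 / 4)) \<longlongrightarrow> 0) at_top" by real_asymp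
      show "DERIV (\<lambda>u. - 4 * (1 + u) powr (- 1 / 4)) x :> (1 + \<bar>x\<bar>) powr (- 5 / 4)" if "0 \<le> x" for x :: real
        using that by (auto intro!: derivative_eq_intros simp: powr_diff)
    qed auto
    have "(\<integral>\<^sup>+ x. ennreal (norm (indicat_real {0..} x *\<^sub>R (1 + \<bar>x\<bar>) powr (- 5 / 4 :: real))) \<partial>lborel) =
      (\<integral>\<^sup>+u. ennreal ((1 + \<bar>u\<bar>) powr (- 5 / 4)) * indicator {0..} u \<partial>lborel)"
      by (intro nn_integral_cong) (auto simp: indicator_def)
    then show "(\<integral>\<^sup>+ x. ennreal (norm (indicat_real {0..} x *\<^sub>R (1 + \<bar>x\<bar>) powr (- 5 / 4 :: real))) \<partial>lborel) < \<infinity>"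
      unfolding nn by simp
  qed simp
  then have "integrable lborel (\<lambda>u::real. indicator {0..} (- u) *\<^sub>R (1 + \<bar>u\<bar>) powr (- 5 / 4))"
    using lborel_integrable_real_affine[of "\<lambda>u::real. indicator {0..} u *\<^sub>R (1 + \<bar>u\<bar>) powr (- 5 / 4)" "-1" 0]
    by (simp add: set_integrable_def)
  with half have sum: "integrable lborel (\<lambda>u::real. indicator {0..} u *\<^sub>R (1 + \<bar>u\<bar>) powr (- 5 / 4) + indicator {0..} (- u) *\<^sub>R (1 + \<bar>u\<bar>) powr (- 5 / 4))"
    unfolding set_integrable_def by (rule Bochner_Integration.integrable_add)
  show ?thesis
    by (rule Bochner_Integration.integrable_bound[OF sum]) (auto simp: indicator_def)
qed

text \<open>
  Any exponent strictly between \<open>1\<close> and \<open>3/2\<close> would do in place of \<open>5/4\<close>: above \<open>1\<close> the weight is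
  integrable, and below \<open>3/2\<close> the convolution bound leaves a decay \<open>s powr (- 3/4)\<close> of the
  dispersion function that is square integrable.
\<close>

definition weight :: "real \<Rightarrow> real" where
  "weight u = (1 + \<bar>u\<bar>) powr (- 5 / 4)"

definition weight_mass :: real where
  "weight_mass = (LINT u|lborel. weight u)"

lemma weight_pos: "weight u > 0"
  by (simp add: weight_def add_pos_nonneg)

lemma weight_measurable [measurable]: "weight \<in> borel_measurable borel"
  unfolding weight_def[abs_def] by measurable

lemma integrable_weight_shift: "integrable lborel (\<lambda>u. weight (u - t))"
  using lborel_integrable_real_affine[OF integrable_weight, of 1 "- t"] by (simp add: weight_def)

lemma integral_weight_shift: "(LINT u|lborel. weight (u - t)) = weight_mass"
  using lborel_integral_real_affine[of 1 weight "- t"] by (simp add: weight_mass_def)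

lemma nn_integral_weight: "(\<integral>\<^sup>+u. ennreal (weight (u - t)) \<partial>lborel) = ennreal weight_mass"
  using integrable_weight_shift[of t] weight_pos
  by (subst nn_integral_eq_integral) (auto simp: integral_weight_shift less_imp_le)

lemma weight_mass_nonneg: "weight_mass \<ge> 0"
  unfolding weight_mass_def by (intro Bochner_Integration.integral_nonneg) (simp add: weight_pos less_imp_le)

text \<open>The larger of \<open>x\<close> and \<open>y\<close> is at least \<open>s / 2\<close>. Of
  its reciprocal, the power \<open>3 / 4\<close> is estimated through \<open>s\<close>, and the
  remaining power \<open>1 / 4\<close> is passed on to the smaller variable, whose exponent thereby
  becomes the integrable \<open>5 / 4\<close>. The factor \<open>2\<close> is a bound for
  \<open>2 powr (3 / 4)\<close>.\<close>

lemma inverse_product_le: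
  fixes x y s :: real
  assumes x: "x \<ge> 1" and y: "y \<ge> 1" and s: "0 < s" "s \<le> x + y"
  shows "1 / (x * y) \<le> 2 * s powr (- 3 / 4) * (x powr (- 5 / 4) + y powr (- 5 / 4))"
proof -
  have *: "1 / (p * q) \<le> 2 * s powr (- 3 / 4) * p powr (- 5 / 4)" if p: "1 \<le> p" "p \<le> q" "s \<le> 2 * q" for p q :: real
  proof -
    have q: "q \<ge> 1" using p by simp
    have "q powr (- 1 / 4) \<le> p powr (- 1 / 4)" using p by (intro powr_mono2') auto
    then have "q powr (- 1 / 4) * p powr (- 1) \<le> p powr (- 1 / 4) * p powr (- 1)" by (intro mult_right_mono) auto
    also have "\<dots> = p powr (- 1 / 4 + - 1)" by (simp only: powr_add)
    also have "\<dots> = p powr (- 5 / 4)" by simp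
    finally have 1: "q powr (- 1 / 4) * p powr (- 1) \<le> p powr (- 5 / 4)" .
    have "(2 * q) powr (- 3 / 4) \<le> s powr (- 3 / 4)" using p s by (intro powr_mono2') auto
    moreover have "(2 * q) powr (- 3 / 4) = 2 powr (- 3 / 4) * q powr (- 3 / 4)" using q by (simp add: powr_mult)
    moreover have "2 powr (- 1) \<le> (2::real) powr (- 3 / 4)" by (intro powr_mono) auto
    ultimately have 2: "q powr (- 3 / 4) \<le> 2 * s powr (- 3 / 4)"
    proof -
      assume a: "(2 * q) powr (- 3 / 4) \<le> s powr (- 3 / 4)" "(2 * q) powr (- 3 / 4) = 2 powr (- 3 / 4) * q powr (- 3 / 4)"
        "2 powr (- 1) \<le> (2::real) powr (- 3 / 4)"
      have "2 powr (- 1) * q powr (- 3 / 4) \<le> 2 powr (- 3 / 4) * q powr (- 3 / 4)"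
        using a(3) by (rule mult_right_mono) simp
      then show ?thesis using a by (simp add: powr_minus_divide)
    qed
    have "q powr (- 3 / 4) * q powr (- 1 / 4) = q powr (- 3 / 4 + - 1 / 4)" by (simp only: powr_add)
    also have "\<dots> = 1 / q" using q by (simp add: powr_minus_divide)
    finally have "1 / (p * q) = q powr (- 3 / 4) * (q powr (- 1 / 4) * p powr (- 1))"
      using p by (simp add: powr_minus_divide flip: mult.assoc)
    also have "\<dots> \<le> (2 * s powr (- 3 / 4)) * p powr (- 5 / 4)"
      using 1 2 by (intro mult_mono) auto
    finally show ?thesis .
  qed
  show ?thesis
  proof (cases "x \<le> y")
    case True
    have "1 / (x * y) \<le> 2 * s powr (- 3 / 4) * x powr (- 5 / 4)" by (rule *) (use True x s in auto)
    also have "\<dots> \<le> 2 * s powr (- 3 / 4) * (x powr (- 5 / 4) + y powr (- 5 / 4))"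
      by (intro mult_left_mono) auto
    finally show ?thesis .
  next
    case False
    have "1 / (y * x) \<le> 2 * s powr (- 3 / 4) * y powr (- 5 / 4)" by (rule *) (use False y s in auto)
    also have "\<dots> \<le> 2 * s powr (- 3 / 4) * (x powr (- 5 / 4) + y powr (- 5 / 4))"
      by (intro mult_left_mono) auto
    finally show ?thesis by (simp add: mult.commute)
  qed
qed

lemma inverse_square_le_weight: "1 / (1 + \<bar>u\<bar>)\<^sup>2 \<le> weight u"
proof -
  have "1 / (1 + \<bar>u\<bar>)\<^sup>2 = (1 + \<bar>u\<bar>) powr (- 2)" by (simp add: powr_minus_divide)
  also have "\<dots> \<le> (1 + \<bar>u\<bar>) powr (- 5 / 4)" by (intro powr_mono) auto
  finally show ?thesis by (simp add: weight_def)
qed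

text \<open>The modulus dominates the mean of the horizontal and the vertical distance. The lower
  bound \<open>p\<close> on the latter absorbs the additional \<open>1\<close>, since
  \<open>p * (1 + s) \<le> (1 + p) * s\<close> for \<open>s \<ge> p\<close>.\<close>

lemma norm_Complex_minus_ge:
  assumes p: "p > 0" and y: "Im \<omega> - y \<ge> p"
  shows "norm (Complex u y - \<omega>) \<ge> (p / (2 * (1 + p))) * (1 + \<bar>u - Re \<omega>\<bar> + (Im \<omega> - y))"
proof -
  let ?q = "Im \<omega> - y" and ?a = "\<bar>u - Re \<omega>\<bar>"
  have "?a \<le> norm (Complex u y - \<omega>)" "\<bar>?q\<bar> \<le> norm (Complex u y - \<omega>)"
    using abs_Re_le_cmod[of "Complex u y - \<omega>"] abs_Im_le_cmod[of "Complex u y - \<omega>"] by auto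
  then have "?a \<le> norm (Complex u y - \<omega>)" "?q \<le> norm (Complex u y - \<omega>)" by linarith+
  moreover have "(a + q) / 2 \<le> n" if "a \<le> n" "q \<le> n" for a q n :: real using that by simp
  ultimately have 1: "(?a + ?q) / 2 \<le> norm (Complex u y - \<omega>)" by blast
  have "p * (1 + ?a + ?q) \<le> (1 + p) * (?a + ?q)" using p y by (simp add: algebra_simps)
  then have "p * (1 + ?a + ?q) / (2 * (1 + p)) \<le> (1 + p) * (?a + ?q) / (2 * (1 + p))"
    using p by (intro divide_right_mono) auto
  also have "\<dots> = (?a + ?q) / 2"
    using p by (subst mult.commute[of 2]) (rule mult_divide_mult_cancel_left, simp)
  finally have 2: "p * (1 + ?a + ?q) / (2 * (1 + p)) \<le> (?a + ?q) / 2" .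
  show ?thesis unfolding times_divide_eq_left by (rule order_trans[OF 2 1])
qed

text \<open>\<open>gr\<close> stands for \<open>f0'\<close> and \<open>g\<close> for its analytic
  continuation. The strip of holomorphy is twice as wide as the strip of the bound, so that the line
  \<open>Im z = - \<beta>\<close> lies in its interior.\<close>

locale analytic_profile =
  fixes g :: "complex \<Rightarrow> complex" and gr :: "real \<Rightarrow> real" and \<beta> C :: real
  assumes \<beta>: "\<beta> > 0" and C: "C > 0"
    and hol: "g holomorphic_on {z. \<bar>Im z\<bar> < 2 * \<beta>}"
    and bnd: "\<And>z. \<bar>Im z\<bar> \<le> \<beta> \<Longrightarrow> norm (g z) \<le> C / (1 + \<bar>Re z\<bar>)"
    and real: "\<And>v. g (of_real v) = of_real (gr v)"
begin

section \<open>Continuation of the dispersion function below the real axis\<close>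

lemma continuous_line: "\<bar>y\<bar> \<le> \<beta> \<Longrightarrow> continuous_on UNIV (\<lambda>u. g (Complex u y))"
  using \<beta> by (intro continuous_on_compose2[OF holomorphic_on_imp_continuous_on[OF hol]] continuous_intros) auto

lemma line_measurable [measurable]: "(\<lambda>u. g (Complex u (- \<beta>))) \<in> borel_measurable borel"
  using \<beta> by (intro borel_measurable_continuous_onI continuous_line) auto

lemma g_real_measurable [measurable]: "(\<lambda>u. g (complex_of_real u)) \<in> borel_measurable borel"
  using borel_measurable_continuous_onI[OF continuous_line[of 0]] \<beta> by (simp add: complex_of_real_def)

lemma gr_measurable [measurable]: "gr \<in> borel_measurable borel"
proof -
  have "(\<lambda>u. Re (g (complex_of_real u))) \<in> borel_measurable borel" by measurable
  then show ?thesis by (simp add: real)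
qed

lemma norm_g_real_le: "norm (g (of_real v)) \<le> C"
proof -
  have "norm (g (of_real v)) \<le> C / (1 + \<bar>Re (of_real v)\<bar>)" using \<beta> by (intro bnd) simp
  also have "\<dots> \<le> C / 1" using C by (intro divide_left_mono) auto
  finally show ?thesis by simp
qed

text \<open>The \<open>\<Lambda>\<close> of the overview, introduced through its continuation: with
  the line lowered to \<open>Im z = - \<beta>\<close>, the formula makes sense for all
  \<open>Im \<omega> > - \<beta>\<close> at once, and nothing has to be glued across the real
  axis.\<close>

definition dispersion :: "complex \<Rightarrow> complex" where
  "dispersion \<omega> = (LINT u|lborel. g (Complex u (- \<beta>)) / (Complex u (- \<beta>) - \<omega>))"

text \<open>The decay in \<open>\<omega>\<close> is extracted pointwise, before integration. What
  remains under the integral is the sum of two translates of one weight, whose mass does not depend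
  on \<open>\<omega>\<close>.\<close>

lemma kernel_bound:
  assumes p: "p > 0" and y: "\<bar>y\<bar> \<le> \<beta>" "Im \<omega> - y \<ge> p"
  shows "norm (g (Complex u y) / (Complex u y - \<omega>)) \<le>
    4 * C * (1 + p) / p * (1 + \<bar>Re \<omega>\<bar> + (Im \<omega> - y)) powr (- 3 / 4) * (weight u + weight (u - Re \<omega>))"
proof -
  let ?c = "p / (2 * (1 + p))" and ?x = "1 + \<bar>u\<bar>" and ?y = "1 + \<bar>u - Re \<omega>\<bar> + (Im \<omega> - y)"
    and ?s = "1 + \<bar>Re \<omega>\<bar> + (Im \<omega> - y)"
  have c: "?c > 0" using p by simp
  have y1: "?y \<ge> 1" "?s > 0" using p y by auto
  have n: "norm (Complex u y - \<omega>) \<ge> ?c * ?y" by (rule norm_Complex_minus_ge) fact+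
  have cy: "?c * ?y > 0" using c y1 by (intro mult_pos_pos) auto
  have "norm (g (Complex u y) / (Complex u y - \<omega>)) \<le> (C / ?x) / (?c * ?y)"
    unfolding norm_divide using bnd[of "Complex u y"] y n cy C by (intro frac_le) auto
  also have "\<dots> = (C / ?c) * (1 / (?x * ?y))" by simp
  also have "\<dots> \<le> (C / ?c) * (2 * ?s powr (- 3 / 4) * (?x powr (- 5 / 4) + ?y powr (- 5 / 4)))"
    using C c y1 p y by (intro mult_left_mono inverse_product_le divide_nonneg_pos) auto
  also have "?y powr (- 5 / 4) \<le> weight (u - Re \<omega>)"
    unfolding weight_def using p y by (intro powr_mono2') auto
  then have "(C / ?c) * (2 * ?s powr (- 3 / 4) * (?x powr (- 5 / 4) + ?y powr (- 5 / 4))) \<le>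
     (C / ?c) * (2 * ?s powr (- 3 / 4) * (weight u + weight (u - Re \<omega>)))"
    using C c by (intro mult_left_mono add_mono divide_nonneg_pos mult_nonneg_nonneg) (auto simp: weight_def)
  also have "(C / ?c) * (2 * ?s powr (- 3 / 4) * (weight u + weight (u - Re \<omega>))) =
    4 * C * (1 + p) / p * ?s powr (- 3 / 4) * (weight u + weight (u - Re \<omega>))"
  proof -
    have "C / ?c = 2 * C * (1 + p) / p" by simp
    moreover have "A * (2 * S * V) = 2 * A * S * V" for A S V :: real by simp
    ultimately show ?thesis by (simp only:)
  qed
  finally show ?thesis .
qed

lemma kernel_bound':
  assumes p: "p > 0" and y: "\<bar>y\<bar> \<le> \<beta>" "Im \<omega> - y \<ge> p"
  shows "norm (g (Complex u y) / (Complex u y - \<omega>)) \<le> 4 * C * (1 + p) / p * (weight u + weight (u - Re \<omega>))"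
proof -
  have "(1 + \<bar>Re \<omega>\<bar> + (Im \<omega> - y)) powr (- 3 / 4) \<le> 1"
    using powr_mono2'[of "- 3 / 4" 1 "1 + \<bar>Re \<omega>\<bar> + (Im \<omega> - y)"] p y by simp
  then have "4 * C * (1 + p) / p * (1 + \<bar>Re \<omega>\<bar> + (Im \<omega> - y)) powr (- 3 / 4) * (weight u + weight (u - Re \<omega>))
     \<le> 4 * C * (1 + p) / p * 1 * (weight u + weight (u - Re \<omega>))"
    using C p weight_pos[of u] weight_pos[of "u - Re \<omega>"] by (intro mult_right_mono mult_left_mono) auto
  with kernel_bound[OF assms, of u] show ?thesis by simp
qed

lemma integrable_weight_sum: "integrable lborel (\<lambda>u. weight u + weight (u - t))"
  using Bochner_Integration.integrable_add[OF integrable_weight_shift[of 0] integrable_weight_shift[of t]] by simp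

lemma integral_weight_sum: "(LINT u|lborel. weight u + weight (u - t)) = 2 * weight_mass"
  using Bochner_Integration.integral_add[OF integrable_weight_shift[of 0] integrable_weight_shift[of t]]
  by (simp add: integral_weight_shift integral_weight_shift[of 0, simplified])

text \<open>For \<open>Im \<omega> > 0\<close> the pole lies above both lines, so raising the line
  from \<open>- \<beta>\<close> to the real axis crosses no singularity. The strip used for the
  shift ends at the height of the pole.\<close>

lemma dispersion_upper:
  assumes "Im \<omega> > 0"
  shows "dispersion \<omega> = (LINT v|lborel. g (of_real v) / (of_real v - \<omega>))"
proof -
  define d where "d = min (2 * \<beta>) (Im \<omega>)"
  have sub: "{z. - 2 * \<beta> < Im z \<and> Im z < d} \<subseteq> {z. \<bar>Im z\<bar> < 2 * \<beta>} \<inter> {z. z \<noteq> \<omega>}"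
    by (auto simp: d_def)
  have "(\<lambda>z. g z / (z - \<omega>)) holomorphic_on {z. - 2 * \<beta> < Im z \<and> Im z < d}"
    using sub by (intro holomorphic_intros holomorphic_on_subset[OF hol]) auto
  then have "(LINT u|lborel. g (Complex u (- \<beta>)) / (Complex u (- \<beta>) - \<omega>)) = (LINT u|lborel. g (Complex u 0) / (Complex u 0 - \<omega>))"
  proof (rule strip_line_integral_shift)
    let ?K = "4 * C * (1 + Im \<omega>) / Im \<omega>"
    show "(\<integral>\<^sup>+ u. ennreal (norm (g (Complex u y) / (Complex u y - \<omega>))) \<partial>lborel) \<le> ennreal (?K * (2 * weight_mass))"
      if "- \<beta> \<le> y" "y \<le> 0" for y
    proof -
      have "(\<integral>\<^sup>+ u. ennreal (norm (g (Complex u y) / (Complex u y - \<omega>))) \<partial>lborel) \<le>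
        (\<integral>\<^sup>+ u. ennreal (?K * (weight u + weight (u - Re \<omega>))) \<partial>lborel)"
        using that assms by (intro nn_integral_mono ennreal_leI kernel_bound') auto
      also have "\<dots> = ennreal (LINT u|lborel. ?K * (weight u + weight (u - Re \<omega>)))"
        using assms C weight_pos by (intro nn_integral_eq_integral integrable_mult_right integrable_weight_sum AE_I2 mult_nonneg_nonneg add_nonneg_nonneg less_imp_le) auto
      also have "\<dots> = ennreal (?K * (2 * weight_mass))" by (simp only: integral_mult_right_zero integral_weight_sum)
      finally show ?thesis .
    qed
  qed (use \<beta> assms in \<open>auto simp: d_def\<close>)
  then show ?thesis by (simp add: dispersion_def complex_of_real_def)
qed

lemma holomorphic_dispersion: "dispersion holomorphic_on {\<omega>. Im \<omega> > - \<beta>}"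
  unfolding dispersion_def[abs_def]
proof (rule holomorphic_on_integral)
  show "open {\<omega>. - \<beta> < Im \<omega>}" by (rule open_halfspace_Im_gt)
  show "(\<lambda>u. g (Complex u (- \<beta>)) / (Complex u (- \<beta>) - z)) \<in> borel_measurable lborel" for z
  proof -
    have [measurable]: "(\<lambda>u. Complex u (- \<beta>) - z) \<in> borel_measurable borel"
      by (intro borel_measurable_continuous_onI continuous_intros)
    show ?thesis by measurable
  qed
  show "(\<lambda>z. g (Complex x (- \<beta>)) / (Complex x (- \<beta>) - z)) holomorphic_on {\<omega>. - \<beta> < Im \<omega>}" for x
    by (intro holomorphic_intros) auto
  fix z assume z: "z \<in> {\<omega>. - \<beta> < Im \<omega>}"
  \<comment> \<open>Half the distance from \<open>z\<close> to the line of integration: every point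
    of the ball keeps at least the distance \<open>p\<close>.\<close>
  define p where "p = (Im z + \<beta>) / 2"
  have p: "p > 0" using z by (simp add: p_def)
  define K where "K = 2 * (1 + p) / p"
  have K: "K > 0" using p by (simp add: K_def)
  define R where "R = 1 + \<bar>Re z\<bar> + p"
  show "\<exists>r>0. \<exists>B. integrable lborel B \<and> ball z r \<subseteq> {\<omega>. - \<beta> < Im \<omega>} \<and>
       (\<forall>w\<in>ball z r. \<forall>u\<in>space lborel. norm (g (Complex u (- \<beta>)) / (Complex u (- \<beta>) - w)) \<le> B u)"
  proof (intro exI conjI ballI)
    show "p > 0" by fact
    show "integrable lborel (\<lambda>u. C * K * R * weight u)"
      using integrable_weight_shift[of 0] by simp
    have w: "Im w + \<beta> \<ge> p" "\<bar>Re w\<bar> \<le> \<bar>Re z\<bar> + p" if "w \<in> ball z p" for w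
    proof -
      have "norm (z - w) < p" using that by (simp add: dist_norm)
      then have "\<bar>Re z - Re w\<bar> < p" "\<bar>Im z - Im w\<bar> < p"
        using abs_Im_le_cmod[of "z - w"] abs_Re_le_cmod[of "z - w"] by auto
      moreover have "Im z + \<beta> = 2 * p" by (simp add: p_def)
      ultimately show "Im w + \<beta> \<ge> p" "\<bar>Re w\<bar> \<le> \<bar>Re z\<bar> + p" by linarith+
    qed
    show "ball z p \<subseteq> {\<omega>. - \<beta> < Im \<omega>}"
      using w p by force
    fix w u assume "w \<in> ball z p"
    note w = w[OF this]
    have "norm (Complex u (- \<beta>) - w) \<ge> (p / (2 * (1 + p))) * (1 + \<bar>u - Re w\<bar> + (Im w - - \<beta>))"
      by (rule norm_Complex_minus_ge) (use p w in auto)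
    moreover have "(p / (2 * (1 + p))) * (1 + \<bar>u - Re w\<bar> + (Im w - - \<beta>)) \<ge> (p / (2 * (1 + p))) * (1 + \<bar>u - Re w\<bar>)"
      using p w by (intro mult_left_mono) auto
    ultimately have "norm (Complex u (- \<beta>) - w) \<ge> 1 / K * (1 + \<bar>u - Re w\<bar>)" by (simp add: K_def)
    \<comment> \<open>Recentres the weight from \<open>Re w\<close> to \<open>0\<close>, so that one
      majorant serves the whole ball.\<close>
    moreover have "(1 + \<bar>u\<bar>) \<le> R * (1 + \<bar>u - Re w\<bar>)"
    proof -
      have "1 + \<bar>u\<bar> \<le> 1 + \<bar>u - Re w\<bar> + (\<bar>Re z\<bar> + p) * 1" using w by auto
      also have "\<dots> \<le> 1 + \<bar>u - Re w\<bar> + (\<bar>Re z\<bar> + p) * (1 + \<bar>u - Re w\<bar>)"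
        using p by (intro add_left_mono mult_left_mono) auto
      also have "\<dots> = R * (1 + \<bar>u - Re w\<bar>)" by (simp add: R_def algebra_simps)
      finally show ?thesis .
    qed
    then have "1 / K * ((1 + \<bar>u\<bar>) / R) \<le> 1 / K * (1 + \<bar>u - Re w\<bar>)"
      using K p by (intro mult_left_mono) (auto simp: R_def divide_le_eq mult.commute)
    ultimately have n: "norm (Complex u (- \<beta>) - w) \<ge> (1 + \<bar>u\<bar>) / (K * R)" by simp
    have R: "R > 0" using p by (simp add: R_def)
    have "norm (g (Complex u (- \<beta>)) / (Complex u (- \<beta>) - w)) \<le> (C / (1 + \<bar>u\<bar>)) / ((1 + \<bar>u\<bar>) / (K * R))"
      unfolding norm_divide using bnd[of "Complex u (- \<beta>)"] \<beta> n C K R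
      by (intro frac_le) (auto intro!: divide_pos_pos mult_pos_pos)
    also have "\<dots> = C * K * R * (1 / (1 + \<bar>u\<bar>)\<^sup>2)" by (simp add: power2_eq_square)
    also have "\<dots> \<le> C * K * R * weight u"
      using C K R by (intro mult_left_mono inverse_square_le_weight) auto
    finally show "norm (g (Complex u (- \<beta>)) / (Complex u (- \<beta>) - w)) \<le> C * K * R * weight u" .
  qed
qed

text \<open>The constant of \<open>kernel_bound\<close> at \<open>p = \<beta> / 2\<close>, times the
  mass of two weights. For \<open>Im \<omega> \<ge> - \<beta> / 2\<close> this \<open>p\<close> is
  the guaranteed distance to the line of integration.\<close>

definition dispersion_const :: real where
  "dispersion_const = 16 * C * (1 + \<beta> / 2) / \<beta> * weight_mass"

lemma dispersion_bound:
  assumes "Im \<omega> \<ge> - \<beta> / 2"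
  shows "norm (dispersion \<omega>) \<le> dispersion_const * (1 + \<bar>Re \<omega>\<bar> + (Im \<omega> + \<beta>)) powr (- 3 / 4)"
proof -
  let ?K = "4 * C * (1 + \<beta> / 2) / (\<beta> / 2) * (1 + \<bar>Re \<omega>\<bar> + (Im \<omega> - - \<beta>)) powr (- 3 / 4)"
  have "norm (dispersion \<omega>) \<le> (LINT u|lborel. ?K * (weight u + weight (u - Re \<omega>)))"
    unfolding dispersion_def
  proof (rule norm_integral_le)
    show "integrable lborel (\<lambda>u. ?K * (weight u + weight (u - Re \<omega>)))"
      by (intro integrable_mult_right integrable_weight_sum)
    show "AE u in lborel. norm (g (Complex u (- \<beta>)) / (Complex u (- \<beta>) - \<omega>)) \<le> ?K * (weight u + weight (u - Re \<omega>))"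
      using assms \<beta> by (intro AE_I2 kernel_bound) auto
  qed
  also have "\<dots> = ?K * (2 * weight_mass)" by (simp only: integral_mult_right_zero integral_weight_sum)
  also have "\<dots> = dispersion_const * (1 + \<bar>Re \<omega>\<bar> + (Im \<omega> + \<beta>)) powr (- 3 / 4)"
    unfolding dispersion_const_def by (simp add: algebra_simps)
  finally show ?thesis .
qed

section \<open>Boundary values on the real line\<close>

lemma dispersion_tendsto_real:
  "((\<lambda>\<epsilon>. dispersion (Complex \<omega> \<epsilon>)) \<longlongrightarrow> dispersion (of_real \<omega>)) (at_right 0)"
proof -
  have "isCont dispersion (of_real \<omega>)"
    using holomorphic_on_imp_continuous_on[OF holomorphic_dispersion] \<beta>
    by (subst (asm) continuous_on_eq_continuous_at) (auto simp: open_halfspace_Im_gt)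
  moreover have "((\<lambda>\<epsilon>. Complex \<omega> \<epsilon>) \<longlongrightarrow> Complex \<omega> 0) (at_right 0)"
    by (intro tendsto_intros)
  ultimately show ?thesis by (intro isCont_tendsto_compose[of _ dispersion]) (auto simp: complex_of_real_def)
qed

text \<open>A zero of the numerator makes the singularity removable, so the quotient is integrable
  and the principal value is an ordinary integral. The same quotient dominates the integrals for
  \<open>\<omega> + \<i> \<epsilon>\<close>, because moving the pole off the real axis only enlarges
  the modulus of the denominator. Hence both limits are the same integral.\<close>

lemma dispersion_pv:
  assumes g0: "gr \<omega> = 0" and pv: "has_cauchy_pv (\<lambda>v. gr v / (v - \<omega>)) \<omega> P"
  shows "dispersion (of_real \<omega>) = of_real P"
proof -
  \<comment> \<open>At \<open>v = \<omega>\<close> this is \<open>0 / 0 = 0\<close>, not the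
    continuous extension; the pointwise limits below hold there too, because the numerator
    vanishes.\<close>
  define q where "q v = gr v / (v - \<omega>)" for v
  have [measurable]: "q \<in> borel_measurable borel" unfolding q_def[abs_def] by measurable
  have near: "\<bar>q v\<bar> \<le> 4 * C / \<beta>" if "\<bar>v - \<omega>\<bar> \<le> \<beta> / 2" for v
  proof -
    have "norm (g (of_real v) - g (of_real \<omega>)) \<le> (4 * C / \<beta>) * norm (of_real v - complex_of_real \<omega>)"
    proof (rule holomorphic_lipschitz_bound[OF _ \<beta>])
      have im: "\<bar>Im w\<bar> < \<beta>" if "w \<in> ball (complex_of_real \<omega>) \<beta>" for w
        using that abs_Im_le_cmod[of "of_real \<omega> - w"] by (simp add: dist_norm)
      show "g holomorphic_on ball (complex_of_real \<omega>) \<beta>"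
        using im \<beta> by (intro holomorphic_on_subset[OF hol]) force
      show "norm (g w) \<le> C" if "w \<in> ball (complex_of_real \<omega>) \<beta>" for w
      proof -
        have "norm (g w) \<le> C / (1 + \<bar>Re w\<bar>)" using im[OF that] by (intro bnd) simp
        also have "\<dots> \<le> C / 1" using C by (intro divide_left_mono) auto
        finally show ?thesis by simp
      qed
      show "dist (complex_of_real v) (complex_of_real \<omega>) \<le> \<beta> / 2"
        using that by (simp add: dist_norm flip: of_real_diff)
    qed
    then have "\<bar>gr v\<bar> \<le> (4 * C / \<beta>) * \<bar>v - \<omega>\<bar>"
      using g0 by (simp add: real flip: of_real_diff)
    then show ?thesis using C \<beta> by (cases "v = \<omega>") (auto simp: q_def pos_divide_le_eq)
  qed
  \<comment> \<open>Away from the singularity, integrability is part of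
    \<open>has_cauchy_pv\<close>; near it the Lipschitz bound takes over.\<close>
  have out: "integrable lborel (\<lambda>v. indicator {v. \<beta> / 2 < \<bar>v - \<omega>\<bar>} v *\<^sub>R q v)"
    using pv \<beta> unfolding has_cauchy_pv_def set_integrable_def q_def by (auto dest: spec[of _ "\<beta> / 2"])
  have inn: "integrable lborel (\<lambda>v. indicator {\<omega> - \<beta> / 2..\<omega> + \<beta> / 2} v *\<^sub>R q v)"
  proof (rule Bochner_Integration.integrable_bound)
    show "integrable lborel (\<lambda>v. indicator {\<omega> - \<beta> / 2..\<omega> + \<beta> / 2} v *\<^sub>R (4 * C / \<beta>))"
      by (intro integrable_scaleR_left integrable_real_indicator) (auto simp: emeasure_lborel_Icc_eq)
    show "AE v in lborel. norm (indicator {\<omega> - \<beta> / 2..\<omega> + \<beta> / 2} v *\<^sub>R q v) \<le> norm (indicator {\<omega> - \<beta> / 2..\<omega> + \<beta> / 2} v *\<^sub>R (4 * C / \<beta>))"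
    proof (intro AE_I2)
      fix v
      have "\<bar>q v\<bar> \<le> \<bar>4 * C / \<beta>\<bar>" if "v \<in> {\<omega> - \<beta> / 2..\<omega> + \<beta> / 2}"
      proof (rule order_trans[OF near abs_ge_self])
        show "\<bar>v - \<omega>\<bar> \<le> \<beta> / 2" using that unfolding abs_le_iff atLeastAtMost_iff by linarith
      qed
      then show "norm (indicator {\<omega> - \<beta> / 2..\<omega> + \<beta> / 2} v *\<^sub>R q v) \<le> norm (indicator {\<omega> - \<beta> / 2..\<omega> + \<beta> / 2} v *\<^sub>R (4 * C / \<beta>))"
        by (cases "v \<in> {\<omega> - \<beta> / 2..\<omega> + \<beta> / 2}") auto
    qed
  qed measurable
  have qint: "integrable lborel q"
  proof (rule Bochner_Integration.integrable_bound[OF Bochner_Integration.integrable_add[OF out inn]])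
    show "AE v in lborel. norm (q v) \<le> norm (indicator {v. \<beta> / 2 < \<bar>v - \<omega>\<bar>} v *\<^sub>R q v + indicator {\<omega> - \<beta> / 2..\<omega> + \<beta> / 2} v *\<^sub>R q v)"
      by (intro AE_I2) (auto simp: indicator_def abs_if split: if_splits)
  qed measurable
  have P: "P = (LINT v|lborel. q v)"
  proof (rule tendsto_unique[OF trivial_limit_at_right_real])
    show "((\<lambda>\<epsilon>. LINT v:{v. \<epsilon> < \<bar>v - \<omega>\<bar>}|lborel. q v) \<longlongrightarrow> P) (at_right 0)"
      using pv unfolding has_cauchy_pv_def q_def by blast
    show "((\<lambda>\<epsilon>. LINT v:{v. \<epsilon> < \<bar>v - \<omega>\<bar>}|lborel. q v) \<longlongrightarrow> (LINT v|lborel. q v)) (at_right 0)"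
      unfolding tendsto_at_iff_sequentially o_def set_lebesgue_integral_def
    proof safe
      fix X :: "nat \<Rightarrow> real" assume X: "X \<longlonglongrightarrow> 0" "\<forall>i. X i \<in> {0<..} - {0}"
      show "(\<lambda>n. LINT v|lborel. indicator {v. X n < \<bar>v - \<omega>\<bar>} v *\<^sub>R q v) \<longlonglongrightarrow> (LINT v|lborel. q v)"
      proof (rule integral_dominated_convergence[where w = "\<lambda>v. norm (q v)"])
        show "AE v in lborel. (\<lambda>n. indicator {v. X n < \<bar>v - \<omega>\<bar>} v *\<^sub>R q v) \<longlonglongrightarrow> q v"
        proof (intro AE_I2)
          fix v
          show "(\<lambda>n. indicator {v. X n < \<bar>v - \<omega>\<bar>} v *\<^sub>R q v) \<longlonglongrightarrow> q v"
          proof (cases "v = \<omega>")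
            case True
            then show ?thesis by (simp add: q_def)
          next
            case False
            then have "\<forall>\<^sub>F n in sequentially. X n < \<bar>v - \<omega>\<bar>"
              using X(1) by (intro order_tendstoD) auto
            then have "\<forall>\<^sub>F n in sequentially. q v = indicator {v. X n < \<bar>v - \<omega>\<bar>} v *\<^sub>R q v"
              by eventually_elim simp
            then show ?thesis by (rule Lim_transform_eventually[OF tendsto_const])
          qed
        qed
      qed (use qint in \<open>auto simp: indicator_def\<close>)
    qed
  qed
  have lim1: "((\<lambda>\<epsilon>. dispersion (Complex \<omega> \<epsilon>)) \<longlongrightarrow> dispersion (of_real \<omega>)) (at_right 0)"
    by (rule dispersion_tendsto_real)
  have lim2: "((\<lambda>\<epsilon>. LINT v|lborel. g (of_real v) / (of_real v - Complex \<omega> \<epsilon>)) \<longlongrightarrow> (LINT v|lborel. of_real (q v))) (at_right 0)"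
    unfolding tendsto_at_iff_sequentially o_def
  proof safe
    fix X :: "nat \<Rightarrow> real" assume X: "X \<longlonglongrightarrow> 0" "\<forall>i. X i \<in> {0<..} - {0}"
    show "(\<lambda>n. LINT v|lborel. g (of_real v) / (of_real v - Complex \<omega> (X n))) \<longlonglongrightarrow> (LINT v|lborel. complex_of_real (q v))"
    proof (rule integral_dominated_convergence[where w = "\<lambda>v. norm (q v)"])
      show "(\<lambda>v. g (of_real v) / (of_real v - Complex \<omega> (X n))) \<in> borel_measurable lborel" for n
      proof -
        have [measurable]: "(\<lambda>v. complex_of_real v - Complex \<omega> (X n)) \<in> borel_measurable borel"
          by (intro borel_measurable_continuous_onI continuous_intros)
        show ?thesis by measurable
      qed
      show "AE v in lborel. (\<lambda>n. g (of_real v) / (of_real v - Complex \<omega> (X n))) \<longlonglongrightarrow> complex_of_real (q v)"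
      proof (intro AE_I2)
        fix v
        show "(\<lambda>n. g (of_real v) / (of_real v - Complex \<omega> (X n))) \<longlonglongrightarrow> complex_of_real (q v)"
        proof (cases "v = \<omega>")
          case True
          then show ?thesis using g0 by (simp add: q_def real)
        next
          case False
          then have "(\<lambda>n. g (of_real v) / (of_real v - Complex \<omega> (X n))) \<longlonglongrightarrow> g (of_real v) / (of_real v - Complex \<omega> 0)"
            by (intro tendsto_intros X) (auto simp: complex_eq_iff)
          then show ?thesis by (simp add: q_def real complex_of_real_def[symmetric])
        qed
      qed
      show "AE v in lborel. norm (g (of_real v) / (of_real v - Complex \<omega> (X n))) \<le> norm (q v)" for n
      proof (intro AE_I2)
        fix v
        show "norm (g (of_real v) / (of_real v - Complex \<omega> (X n))) \<le> norm (q v)"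
        proof (cases "v = \<omega>")
          case True
          then show ?thesis using g0 by (simp add: q_def real)
        next
          case False
          have "\<bar>v - \<omega>\<bar> \<le> norm (of_real v - Complex \<omega> (X n))"
            using abs_Re_le_cmod[of "of_real v - Complex \<omega> (X n)"] by simp
          then show ?thesis using False
            by (auto simp: q_def real norm_divide intro!: divide_left_mono mult_pos_pos)
        qed
      qed
    qed (use qint in auto)
  qed
  have "((\<lambda>\<epsilon>. dispersion (Complex \<omega> \<epsilon>)) \<longlongrightarrow> (LINT v|lborel. of_real (q v))) (at_right 0)"
    by (rule Lim_transform_eventually[OF lim2]) (use eventually_at_right_less[of 0] in \<open>eventually_elim, simp add: dispersion_upper\<close>)
  from tendsto_unique[OF trivial_limit_at_right_real lim1 this]
  show ?thesis unfolding P by (simp only: integral_of_real[OF qint])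
qed

text \<open>The Plemelj formula for the imaginary part: the imaginary part of
  \<open>1 / (v - \<omega> - \<i> \<epsilon>)\<close> is the Poisson kernel at
  \<open>\<omega>\<close>. A real value of \<open>dispersion\<close> on the real line therefore
  forces \<open>gr \<omega> = 0\<close>, which is the case covered by the stability
  condition.\<close>

lemma Im_dispersion_real: "Im (dispersion (of_real \<omega>)) = pi * gr \<omega>"
proof (rule tendsto_unique[OF trivial_limit_at_right_real])
  show "((\<lambda>\<epsilon>. Im (dispersion (Complex \<omega> \<epsilon>))) \<longlongrightarrow> Im (dispersion (of_real \<omega>))) (at_right 0)"
    by (intro tendsto_Im dispersion_tendsto_real)
  have "((\<lambda>\<epsilon>. LINT v|lborel. (\<epsilon> / (\<epsilon>\<^sup>2 + (v - \<omega>)\<^sup>2)) *\<^sub>R g (of_real v)) \<longlongrightarrow> pi *\<^sub>R g (of_real \<omega>)) (at_right 0)"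
  proof (rule poisson_kernel_tendsto[where B = C])
    show "norm (g (of_real v)) \<le> C" for v by (rule norm_g_real_le)
    show "isCont (\<lambda>v. g (of_real v)) \<omega>"
      using continuous_line[of 0] \<beta> by (simp add: continuous_on_eq_continuous_at complex_of_real_def)
  qed measurable
  then have "((\<lambda>\<epsilon>. Re (LINT v|lborel. (\<epsilon> / (\<epsilon>\<^sup>2 + (v - \<omega>)\<^sup>2)) *\<^sub>R g (of_real v))) \<longlongrightarrow> Re (pi *\<^sub>R g (of_real \<omega>))) (at_right 0)"
    by (intro tendsto_intros)
  moreover have "\<forall>\<^sub>F \<epsilon> in at_right 0. Re (LINT v|lborel. (\<epsilon> / (\<epsilon>\<^sup>2 + (v - \<omega>)\<^sup>2)) *\<^sub>R g (of_real v)) = Im (dispersion (Complex \<omega> \<epsilon>))"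
    using eventually_at_right_less[of 0]
  proof eventually_elim
    case (elim e)
    have int: "integrable lborel (\<lambda>v. g (of_real v) / (of_real v - Complex \<omega> e))"
    proof (rule Bochner_Integration.integrable_bound)
      show "integrable lborel (\<lambda>u. 4 * C * (1 + e) / e * (weight u + weight (u - Re (Complex \<omega> e))))"
        by (intro integrable_mult_right integrable_weight_sum)
      have [measurable]: "(\<lambda>v. complex_of_real v - Complex \<omega> e) \<in> borel_measurable borel"
        by (intro borel_measurable_continuous_onI continuous_intros)
      show "(\<lambda>v. g (of_real v) / (of_real v - Complex \<omega> e)) \<in> borel_measurable lborel" by measurable
      show "AE u in lborel. norm (g (of_real u) / (of_real u - Complex \<omega> e)) \<le> norm (4 * C * (1 + e) / e * (weight u + weight (u - Re (Complex \<omega> e))))"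
        using \<beta> elim unfolding complex_of_real_def real_norm_def
        by (intro AE_I2 order_trans[OF kernel_bound' abs_ge_self]) auto
    qed
    have "Im (dispersion (Complex \<omega> e)) = (LINT v|lborel. Im (g (of_real v) / (of_real v - Complex \<omega> e)))"
      using elim int by (simp add: dispersion_upper)
    also have "\<dots> = (LINT v|lborel. Re ((e / (e\<^sup>2 + (v - \<omega>)\<^sup>2)) *\<^sub>R g (of_real v)))"
      by (intro Bochner_Integration.integral_cong refl) (simp add: real Im_divide add.commute)
    also have "\<dots> = Re (LINT v|lborel. (e / (e\<^sup>2 + (v - \<omega>)\<^sup>2)) *\<^sub>R g (of_real v))"
    proof (rule integral_Re)
      show "integrable lborel (\<lambda>v. (e / (e\<^sup>2 + (v - \<omega>)\<^sup>2)) *\<^sub>R g (of_real v))"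
      proof (rule Bochner_Integration.integrable_bound)
        show "integrable lborel (\<lambda>v. (e / (e\<^sup>2 + (v - \<omega>)\<^sup>2)) * C)"
          using has_bochner_integral_poisson_kernel[OF elim, of \<omega>] by (intro integrable_mult_left) (auto simp: has_bochner_integral_iff)
        show "AE v in lborel. norm ((e / (e\<^sup>2 + (v - \<omega>)\<^sup>2)) *\<^sub>R g (of_real v)) \<le> norm ((e / (e\<^sup>2 + (v - \<omega>)\<^sup>2)) * C)"
        proof (intro AE_I2)
          fix v
          have "norm (g (of_real v)) \<le> norm C" using norm_g_real_le[of v] by simp
          then show "norm ((e / (e\<^sup>2 + (v - \<omega>)\<^sup>2)) *\<^sub>R g (of_real v)) \<le> norm ((e / (e\<^sup>2 + (v - \<omega>)\<^sup>2)) * C)"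
            by (simp only: norm_scaleR abs_mult real_norm_def) (rule mult_left_mono, simp_all)
        qed
      qed measurable
    qed
    finally show ?case by simp
  qed
  ultimately have "((\<lambda>\<epsilon>. Im (dispersion (Complex \<omega> \<epsilon>))) \<longlongrightarrow> Re (pi *\<^sub>R g (of_real \<omega>))) (at_right 0)"
    by (rule Lim_transform_eventually)
  then show "((\<lambda>\<epsilon>. Im (dispersion (Complex \<omega> \<epsilon>))) \<longlongrightarrow> pi * gr \<omega>) (at_right 0)"
    by (simp add: real)
qed

section \<open>The stability condition and the absence of zeros\<close>

lemma continuous_on_dispersion: "continuous_on {\<omega>. Im \<omega> > - \<beta>} dispersion"
  by (rule holomorphic_on_imp_continuous_on[OF holomorphic_dispersion])

lemma dispersion_const_nonneg: "dispersion_const \<ge> 0"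
  using C \<beta> weight_mass_nonneg by (simp add: dispersion_const_def)

lemma dispersion_small:
  assumes "e > 0"
  obtains B where "\<And>\<omega>. Im \<omega> \<ge> - \<beta> / 2 \<Longrightarrow> norm \<omega> \<ge> B \<Longrightarrow> norm (dispersion \<omega>) < e"
proof -
  have "((\<lambda>s. dispersion_const * s powr (- 3 / 4)) \<longlongrightarrow> 0) at_top"
    by (rule tendsto_mult_right_zero) real_asymp
  then have "\<forall>\<^sub>F s in at_top. dispersion_const * s powr (- 3 / 4) < e"
    using assms by (rule order_tendstoD)
  then obtain B where B: "\<And>s. s \<ge> B \<Longrightarrow> dispersion_const * s powr (- 3 / 4) < e"
    by (auto simp: eventually_at_top_linorder)
  show ?thesis
  proof (rule that[of B])
    fix \<omega> assume w: "Im \<omega> \<ge> - \<beta> / 2" "norm \<omega> \<ge> B"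
    have "norm \<omega> \<le> \<bar>Re \<omega>\<bar> + \<bar>Im \<omega>\<bar>" by (rule cmod_le)
    also have "\<bar>Im \<omega>\<bar> \<le> Im \<omega> + \<beta>" using w \<beta> by (simp add: abs_le_iff)
    finally have "B \<le> 1 + \<bar>Re \<omega>\<bar> + (Im \<omega> + \<beta>)" using w by simp
    from B[OF this] dispersion_bound[OF w(1)] show "norm (dispersion \<omega>) < e" by simp
  qed
qed

text \<open>
  The dispersion function tends to zero at infinity and is open, so a value in \<open>(-\<infinity>, -1]\<close> taken in
  the closed upper half plane could be pushed further to the left until it is taken on the real
  line, where the stability condition forbids it.
\<close>

lemma dispersion_avoids_ray:
  assumes penrose: "\<And>\<omega>. gr \<omega> = 0 \<Longrightarrow> \<exists>P. has_cauchy_pv (\<lambda>v. gr v / (v - \<omega>)) \<omega> P \<and> P > -1"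
    and w: "Im \<omega> \<ge> 0"
  shows "\<not> (Im (dispersion \<omega>) = 0 \<and> Re (dispersion \<omega>) \<le> - 1)"
proof
  assume bad: "Im (dispersion \<omega>) = 0 \<and> Re (dispersion \<omega>) \<le> - 1"
  define S where "S = {w. Im w \<ge> 0 \<and> Im (dispersion w) = 0 \<and> Re (dispersion w) \<le> - 1}"
  have real_no: "Im w > 0" if "w \<in> S" for w
  proof (rule ccontr)
    assume "\<not> Im w > 0"
    with that have "Im w = 0" by (simp add: S_def)
    then have w: "w = of_real (Re w)" by (simp add: complex_eq_iff)
    then have "gr (Re w) = 0" using that Im_dispersion_real[of "Re w"] by (simp add: S_def)
    with penrose obtain P where P: "has_cauchy_pv (\<lambda>v. gr v / (v - Re w)) (Re w) P" "P > -1" by blast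
    have "dispersion w = of_real P" using dispersion_pv[OF \<open>gr (Re w) = 0\<close> P(1)] w by simp
    then show False using that P(2) by (simp add: S_def)
  qed
  obtain B where B: "\<And>w. Im w \<ge> - \<beta> / 2 \<Longrightarrow> norm w \<ge> B \<Longrightarrow> norm (dispersion w) < 1"
    using dispersion_small[of 1] by auto
  have contS: "continuous_on {w. Im w \<ge> 0} dispersion"
    using \<beta> by (intro continuous_on_subset[OF continuous_on_dispersion]) auto
  have "S \<subseteq> cball 0 B"
  proof
    fix w assume w: "w \<in> S"
    show "w \<in> cball 0 B"
    proof (rule ccontr)
      assume "w \<notin> cball 0 B"
      then have "norm (dispersion w) < 1" using w \<beta> by (intro B) (auto simp: S_def)
      moreover have "\<bar>Re (dispersion w)\<bar> \<ge> 1" using w by (auto simp: S_def)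
      ultimately show False using abs_Re_le_cmod[of "dispersion w"] by simp
    qed
  qed
  moreover have "closed S"
  proof -
    have "S = {w. Im w \<ge> 0} \<inter> dispersion -` ({z. Im z = 0} \<inter> {z. Re z \<le> - 1})"
      by (auto simp: S_def)
    also have "closed \<dots>"
      by (intro continuous_closed_preimage[OF contS] closed_halfspace_Im_ge closed_Int closed_halfspace_Re_le
          closed_Collect_eq continuous_intros)
    finally show ?thesis .
  qed
  ultimately have "compact S"
    using compact_eq_bounded_closed bounded_subset[OF bounded_cball] by blast
  moreover have "\<omega> \<in> S" using bad w by (simp add: S_def)
  moreover have "continuous_on S (\<lambda>w. Re (dispersion w))"
    by (intro continuous_intros continuous_on_subset[OF contS]) (auto simp: S_def)
  \<comment> \<open>The smallness of \<open>dispersion\<close> at infinity makes \<open>S\<close>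
    compact, so a leftmost value on the ray is attained, and by \<open>real_no\<close> it is
    attained off the real axis.\<close>
  ultimately obtain z where z: "z \<in> S" "\<And>w. w \<in> S \<Longrightarrow> Re (dispersion z) \<le> Re (dispersion w)"
    using continuous_attains_inf[of S "\<lambda>w. Re (dispersion w)"] by auto
  have "open (dispersion ` {w. Im w > 0})"
  proof (rule open_mapping_thm)
    show "dispersion holomorphic_on {w. Im w > 0}"
      using \<beta> by (intro holomorphic_on_subset[OF holomorphic_dispersion]) auto
    \<comment> \<open>A constant value would have modulus below \<open>1\<close>, as seen far out,
      whereas the value at \<open>z\<close> has modulus at least \<open>1\<close>.\<close>
    show "\<not> dispersion constant_on {w. Im w > 0}"
    proof
      assume "dispersion constant_on {w. Im w > 0}"
      then obtain c where c: "\<And>w. Im w > 0 \<Longrightarrow> dispersion w = c" by (auto simp: constant_on_def)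
      have "dispersion z = c" using c real_no[OF z(1)] by simp
      moreover have "norm (dispersion (Complex 0 (max 1 B))) < 1"
        using \<beta> by (intro B) (auto simp: cmod_def)
      moreover have "dispersion (Complex 0 (max 1 B)) = c" by (intro c) simp
      ultimately have "norm (dispersion z) < 1" by simp
      then show False using z(1) abs_Re_le_cmod[of "dispersion z"] by (simp add: S_def)
    qed
  qed (auto simp: open_halfspace_Im_gt convex_connected convex_halfspace_Im_gt)
  moreover have "dispersion z \<in> dispersion ` {w. Im w > 0}" using real_no[OF z(1)] by simp
  ultimately obtain e where e: "e > 0" "ball (dispersion z) e \<subseteq> dispersion ` {w. Im w > 0}"
    using open_contains_ball by blast
  have "dispersion z - of_real (e / 2) \<in> ball (dispersion z) e"
    using e by (simp add: dist_norm)
  then have "dispersion z - of_real (e / 2) \<in> dispersion ` {w. Im w > 0}" using e(2) by blast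
  then obtain w where w: "dispersion z - of_real (e / 2) = dispersion w" "w \<in> {w. Im w > 0}" by (rule imageE)
  have w': "Re (dispersion w) = Re (dispersion z) - e / 2" "Im (dispersion w) = Im (dispersion z)"
    by (simp_all flip: w(1))
  have "w \<in> S" using w(2) w' z(1) e(1) by (simp add: S_def)
  from z(2)[OF this] show False using w' e(1) by simp
qed

text \<open>Far out \<open>dispersion\<close> is below \<open>1 / 2\<close> in modulus while
  \<open>k \<ge> 1\<close>. On a compact half disc its values keep a positive distance
  \<open>d\<close> from the ray of real numbers up to \<open>- 1\<close>; this ray contains every
  \<open>- k\<close>, which makes the bound uniform in \<open>k\<close>. Uniform continuity carries
  half of \<open>d\<close> over to a thin strip below the real axis.\<close>

theorem dispersion_nonvanishing:
  assumes penrose: "\<And>\<omega>. gr \<omega> = 0 \<Longrightarrow> \<exists>P. has_cauchy_pv (\<lambda>v. gr v / (v - \<omega>)) \<omega> P \<and> P > -1"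
  obtains \<delta> c where "0 < \<delta>" "\<delta> \<le> \<beta> / 2" "0 < c"
    "\<And>\<omega> k. Im \<omega> \<ge> - \<delta> \<Longrightarrow> k \<ge> 1 \<Longrightarrow> c \<le> norm (of_real k + dispersion \<omega>)"
proof -
  obtain B0 where B0: "\<And>w. Im w \<ge> - \<beta> / 2 \<Longrightarrow> norm w \<ge> B0 \<Longrightarrow> norm (dispersion w) < 1 / 2"
    using dispersion_small[of "1/2"] by auto
  define B where "B = max B0 0"
  have B: "norm (dispersion w) < 1 / 2" if "Im w \<ge> - \<beta> / 2" "norm w \<ge> B" for w
    using B0[of w] that by (simp add: B_def)
  define T where "T = {z. Im z = 0} \<inter> {z. Re z \<le> - 1}"
  have T: "closed T" unfolding T_def by (intro closed_Int closed_halfspace_Re_le closed_Collect_eq continuous_intros)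
  have kT: "- of_real k \<in> T" if "k \<ge> 1" for k :: real using that by (simp add: T_def)
  define K where "K = cball 0 B \<inter> {w. Im w \<ge> 0}"
  define K' where "K' = cball 0 B \<inter> {w. Im w \<ge> - \<beta> / 2}"
  have K: "compact K" "compact K'" unfolding K_def K'_def
    by (intro compact_Int_closed compact_cball closed_halfspace_Im_ge)+
  have contK': "continuous_on K' dispersion" 
    using \<beta> by (intro continuous_on_subset[OF continuous_on_dispersion]) (auto simp: K'_def)
  have KK': "K \<subseteq> K'" using \<beta> by (auto simp: K_def K'_def)
  have "compact (dispersion ` K)"
    by (intro compact_continuous_image continuous_on_subset[OF contK'] KK' K)
  moreover have "dispersion ` K \<inter> T = {}"
    using dispersion_avoids_ray[OF penrose] by (force simp: K_def T_def)
  ultimately obtain d where d: "d > 0" "\<And>x y. x \<in> dispersion ` K \<Longrightarrow> y \<in> T \<Longrightarrow> d \<le> dist x y"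
    using separate_compact_closed[OF _ T, of "dispersion ` K"] by auto
  have "uniformly_continuous_on K' dispersion"
    using K(2) contK' by (rule compact_uniformly_continuous[rotated])
  then obtain e where e: "e > 0" "\<And>x y. x \<in> K' \<Longrightarrow> y \<in> K' \<Longrightarrow> dist y x < e \<Longrightarrow> dist (dispersion y) (dispersion x) < d / 2"
    unfolding uniformly_continuous_on_def using half_gt_zero[OF d(1)] by metis
  show ?thesis
  proof (rule that[of "min (\<beta> / 2) (e / 2)" "min (1 / 2) (d / 2)"])
    fix \<omega> :: complex and k :: real assume w: "- min (\<beta> / 2) (e / 2) \<le> Im \<omega>" and k: "k \<ge> 1"
    show "min (1 / 2) (d / 2) \<le> norm (of_real k + dispersion \<omega>)"
    proof (cases "norm \<omega> \<ge> B")
      case True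
      have "norm (dispersion \<omega>) < 1 / 2" using w True by (intro B) auto
      moreover have "k \<le> norm (of_real k + dispersion \<omega>) + norm (dispersion \<omega>)"
        using norm_triangle_ineq4[of "of_real k + dispersion \<omega>" "dispersion \<omega>"] k by simp
      ultimately show ?thesis using k by linarith
    next
      case False
      \<comment> \<open>The nearest point of the closed upper half plane; it differs from
        \<open>\<omega>\<close> by at most the thickness of the strip.\<close>
      define w' where "w' = (if Im \<omega> \<ge> 0 then \<omega> else of_real (Re \<omega>))"
      have "norm w' \<le> norm \<omega>" using abs_Re_le_cmod[of \<omega>] by (auto simp: w'_def)
      then have w'K: "w' \<in> K" using False by (auto simp: K_def w'_def)
      have "\<omega> - w' = (if Im \<omega> \<ge> 0 then 0 else Complex 0 (Im \<omega>))" by (auto simp: w'_def complex_eq_iff)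
      then have "norm (\<omega> - w') < e" using w e(1) by (auto simp: cmod_def)
      then have "dist (dispersion \<omega>) (dispersion w') < d / 2"
        using w'K KK' w False by (intro e(2)) (auto simp: dist_norm K'_def)
      moreover have "d \<le> dist (dispersion w') (- of_real k)"
        using w'K by (intro d(2) kT k) auto
      moreover have "dist (dispersion w') (- of_real k) \<le> dist (dispersion \<omega>) (dispersion w') + dist (dispersion \<omega>) (- of_real k)"
        by (metis dist_commute dist_triangle)
      ultimately have "d / 2 \<le> dist (dispersion \<omega>) (- of_real k)" by linarith
      then show ?thesis by (simp add: dist_norm add.commute)
    qed
  qed (use \<beta> d e in auto)
qed

end

section \<open>The Volterra equation\<close>

lemma has_bochner_integral_exp_half_line_real:
  fixes a :: real
  assumes "a > 0"
  shows "has_bochner_integral lborel (\<lambda>t. indicator {0..} t * exp (- (a * t))) (1 / a)"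
proof -
  have "has_bochner_integral lborel (\<lambda>s. Re (indicator {0..} s *\<^sub>R exp (- (of_real a * of_real s)))) (Re (1 / of_real a))"
    using has_bochner_integral_exp_half_line[of "of_real a"] assms by (intro has_bochner_integral_Re) simp
  then show ?thesis by (simp add: exp_eq_polar flip: of_real_mult of_real_minus of_real_exp)
qed

lemma measurable_on_half_line:
  fixes q :: "real \<Rightarrow> complex"
  assumes "continuous_on {0..} q"
  shows "(\<lambda>t. indicator {0..} t *\<^sub>R q t) \<in> borel_measurable borel"
  using assms by (intro borel_measurable_continuous_on_indicator) auto

definition damped :: "(real \<Rightarrow> complex) \<Rightarrow> real \<Rightarrow> real \<Rightarrow> complex" where
  "damped q y t = exp (- (y * t)) *\<^sub>R (indicator {0..} t *\<^sub>R q t)"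

text \<open>Fourier convention, with the kernel \<open>exp (\<i> * \<omega> * t)\<close>: a bound
  \<open>exp (- a * t)\<close> means holomorphy for \<open>Im \<omega> > - a\<close>. On each
  horizontal line the transform is a \<open>fourier\<close> integral of a damped function, so that
  inversion and Bessel's inequality apply line by line.\<close>

definition laplace :: "(real \<Rightarrow> complex) \<Rightarrow> complex \<Rightarrow> complex" where
  "laplace q \<omega> = fourier (damped q (Im \<omega>)) (Re \<omega>)"

lemma laplace_eq:
  "laplace q \<omega> = (LINT t|lborel. exp (\<i> * \<omega> * of_real t) * (indicator {0..} t *\<^sub>R q t))"
  unfolding laplace_def fourier_def
proof (intro Bochner_Integration.integral_cong refl)
  fix t
  have "exp (\<i> * \<omega> * of_real t) = exp (- (Im \<omega> * t)) *\<^sub>R cis (Re \<omega> * t)"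
    by (simp add: exp_eq_polar scaleR_conv_of_real)
  then show "cis (Re \<omega> * t) * damped q (Im \<omega>) t = exp (\<i> * \<omega> * of_real t) * (indicator {0..} t *\<^sub>R q t)"
    by (simp add: damped_def)
qed

context
  fixes q :: "real \<Rightarrow> complex" and a B :: real
  assumes cont: "continuous_on {0..} q" and le: "\<And>t. t \<ge> 0 \<Longrightarrow> norm (q t) \<le> B * exp (- (a * t))" and B: "B \<ge> 0"
begin

lemma damped_measurable [measurable]: "damped q y \<in> borel_measurable borel"
proof -
  note [measurable] = measurable_on_half_line[OF cont]
  show ?thesis unfolding damped_def[abs_def] by measurable
qed

lemma norm_damped_le: "norm (damped q y t) \<le> B * (indicator {0..} t * exp (- ((a + y) * t)))"
proof (cases "t \<ge> 0")
  case True
  then have "norm (damped q y t) \<le> exp (- (y * t)) * (B * exp (- (a * t)))"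
    using le[OF True] by (simp add: damped_def)
  also have "\<dots> = B * exp (- (y * t) + - (a * t))" by (simp only: exp_add mult_ac)
  also have "- (y * t) + - (a * t) = - ((a + y) * t)" by (simp add: algebra_simps)
  finally show ?thesis using True by simp
qed (simp add: damped_def)

lemma integrable_exp_bound: "a + y > 0 \<Longrightarrow> integrable lborel (\<lambda>t. B * (indicator {0..} t * exp (- ((a + y) * t))))"
  using has_bochner_integral_exp_half_line_real[of "a + y"] by (intro integrable_mult_right) (auto simp: has_bochner_integral_iff)

lemma integrable_damped:
  assumes "a + y > 0"
  shows "integrable lborel (damped q y)"
  by (rule Bochner_Integration.integrable_bound[OF integrable_exp_bound[OF assms]])
     (auto intro!: AE_I2 order_trans[OF norm_damped_le abs_ge_self])

lemma damped_square:
  assumes "a + y > 0"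
  shows "integrable lborel (\<lambda>t. (norm (damped q y t))\<^sup>2)"
    and "(LINT t|lborel. (norm (damped q y t))\<^sup>2) \<le> B\<^sup>2 / (2 * (a + y))"
proof -
  have h: "has_bochner_integral lborel (\<lambda>t. B\<^sup>2 * (indicator {0..} t * exp (- ((2 * (a + y)) * t)))) (B\<^sup>2 * (1 / (2 * (a + y))))"
    using assms by (intro has_bochner_integral_mult_right has_bochner_integral_exp_half_line_real) auto
  have b: "(norm (damped q y t))\<^sup>2 \<le> B\<^sup>2 * (indicator {0..} t * exp (- ((2 * (a + y)) * t)))" for t
  proof -
    have "(norm (damped q y t))\<^sup>2 \<le> (B * (indicator {0..} t * exp (- ((a + y) * t))))\<^sup>2"
      by (intro power_mono norm_damped_le) auto
    also have "\<dots> = B\<^sup>2 * (indicator {0..} t * (exp (- ((a + y) * t)))\<^sup>2)"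
      by (simp add: power_mult_distrib indicator_def)
    also have "(exp (- ((a + y) * t)))\<^sup>2 = exp (- ((2 * (a + y)) * t))"
      by (simp add: exp_double[symmetric])
    finally show ?thesis .
  qed
  show 1: "integrable lborel (\<lambda>t. (norm (damped q y t))\<^sup>2)"
    by (rule Bochner_Integration.integrable_bound[OF integrable.intros[OF h]])
       (use b in \<open>auto intro!: AE_I2 simp: abs_mult simp del: distrib_left_numeral\<close>)
  show "(LINT t|lborel. (norm (damped q y t))\<^sup>2) \<le> B\<^sup>2 / (2 * (a + y))"
    using integral_mono[OF 1 integrable.intros[OF h] b] h by (simp add: has_bochner_integral_iff)
qed

lemma laplace_square:
  assumes "a + y > 0"
  shows "(\<integral>\<^sup>+x. ennreal ((norm (laplace q (Complex x y)))\<^sup>2) \<partial>lborel) \<le> ennreal (pi * B\<^sup>2 / (a + y))"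
proof -
  have "(\<integral>\<^sup>+x. ennreal ((norm (laplace q (Complex x y)))\<^sup>2) \<partial>lborel) \<le> ennreal (2 * pi * (LINT t|lborel. (norm (damped q y t))\<^sup>2))"
    unfolding laplace_def complex.sel by (rule fourier_bessel[OF integrable_damped[OF assms] damped_square(1)[OF assms]])
  also have "\<dots> \<le> ennreal (2 * pi * (B\<^sup>2 / (2 * (a + y))))"
    by (intro ennreal_leI mult_left_mono damped_square(2)[OF assms]) simp
  also have "2 * pi * (B\<^sup>2 / (2 * (a + y))) = pi * B\<^sup>2 / (a + y)" using assms by (simp add: field_simps)
  finally show ?thesis .
qed

lemma holomorphic_laplace: "laplace q holomorphic_on {\<omega>. Im \<omega> > - a}"
  unfolding laplace_eq[abs_def]
proof (rule holomorphic_on_integral)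
  note [measurable] = measurable_on_half_line[OF cont]
  show "open {\<omega>. - a < Im \<omega>}" by (rule open_halfspace_Im_gt)
  show "(\<lambda>t. exp (\<i> * z * of_real t) * (indicator {0..} t *\<^sub>R q t)) \<in> borel_measurable lborel" for z
  proof -
    have [measurable]: "(\<lambda>t. exp (\<i> * z * complex_of_real t)) \<in> borel_measurable borel"
      by (intro borel_measurable_continuous_onI continuous_intros)
    show ?thesis by measurable
  qed
  show "(\<lambda>z. exp (\<i> * z * of_real t) * (indicator {0..} t *\<^sub>R q t)) holomorphic_on {\<omega>. - a < Im \<omega>}" for t
    by (intro holomorphic_intros)
  fix z assume z: "z \<in> {\<omega>. - a < Im \<omega>}"
  define p where "p = (a + Im z) / 2"
  have p: "p > 0" using z by (simp add: p_def)
  have w: "Im w > Im z - p" if "w \<in> ball z p" for w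
  proof -
    have "\<bar>Im (z - w)\<bar> < p" using that abs_Im_le_cmod[of "z - w"] by (simp add: dist_norm)
    then show ?thesis by simp
  qed
  show "\<exists>r>0. \<exists>B. integrable lborel B \<and> ball z r \<subseteq> {\<omega>. - a < Im \<omega>} \<and>
       (\<forall>w\<in>ball z r. \<forall>t\<in>space lborel. norm (exp (\<i> * w * of_real t) * (indicator {0..} t *\<^sub>R q t)) \<le> B t)"
  proof (intro exI conjI ballI)
    show "p > 0" by fact
    show "integrable lborel (\<lambda>t. B * (indicator {0..} t * exp (- ((a + (Im z - p)) * t))))"
      using p by (intro integrable_exp_bound) (simp add: p_def field_simps)
    show "ball z p \<subseteq> {\<omega>. - a < Im \<omega>}"
    proof
      fix w assume "w \<in> ball z p"
      from w[OF this] show "w \<in> {\<omega>. - a < Im \<omega>}" using p by (simp add: p_def field_simps)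
    qed
    fix w t assume w': "w \<in> ball z p"
    have "norm (exp (\<i> * w * of_real t) * (indicator {0..} t *\<^sub>R q t)) = exp (- (Im w * t)) * (indicator {0..} t * norm (q t))"
      by (simp add: norm_mult norm_exp_eq_Re)
    also have "\<dots> \<le> exp (- ((Im z - p) * t)) * (indicator {0..} t * norm (q t))"
    proof (cases "t \<ge> 0")
      case True
      then have "(Im z - p) * t \<le> Im w * t" using w[OF w'] by (intro mult_right_mono) auto
      then show ?thesis by (intro mult_right_mono) auto
    qed simp
    also have "\<dots> = norm (damped q (Im z - p) t)" by (simp add: damped_def)
    also have "\<dots> \<le> B * (indicator {0..} t * exp (- ((a + (Im z - p)) * t)))" by (rule norm_damped_le)
    finally show "norm (exp (\<i> * w * of_real t) * (indicator {0..} t *\<^sub>R q t)) \<le> B * (indicator {0..} t * exp (- ((a + (Im z - p)) * t)))" .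
  qed
qed

end

section \<open>The history term and a priori growth\<close>

definition memory :: "(real \<Rightarrow> complex) \<Rightarrow> real \<Rightarrow> real \<Rightarrow> complex" where
  "memory q t v = (LINT s|lborel. indicator {0..t} s *\<^sub>R (cis (- (v * (t - s))) * q s))"

text \<open>Up to a phase of modulus one, the dependence on the velocity is the Fourier transform of
  the truncated history. This is what makes Bessel's inequality available in
  \<open>v\<close>.\<close>

lemma memory_fourier:
  "memory q t v = cis (- (v * t)) * fourier (\<lambda>s. indicator {0..t} s *\<^sub>R q s) v"
proof -
  have "cis (- (v * t)) * fourier (\<lambda>s. indicator {0..t} s *\<^sub>R q s) v =
     (LINT s|lborel. cis (- (v * t)) * (cis (v * s) * (indicator {0..t} s *\<^sub>R q s)))"
    unfolding fourier_def by (rule integral_mult_right_zero[symmetric])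
  also have "\<dots> = memory q t v"
    unfolding memory_def
    by (intro Bochner_Integration.integral_cong refl) (simp add: cis_mult algebra_simps flip: mult.assoc)
  finally show ?thesis ..
qed

lemma memory_measurable:
  assumes cont: "continuous_on {0..} q"
  shows "(\<lambda>(t, v). memory q t v) \<in> borel_measurable (borel \<Otimes>\<^sub>M borel)"
proof -
  note [measurable] = measurable_on_half_line[OF cont]
  \<comment> \<open>Rewrites the moving cut-off through half lines, so that joint measurability
    follows from that of \<open>q\<close> extended by zero.\<close>
  have eq: "indicator {0..t} s *\<^sub>R (cis (- (v * (t - s))) * q s) =
     indicator {0..} (t - s) *\<^sub>R (cis (- (v * (t - s))) * (indicator {0..} s *\<^sub>R q s))" for s t v
    by (auto simp: indicator_def)
  show ?thesis unfolding memory_def eq by measurable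
qed

text \<open>What matters is the factor \<open>1 / \<mu>\<close>: measured against a faster
  exponential, the history weighs less. This gain closes the growth estimate.\<close>

lemma memory_square:
  assumes cont: "continuous_on {0..} q" and t: "t \<ge> 0" and lam: "\<mu> > 0" and m: "m \<ge> 0"
    and le: "\<And>s. 0 \<le> s \<Longrightarrow> s \<le> t \<Longrightarrow> norm (q s) \<le> m * exp (\<mu> * s)"
  shows "(\<integral>\<^sup>+v. ennreal ((norm (memory q t v))\<^sup>2) \<partial>lborel) \<le> ennreal (pi * m\<^sup>2 * exp (2 * \<mu> * t) / \<mu>)"
proof -
  let ?f = "\<lambda>s. indicator {0..t} s *\<^sub>R q s"
  have cont': "continuous_on {0..t} q" using cont by (rule continuous_on_subset) auto
  have f: "integrable lborel ?f" by (intro borel_integrable_compact cont') simp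
  have f2: "integrable lborel (\<lambda>s. (norm (?f s))\<^sup>2)"
  proof -
    have "integrable lborel (\<lambda>s. indicator {0..t} s *\<^sub>R (norm (q s))\<^sup>2)"
      by (intro borel_integrable_compact continuous_intros cont') simp
    also have "(\<lambda>s. indicator {0..t} s *\<^sub>R (norm (q s))\<^sup>2) = (\<lambda>s. (norm (?f s))\<^sup>2)"
      by (auto simp: indicator_def)
    finally show ?thesis .
  qed
  have h: "has_bochner_integral lborel (\<lambda>s. indicator {0..t} s *\<^sub>R (m\<^sup>2 * exp (2 * \<mu> * s)))
     (m\<^sup>2 * exp (2 * \<mu> * t) / (2 * \<mu>) - m\<^sup>2 * exp (2 * \<mu> * 0) / (2 * \<mu>))"
    using t lam by (intro has_bochner_integral_FTC_Icc continuous_intros)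
      (auto intro!: derivative_eq_intros simp: has_real_derivative_iff_has_vector_derivative[symmetric])
  have "(LINT s|lborel. (norm (?f s))\<^sup>2) \<le> (LINT s|lborel. indicator {0..t} s *\<^sub>R (m\<^sup>2 * exp (2 * \<mu> * s)))"
  proof (rule integral_mono[OF f2 integrable.intros[OF h]])
    fix s
    show "(norm (?f s))\<^sup>2 \<le> indicator {0..t} s *\<^sub>R (m\<^sup>2 * exp (2 * \<mu> * s))"
    proof (cases "s \<in> {0..t}")
      case True
      then have "(norm (q s))\<^sup>2 \<le> (m * exp (\<mu> * s))\<^sup>2" by (intro power_mono le) auto
      also have "\<dots> = m\<^sup>2 * exp (2 * \<mu> * s)" by (simp add: power_mult_distrib exp_double[symmetric] mult.assoc)
      finally show ?thesis using True by simp
    qed simp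
  qed
  also have "\<dots> \<le> m\<^sup>2 * exp (2 * \<mu> * t) / (2 * \<mu>)"
    using h lam by (simp add: has_bochner_integral_iff)
  finally have le2: "(LINT s|lborel. (norm (?f s))\<^sup>2) \<le> m\<^sup>2 * exp (2 * \<mu> * t) / (2 * \<mu>)" .
  have "(\<integral>\<^sup>+v. ennreal ((norm (memory q t v))\<^sup>2) \<partial>lborel) = (\<integral>\<^sup>+v. ennreal ((norm (fourier ?f v))\<^sup>2) \<partial>lborel)"
    by (simp add: memory_fourier norm_mult)
  also have "\<dots> \<le> ennreal (2 * pi * (LINT s|lborel. (norm (?f s))\<^sup>2))"
    by (rule fourier_bessel[OF f f2])
  also have "\<dots> \<le> ennreal (2 * pi * (m\<^sup>2 * exp (2 * \<mu> * t) / (2 * \<mu>)))"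
    by (intro ennreal_leI mult_left_mono le2) simp
  also have "2 * pi * (m\<^sup>2 * exp (2 * \<mu> * t) / (2 * \<mu>)) = pi * m\<^sup>2 * exp (2 * \<mu> * t) / \<mu>"
    by simp
  finally show ?thesis .
qed

context analytic_profile
begin

text \<open>Arises from Young's inequality as half the sum of the bound on the square integral of
  \<open>g\<close> and the bound \<open>pi\<close> on that of the normalised history.\<close>

definition growth_const :: real where
  "growth_const = (C\<^sup>2 * weight_mass + pi) / 2"

lemma growth_const_pos: "growth_const > 0"
  using weight_mass_nonneg by (simp add: growth_const_def add_nonneg_pos)

text \<open>\<open>g\<close> is square integrable but need not be integrable, so the product is
  controlled through the square integrals of both factors, by Young's inequality with a
  weight.\<close>

lemma profile_memory_bound:
  assumes cont: "continuous_on {0..} q" and t: "t \<ge> 0" and lam: "\<mu> > 0" and m: "m > 0"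
    and le: "\<And>s. 0 \<le> s \<Longrightarrow> s \<le> t \<Longrightarrow> norm (q s) \<le> m * exp (\<mu> * s)"
  shows "(\<integral>\<^sup>+v. ennreal (norm (g (of_real v) * memory q t v)) \<partial>lborel) \<le> ennreal (growth_const / sqrt \<mu> * (m * exp (\<mu> * t)))"
proof -
  note [measurable] = memory_measurable[OF cont]
  \<comment> \<open>With this \<open>\<theta>\<close> the bound of \<open>memory_square\<close>
    reads \<open>pi * \<theta>\<^sup>2\<close>; weighting Young's inequality by
    \<open>\<theta>\<close> makes both of its terms multiples of \<open>\<theta>\<close>.\<close>
  define \<theta> where "\<theta> = m * exp (\<mu> * t) / sqrt \<mu>"
  have \<theta>: "\<theta> > 0" using m lam by (simp add: \<theta>_def)
  have g2: "(\<integral>\<^sup>+v. ennreal ((norm (g (of_real v)))\<^sup>2) \<partial>lborel) \<le> ennreal (C\<^sup>2 * weight_mass)"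
  proof -
    have "(\<integral>\<^sup>+v. ennreal ((norm (g (of_real v)))\<^sup>2) \<partial>lborel) \<le> (\<integral>\<^sup>+v. ennreal (C\<^sup>2) * ennreal (weight (v - 0)) \<partial>lborel)"
    proof (intro nn_integral_mono)
      fix v
      have "(norm (g (of_real v)))\<^sup>2 \<le> (C / (1 + \<bar>Re (of_real v)\<bar>))\<^sup>2"
        using \<beta> by (intro power_mono bnd) auto
      also have "\<dots> = C\<^sup>2 * (1 / (1 + \<bar>v\<bar>)\<^sup>2)" by (simp add: power_divide)
      also have "\<dots> \<le> C\<^sup>2 * weight v" by (intro mult_left_mono inverse_square_le_weight) auto
      finally show "ennreal ((norm (g (of_real v)))\<^sup>2) \<le> ennreal (C\<^sup>2) * ennreal (weight (v - 0))"
        using weight_pos[of v] by (simp add: ennreal_leI flip: ennreal_mult)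
    qed
    also have "\<dots> = ennreal (C\<^sup>2) * ennreal weight_mass"
      by (subst nn_integral_cmult) (measurable, simp only: nn_integral_weight)
    finally show ?thesis using weight_mass_nonneg by (simp add: ennreal_mult)
  qed
  have "(\<integral>\<^sup>+v. ennreal (norm (g (of_real v) * memory q t v)) \<partial>lborel) \<le>
    (\<integral>\<^sup>+v. ennreal (\<theta> / 2) * ennreal ((norm (g (of_real v)))\<^sup>2) + ennreal (1 / (2 * \<theta>)) * ennreal ((norm (memory q t v))\<^sup>2) \<partial>lborel)"
  proof (intro nn_integral_mono)
    fix v
    let ?x = "norm (g (of_real v))" and ?y = "norm (memory q t v)"
    have "0 \<le> (\<theta> * ?x - ?y)\<^sup>2" by simp
    also have "\<dots> = 2 * \<theta> * ((\<theta> / 2) * ?x\<^sup>2 + (1 / (2 * \<theta>)) * ?y\<^sup>2 - ?x * ?y)"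
      using \<theta> by (simp add: power2_eq_square field_simps)
    finally have "?x * ?y \<le> (\<theta> / 2) * ?x\<^sup>2 + (1 / (2 * \<theta>)) * ?y\<^sup>2"
      using \<theta> by (simp add: zero_le_mult_iff)
    then have "ennreal (?x * ?y) \<le> ennreal ((\<theta> / 2) * ?x\<^sup>2 + (1 / (2 * \<theta>)) * ?y\<^sup>2)" by (rule ennreal_leI)
    also have "\<dots> = ennreal (\<theta> / 2) * ennreal (?x\<^sup>2) + ennreal (1 / (2 * \<theta>)) * ennreal (?y\<^sup>2)"
      using \<theta> by (simp only: ennreal_mult[symmetric] ennreal_plus[symmetric] zero_le_power2 mult_nonneg_nonneg
          divide_nonneg_nonneg less_imp_le zero_le_numeral zero_le_one)
    finally show "ennreal (norm (g (of_real v) * memory q t v)) \<le> ennreal (\<theta> / 2) * ennreal (?x\<^sup>2) + ennreal (1 / (2 * \<theta>)) * ennreal (?y\<^sup>2)"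
      by (simp add: norm_mult)
  qed
  also have "\<dots> = ennreal (\<theta> / 2) * (\<integral>\<^sup>+v. ennreal ((norm (g (of_real v)))\<^sup>2) \<partial>lborel) +
     ennreal (1 / (2 * \<theta>)) * (\<integral>\<^sup>+v. ennreal ((norm (memory q t v))\<^sup>2) \<partial>lborel)"
    by (subst nn_integral_add) (auto simp: nn_integral_cmult)
  also have "\<dots> \<le> ennreal (\<theta> / 2) * ennreal (C\<^sup>2 * weight_mass) + ennreal (1 / (2 * \<theta>)) * ennreal (pi * m\<^sup>2 * exp (2 * \<mu> * t) / \<mu>)"
    using m by (intro add_mono mult_left_mono g2 memory_square cont t lam le) auto
  also have "pi * m\<^sup>2 * exp (2 * \<mu> * t) / \<mu> = pi * \<theta>\<^sup>2"
    using lam by (simp add: \<theta>_def power_divide power_mult_distrib exp_double[symmetric] mult.assoc)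
  also have "ennreal (\<theta> / 2) * ennreal (C\<^sup>2 * weight_mass) + ennreal (1 / (2 * \<theta>)) * ennreal (pi * \<theta>\<^sup>2)
     = ennreal ((\<theta> / 2) * (C\<^sup>2 * weight_mass) + (1 / (2 * \<theta>)) * (pi * \<theta>\<^sup>2))"
    using \<theta> weight_mass_nonneg by (simp add: ennreal_mult[symmetric] ennreal_plus[symmetric] del: ennreal_plus)
  also have "(\<theta> / 2) * (C\<^sup>2 * weight_mass) + (1 / (2 * \<theta>)) * (pi * \<theta>\<^sup>2) = growth_const * \<theta>"
    using \<theta> by (simp add: growth_const_def power2_eq_square field_simps)
  also have "\<dots> = growth_const / sqrt \<mu> * (m * exp (\<mu> * t))" by (simp add: \<theta>_def)
  finally show ?thesis .
qed

definition growth_rate :: real where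
  "growth_rate = 4 * growth_const\<^sup>2"

lemma growth_rate_pos: "growth_rate > 0"
  using growth_const_pos by (simp add: growth_rate_def)

lemma growth_rate_half: "growth_const / sqrt growth_rate = 1 / 2"
  using growth_const_pos by (simp add: growth_rate_def real_sqrt_mult)

text \<open>
  The growth rate is chosen such that, at the maximum of \<open>exp (- growth_rate * s) * norm (q s)\<close>, the
  history term is at most half of that maximum.
\<close>

lemma volterra_growth:
  assumes cont: "continuous_on {0..} q" and M: "M > 0" and k: "k \<ge> (1::real)"
    and n: "\<And>t. t \<ge> 0 \<Longrightarrow> norm (n t) \<le> M"
    and eq: "\<And>t. t \<ge> 0 \<Longrightarrow> q t = n t - \<i> / of_real k * (LINT v|lborel. g (of_real v) * memory q t v)"
    and t: "t \<ge> 0"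
  shows "norm (q t) \<le> 2 * M * exp (growth_rate * t)"
proof -
  let ?f = "\<lambda>s. exp (- (growth_rate * s)) * norm (q s)"
  have "continuous_on {0..t} ?f"
    by (intro continuous_intros continuous_on_subset[OF cont]) auto
  \<comment> \<open>No growth of \<open>q\<close> is known beforehand, but on a compact interval the
    maximum exists, and the bound \<open>2 * M\<close> obtained for it does not depend on
    \<open>t\<close>.\<close>
  then obtain z where z: "z \<in> {0..t}" "\<And>s. s \<in> {0..t} \<Longrightarrow> ?f s \<le> ?f z"
    using continuous_attains_sup[of "{0..t}" ?f] t by auto
  define m where "m = ?f z"
  have m: "norm (q s) \<le> m * exp (growth_rate * s)" if "s \<in> {0..t}" for s
  proof -
    have "norm (q s) = ?f s * exp (growth_rate * s)" by (simp flip: exp_add)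
    also have "\<dots> \<le> m * exp (growth_rate * s)" unfolding m_def by (intro mult_right_mono z(2) that) auto
    finally show ?thesis .
  qed
  have "m \<le> 2 * M"
  proof (cases "m > 0")
    case False
    then show ?thesis using M by simp
  next
    case True
    have z0: "z \<ge> 0" using z by simp
    have "ennreal (norm (LINT v|lborel. g (of_real v) * memory q z v)) \<le> (\<integral>\<^sup>+v. ennreal (norm (g (of_real v) * memory q z v)) \<partial>lborel)"
      by (rule norm_integral_le_nn_integral)
    also have "\<dots> \<le> ennreal (growth_const / sqrt growth_rate * (m * exp (growth_rate * z)))"
      using z by (intro profile_memory_bound[OF cont z0 growth_rate_pos True] m) auto
    finally have i: "norm (LINT v|lborel. g (of_real v) * memory q z v) \<le> m * exp (growth_rate * z) / 2"
      using True by (simp add: growth_rate_half)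
    have "norm (q z) \<le> norm (n z) + norm (\<i> / of_real k * (LINT v|lborel. g (of_real v) * memory q z v))"
      by (subst eq[OF z0]) (rule norm_triangle_ineq4)
    also have "norm (\<i> / of_real k * (LINT v|lborel. g (of_real v) * memory q z v)) \<le> 1 * norm (LINT v|lborel. g (of_real v) * memory q z v)"
      unfolding norm_mult using k by (intro mult_right_mono) (auto simp: norm_divide)
    also have "norm (n z) + 1 * norm (LINT v|lborel. g (of_real v) * memory q z v) \<le> M + m * exp (growth_rate * z) / 2"
      using n[OF z0] i by simp
    finally have "norm (q z) \<le> M + m * exp (growth_rate * z) / 2" by simp
    then have "exp (- (growth_rate * z)) * norm (q z) \<le> exp (- (growth_rate * z)) * (M + m * exp (growth_rate * z) / 2)"
      by (rule mult_left_mono) simp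
    also have "\<dots> = exp (- (growth_rate * z)) * M + m / 2 * exp (- (growth_rate * z) + growth_rate * z)"
      by (simp only: exp_add) (simp add: algebra_simps)
    also have "\<dots> \<le> 1 * M + m / 2"
      using z0 growth_rate_pos M by (intro add_mono mult_right_mono) auto
    finally show ?thesis by (simp add: m_def)
  qed
  then show ?thesis using m[of t] t by (auto intro: order_trans mult_right_mono)
qed

end

section \<open>Laplace transformation of the Volterra equation and decay\<close>

context analytic_profile
begin

text \<open>For fixed \<open>v\<close> the history is the convolution of \<open>q\<close> with an
  exponential whose transform is \<open>1 / (\<i> * (v - \<omega>))\<close>. Weighted with
  \<open>g\<close> and integrated over \<open>v\<close>, this factor becomes the dispersion
  function.\<close>

lemma laplace_memory:
  assumes cont: "continuous_on {0..} q" and mu: "\<mu> > 0" and m: "m > 0"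
    and le: "\<And>t. t \<ge> 0 \<Longrightarrow> norm (q t) \<le> m * exp (\<mu> * t)"
    and w: "Im \<omega> > \<mu>"
  shows "(LINT t|lborel. exp (\<i> * \<omega> * of_real t) * (indicator {0..} t *\<^sub>R (LINT v|lborel. g (of_real v) * memory q t v)))
     = - \<i> * dispersion \<omega> * laplace q \<omega>"
proof -
  note [measurable] = memory_measurable[OF cont] measurable_on_half_line[OF cont]
  have [measurable]: "(\<lambda>t. exp (\<i> * \<omega> * complex_of_real t)) \<in> borel_measurable borel"
    by (intro borel_measurable_continuous_onI continuous_intros)
  have y: "Im \<omega> > 0" using mu w by simp
  let ?E = "\<lambda>t. exp (\<i> * \<omega> * complex_of_real t)"
  have nE: "norm (?E t) = exp (- (Im \<omega> * t))" for t by (simp add: norm_exp_eq_Re)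
  define I where "I t = (LINT v|lborel. norm (g (of_real v) * memory q t v))" for t
  have I_bound: "integrable lborel (\<lambda>v. g (of_real v) * memory q t v)"
      "I t \<le> growth_const / sqrt \<mu> * (m * exp (\<mu> * t))" if "t \<ge> 0" for t
  proof -
    have b: "(\<integral>\<^sup>+v. ennreal (norm (g (of_real v) * memory q t v)) \<partial>lborel) \<le> ennreal (growth_const / sqrt \<mu> * (m * exp (\<mu> * t)))"
      by (rule profile_memory_bound) (use assms that in auto)
    show i: "integrable lborel (\<lambda>v. g (of_real v) * memory q t v)"
      by (rule integrableI_bounded) (use b in \<open>auto simp: order_le_less_trans\<close>)
    have "ennreal (I t) = (\<integral>\<^sup>+v. ennreal (norm (g (of_real v) * memory q t v)) \<partial>lborel)"
      unfolding I_def using i by (intro nn_integral_eq_integral[symmetric]) auto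
    with b have "ennreal (I t) \<le> ennreal (growth_const / sqrt \<mu> * (m * exp (\<mu> * t)))" by simp
    then show "I t \<le> growth_const / sqrt \<mu> * (m * exp (\<mu> * t))"
      using growth_const_pos mu m by (subst (asm) ennreal_le_iff) auto
  qed
  define K where "K = growth_const / sqrt \<mu> * m"
  have hint: "integrable lborel (\<lambda>t. D * (indicator {0..} t * exp (- ((Im \<omega> - \<mu>) * t))))" for D
    using has_bochner_integral_exp_half_line_real[of "Im \<omega> - \<mu>"] w by (intro integrable_mult_right) (auto intro: integrable.intros)
  have ee: "exp (- (Im \<omega> * t)) * (D * exp (\<mu> * t)) = D * exp (- ((Im \<omega> - \<mu>) * t))" for t D
  proof -
    have "exp (- (Im \<omega> * t)) * exp (\<mu> * t) = exp (- ((Im \<omega> - \<mu>) * t))"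
      by (simp add: algebra_simps flip: exp_add)
    then show ?thesis by (simp add: mult.left_commute)
  qed
  \<comment> \<open>Absolute convergence in \<open>v\<close> cannot be taken from \<open>g\<close>
    alone; \<open>profile_memory_bound\<close> provides it together with the growth
    \<open>exp (\<mu> * t)\<close>, which \<open>Im \<omega> > \<mu>\<close> compensates.\<close>
  have int1: "integrable (lborel \<Otimes>\<^sub>M lborel) (\<lambda>(t, v). ?E t * (indicator {0..} t *\<^sub>R (g (of_real v) * memory q t v)))"
  proof (rule lborel_pair.Fubini_integrable)
    show "integrable lborel (\<lambda>t. LINT v|lborel. norm (case (t, v) of (t, v) \<Rightarrow> ?E t * (indicator {0..} t *\<^sub>R (g (of_real v) * memory q t v))))"
    proof (rule Bochner_Integration.integrable_bound[OF hint[of K]])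
      show "AE t in lborel. norm (LINT v|lborel. norm (case (t, v) of (t, v) \<Rightarrow> ?E t * (indicator {0..} t *\<^sub>R (g (of_real v) * memory q t v))))
         \<le> norm (K * (indicator {0..} t * exp (- ((Im \<omega> - \<mu>) * t))))"
      proof (intro AE_I2)
        fix t
        have "(LINT v|lborel. norm (?E t * (indicator {0..} t *\<^sub>R (g (of_real v) * memory q t v)))) =
           (LINT v|lborel. (exp (- (Im \<omega> * t)) * indicator {0..} t) * norm (g (of_real v) * memory q t v))"
          by (intro Bochner_Integration.integral_cong refl) (simp only: norm_mult nE norm_scaleR, simp)
        also have "\<dots> = (exp (- (Im \<omega> * t)) * indicator {0..} t) * I t"
          unfolding I_def by (rule integral_mult_right_zero)
        finally have e: "(LINT v|lborel. norm (?E t * (indicator {0..} t *\<^sub>R (g (of_real v) * memory q t v)))) = (exp (- (Im \<omega> * t)) * indicator {0..} t) * I t" .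
        have I0: "I t \<ge> 0" unfolding I_def by simp
        have "(exp (- (Im \<omega> * t)) * indicator {0..} t) * I t \<le> K * (indicator {0..} t * exp (- ((Im \<omega> - \<mu>) * t)))"
        proof (cases "t \<ge> 0")
          case True
          have "exp (- (Im \<omega> * t)) * I t \<le> exp (- (Im \<omega> * t)) * (K * exp (\<mu> * t))"
            using I_bound(2)[OF True] by (intro mult_left_mono) (auto simp: K_def)
          then show ?thesis unfolding ee using True by simp
        qed simp
        moreover have "(exp (- (Im \<omega> * t)) * indicator {0..} t) * I t \<ge> 0" using I0 by simp
        ultimately show "norm (LINT v|lborel. norm (case (t, v) of (t, v) \<Rightarrow> ?E t * (indicator {0..} t *\<^sub>R (g (of_real v) * memory q t v))))
         \<le> norm (K * (indicator {0..} t * exp (- ((Im \<omega> - \<mu>) * t))))"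
          unfolding prod.case e by simp
      qed
    qed measurable
    show "AE t in lborel. integrable lborel (\<lambda>v. case (t, v) of (t, v) \<Rightarrow> ?E t * (indicator {0..} t *\<^sub>R (g (of_real v) * memory q t v)))"
    proof (intro AE_I2)
      fix t
      show "integrable lborel (\<lambda>v. case (t, v) of (t, v) \<Rightarrow> ?E t * (indicator {0..} t *\<^sub>R (g (of_real v) * memory q t v)))"
        unfolding prod.case using I_bound(1)[of t] by (cases "t \<ge> 0") (auto intro!: integrable_mult_right)
    qed
  qed measurable
  have inner: "(LINT t|lborel. ?E t * (indicator {0..} t *\<^sub>R (g (of_real v) * memory q t v))) = - \<i> * (g (of_real v) / (of_real v - \<omega>)) * laplace q \<omega>" for v
  proof -
    let ?z = "\<i> * (of_real v - \<omega>)"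
    have z: "Re ?z > 0" using y by simp
    \<comment> \<open>Factors the exponentials into a function of \<open>s\<close> and one of
      \<open>t - s\<close>, which exhibits the convolution.\<close>
    have E: "?E t * cis (- (v * (t - s))) = ?E s * exp (- (?z * of_real (t - s)))" for t s
      by (simp add: cis_conv_exp algebra_simps flip: exp_add)
    let ?B = "\<lambda>s t. (?E s * (indicator {0..} s *\<^sub>R q s)) * (indicator {0..} (t - s) *\<^sub>R exp (- (?z * of_real (t - s))))"
    have hz: "has_bochner_integral lborel (\<lambda>t. indicator {0..} (t - s) *\<^sub>R exp (- (?z * of_real (t - s)))) (1 / ?z)" for s
      using lborel_has_bochner_integral_real_affine_iff[of 1 "\<lambda>t. indicator {0..} t *\<^sub>R exp (- (?z * of_real t))" "1 / ?z" "- s"]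
        has_bochner_integral_exp_half_line[OF z] by simp
    have hz': "has_bochner_integral lborel (\<lambda>t. indicator {0..} (t - s) * exp (- (Im \<omega> * (t - s)))) (1 / Im \<omega>)" for s
      using lborel_has_bochner_integral_real_affine_iff[of 1 "\<lambda>t. indicator {0..} t * exp (- (Im \<omega> * t))" "1 / Im \<omega>" "- s"]
        has_bochner_integral_exp_half_line_real[OF y] by simp
    have nz: "norm (exp (- (?z * of_real x))) = exp (- (Im \<omega> * x))" for x by (simp add: norm_exp_eq_Re)
    have [measurable]: "(\<lambda>x. exp (- (?z * complex_of_real x))) \<in> borel_measurable borel"
      by (intro borel_measurable_continuous_onI continuous_intros)
    have int2: "integrable (lborel \<Otimes>\<^sub>M lborel) (\<lambda>(s, t). ?B s t)"
    proof (rule lborel_pair.Fubini_integrable)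
      have e: "(LINT t|lborel. norm (?B s t)) = (exp (- (Im \<omega> * s)) * (indicator {0..} s * norm (q s))) * (1 / Im \<omega>)" for s
      proof -
        have "(LINT t|lborel. norm (?B s t)) = (LINT t|lborel. (exp (- (Im \<omega> * s)) * (indicator {0..} s * norm (q s))) * (indicator {0..} (t - s) * exp (- (Im \<omega> * (t - s)))))"
          by (intro Bochner_Integration.integral_cong refl) (simp only: norm_mult nE norm_scaleR nz, simp)
        also have "\<dots> = (exp (- (Im \<omega> * s)) * (indicator {0..} s * norm (q s))) * (1 / Im \<omega>)"
          by (simp only: integral_mult_right_zero has_bochner_integral_integral_eq[OF hz'])
        finally show ?thesis .
      qed
      show "integrable lborel (\<lambda>s. LINT t|lborel. norm (case (s, t) of (s, t) \<Rightarrow> ?B s t))"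
        unfolding prod.case e
      proof (rule Bochner_Integration.integrable_bound[OF hint[of "m / Im \<omega>"]])
        show "AE s in lborel. norm ((exp (- (Im \<omega> * s)) * (indicator {0..} s * norm (q s))) * (1 / Im \<omega>))
          \<le> norm (m / Im \<omega> * (indicator {0..} s * exp (- ((Im \<omega> - \<mu>) * s))))"
        proof (intro AE_I2)
          fix s
          show "norm ((exp (- (Im \<omega> * s)) * (indicator {0..} s * norm (q s))) * (1 / Im \<omega>))
            \<le> norm (m / Im \<omega> * (indicator {0..} s * exp (- ((Im \<omega> - \<mu>) * s))))"
          proof (cases "s \<ge> 0")
            case True
            have "exp (- (Im \<omega> * s)) * norm (q s) \<le> exp (- (Im \<omega> * s)) * (m * exp (\<mu> * s))"
              using le[OF True] by (intro mult_left_mono) auto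
            then have "exp (- (Im \<omega> * s)) * norm (q s) / Im \<omega> \<le> m * exp (- ((Im \<omega> - \<mu>) * s)) / Im \<omega>"
              unfolding ee using y by (intro divide_right_mono) auto
            then show ?thesis using True y m by (simp add: abs_mult)
          qed simp
        qed
        have "(\<lambda>s. exp (- (Im \<omega> * s)) * norm (indicator {0..} s *\<^sub>R q s) * (1 / Im \<omega>)) \<in> borel_measurable lborel"
          by measurable
        then show "(\<lambda>s. (exp (- (Im \<omega> * s)) * (indicator {0..} s * norm (q s))) * (1 / Im \<omega>)) \<in> borel_measurable lborel"
          by simp
      qed
      show "AE s in lborel. integrable lborel (\<lambda>t. case (s, t) of (s, t) \<Rightarrow> ?B s t)"
        unfolding prod.case by (intro AE_I2 integrable_mult_right integrable.intros[OF hz])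
    qed measurable
    have "(LINT t|lborel. ?E t * (indicator {0..} t *\<^sub>R (g (of_real v) * memory q t v))) =
       (LINT t|lborel. g (of_real v) * (LINT s|lborel. ?B s t))"
    proof (intro Bochner_Integration.integral_cong refl)
      fix t
      have "?E t * (indicator {0..} t *\<^sub>R memory q t v) = (LINT s|lborel. (?E t * indicator {0..} t) * (indicator {0..t} s *\<^sub>R (cis (- (v * (t - s))) * q s)))"
        unfolding memory_def by (simp add: scaleR_conv_of_real indicator_def)
      also have "\<dots> = (LINT s|lborel. ?B s t)"
      proof (intro Bochner_Integration.integral_cong refl)
        fix s
        show "(?E t * indicator {0..} t) * (indicator {0..t} s *\<^sub>R (cis (- (v * (t - s))) * q s)) = ?B s t"
        proof (cases "0 \<le> s \<and> s \<le> t")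
          case True
          then have "(?E t * indicator {0..} t) * (indicator {0..t} s *\<^sub>R (cis (- (v * (t - s))) * q s)) = (?E t * cis (- (v * (t - s)))) * q s"
            by (simp add: mult.assoc)
          also have "\<dots> = ?B s t" unfolding E using True by (simp add: mult_ac)
          finally show ?thesis .
        next
          case False
          then show ?thesis by (auto simp: indicator_def)
        qed
      qed
      finally have "?E t * (indicator {0..} t *\<^sub>R memory q t v) = (LINT s|lborel. ?B s t)" .
      then show "?E t * (indicator {0..} t *\<^sub>R (g (of_real v) * memory q t v)) = g (of_real v) * (LINT s|lborel. ?B s t)"
        by (metis mult.left_commute mult_scaleR_right)
    qed
    also have "\<dots> = g (of_real v) * (LINT t|lborel. LINT s|lborel. ?B s t)" by (rule integral_mult_right_zero)
    also have "(LINT t|lborel. LINT s|lborel. ?B s t) = (LINT s|lborel. LINT t|lborel. ?B s t)"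
      by (rule lborel_pair.Fubini_integral[OF int2])
    also have "\<dots> = (LINT s|lborel. (?E s * (indicator {0..} s *\<^sub>R q s)) * (1 / ?z))"
      by (simp only: integral_mult_right_zero has_bochner_integral_integral_eq[OF hz])
    also have "\<dots> = laplace q \<omega> * (1 / ?z)"
      unfolding laplace_eq by (rule integral_mult_left_zero)
    also have "1 / ?z = - \<i> * (1 / (of_real v - \<omega>))"
      by (simp only: divide_inverse inverse_mult_distrib inverse_i) simp
    finally show ?thesis by simp
  qed
  have "(LINT t|lborel. ?E t * (indicator {0..} t *\<^sub>R (LINT v|lborel. g (of_real v) * memory q t v)))
    = (LINT t|lborel. LINT v|lborel. ?E t * (indicator {0..} t *\<^sub>R (g (of_real v) * memory q t v)))"
    by (simp only: integral_mult_right_zero integral_scaleR_right)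
  also have "\<dots> = (LINT v|lborel. LINT t|lborel. ?E t * (indicator {0..} t *\<^sub>R (g (of_real v) * memory q t v)))"
    by (rule lborel_pair.Fubini_integral[symmetric, OF int1])
  also have "\<dots> = (LINT v|lborel. - \<i> * (g (of_real v) / (of_real v - \<omega>)) * laplace q \<omega>)"
    by (simp only: inner)
  also have "\<dots> = - \<i> * dispersion \<omega> * laplace q \<omega>"
    unfolding dispersion_upper[OF y] by (simp only: integral_mult_right_zero integral_mult_left_zero)
  finally show ?thesis .
qed

text \<open>Confined to heights above the a priori growth rate, where the transform of
  \<open>q\<close> is known to converge. Solved for \<open>laplace q\<close>, the identity leaves an
  expression in \<open>n\<close> and \<open>dispersion\<close> alone, and this is what extends
  further down.\<close>

lemma laplace_volterra:
  assumes cont: "continuous_on {0..} q" and contn: "continuous_on {0..} n" and M: "M > 0" and k: "k \<ge> (1::real)"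
    and n: "\<And>t. t \<ge> 0 \<Longrightarrow> norm (n t) \<le> M"
    and eq: "\<And>t. t \<ge> 0 \<Longrightarrow> q t = n t - \<i> / of_real k * (LINT v|lborel. g (of_real v) * memory q t v)"
    and w: "Im \<omega> > growth_rate"
  shows "of_real k * laplace q \<omega> = of_real k * laplace n \<omega> - dispersion \<omega> * laplace q \<omega>"
proof -
  let ?E = "\<lambda>t. exp (\<i> * \<omega> * complex_of_real t)"
  have [measurable]: "?E \<in> borel_measurable borel"
    by (intro borel_measurable_continuous_onI continuous_intros)
  have q: "norm (q t) \<le> 2 * M * exp (- (- growth_rate * t))" if "t \<ge> 0" for t
    using volterra_growth[OF cont M k n eq that] by simp
  have n': "norm (n t) \<le> M * exp (- (0 * t))" if "t \<ge> 0" for t using n[OF that] by simp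
  have int: "integrable lborel (\<lambda>t. ?E t * (indicator {0..} t *\<^sub>R p t))"
    if "continuous_on {0..} p" "\<And>t. t \<ge> 0 \<Longrightarrow> norm (p t) \<le> D * exp (- (a * t))" "a + Im \<omega> > 0" "D \<ge> 0" for p D a
  proof -
    have "integrable lborel (\<lambda>t. cis (Re \<omega> * t) * damped p (Im \<omega>) t)"
      by (intro integrable_cis_mult integrable_damped[OF that(1) that(2)] that)
    also have "(\<lambda>t. cis (Re \<omega> * t) * damped p (Im \<omega>) t) = (\<lambda>t. ?E t * (indicator {0..} t *\<^sub>R p t))"
      by (simp add: fun_eq_iff damped_def exp_eq_polar scaleR_conv_of_real)
    finally show ?thesis .
  qed
  have iq: "integrable lborel (\<lambda>t. ?E t * (indicator {0..} t *\<^sub>R q t))"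
    by (rule int[OF cont q]) (use M w in auto)
  have "in": "integrable lborel (\<lambda>t. ?E t * (indicator {0..} t *\<^sub>R n t))"
    by (rule int[OF contn n']) (use M w growth_rate_pos in auto)
  let ?Q = "\<lambda>t. LINT v|lborel. g (of_real v) * memory q t v"
  have 1: "(LINT t|lborel. ?E t * (indicator {0..} t *\<^sub>R ?Q t)) = - \<i> * dispersion \<omega> * laplace q \<omega>"
    by (rule laplace_memory[OF cont growth_rate_pos _ _ w, of "2 * M"]) (use q M in auto)
  have 2: "(LINT t|lborel. ?E t * (indicator {0..} t *\<^sub>R ?Q t)) = (LINT t|lborel. - \<i> * of_real k * (?E t * (indicator {0..} t *\<^sub>R n t) - ?E t * (indicator {0..} t *\<^sub>R q t)))"
  proof (intro Bochner_Integration.integral_cong refl)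
    fix t
    show "?E t * (indicator {0..} t *\<^sub>R ?Q t) = - \<i> * of_real k * (?E t * (indicator {0..} t *\<^sub>R n t) - ?E t * (indicator {0..} t *\<^sub>R q t))"
    proof (cases "t \<ge> 0")
      case True
      have "n t - q t = \<i> / of_real k * ?Q t" using eq[OF True] by simp
      then have Q: "?Q t = - \<i> * of_real k * (n t - q t)" using k by simp
      show ?thesis unfolding Q using True by (simp add: algebra_simps)
    qed simp
  qed
  have 3: "(LINT t|lborel. - \<i> * of_real k * (?E t * (indicator {0..} t *\<^sub>R n t) - ?E t * (indicator {0..} t *\<^sub>R q t))) = - \<i> * of_real k * (laplace n \<omega> - laplace q \<omega>)"
    unfolding laplace_eq by (simp only: integral_mult_right_zero Bochner_Integration.integral_diff[OF "in" iq])
  have "- \<i> * of_real k * (laplace n \<omega> - laplace q \<omega>) = - \<i> * dispersion \<omega> * laplace q \<omega>"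
    by (rule trans[OF 3[symmetric] trans[OF 2[symmetric] 1]])
  then have "- \<i> * (of_real k * (laplace n \<omega> - laplace q \<omega>)) = - \<i> * (dispersion \<omega> * laplace q \<omega>)" by (simp only: mult.assoc)
  then have "of_real k * (laplace n \<omega> - laplace q \<omega>) = dispersion \<omega> * laplace q \<omega>" by simp
  then show ?thesis by (simp add: algebra_simps)
qed

text \<open>The rate and the constant precede \<open>k\<close>, \<open>n\<close> and
  \<open>q\<close>: they see the source only through \<open>M\<close> and \<open>\<eta>\<close>, and
  both the a priori growth and the lower bound on \<open>of_real k + dispersion \<omega>\<close> are
  uniform in \<open>k\<close>. Real \<open>k\<close> cost nothing, as only \<open>k \<ge> 1\<close>
  is used.\<close>

theorem volterra_decay:
  assumes penrose: "\<And>\<omega>. gr \<omega> = 0 \<Longrightarrow> \<exists>P. has_cauchy_pv (\<lambda>v. gr v / (v - \<omega>)) \<omega> P \<and> P > -1"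
    and eta: "\<eta> > 0" and M: "M > 0"
  shows "\<exists>\<delta>>0. \<exists>K>0. \<forall>n q k. k \<ge> (1::real) \<longrightarrow> continuous_on {0..} q \<longrightarrow> continuous_on {0..} n \<longrightarrow>
    (\<forall>t\<ge>0. norm (n t) \<le> M * exp (- (\<eta> * t))) \<longrightarrow>
    (\<forall>t\<ge>0. q t = n t - \<i> / of_real k * (LINT v|lborel. g (of_real v) * memory q t v)) \<longrightarrow>
    (\<forall>t>0. norm (q t) \<le> K * exp (- (\<delta> * t)))"
proof -
  obtain \<delta>0 c where d0: "0 < \<delta>0" "\<delta>0 \<le> \<beta> / 2" and c: "0 < c"
    and nv: "\<And>\<omega> k. Im \<omega> \<ge> - \<delta>0 \<Longrightarrow> k \<ge> 1 \<Longrightarrow> c \<le> norm (of_real k + dispersion \<omega>)"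
    using dispersion_nonvanishing[OF penrose] by blast
  \<comment> \<open>Half of both limits, so that the target line lies strictly inside the strip
    where the transform of \<open>n\<close> and the lower bound on the denominator are
    available.\<close>
  define \<delta> where "\<delta> = min \<delta>0 \<eta> / 2"
  have d: "0 < \<delta>" "\<delta> < \<delta>0" "\<delta> < \<eta>" using d0 eta by (auto simp: \<delta>_def)
  define y1 where "y1 = growth_rate + 1"
  have y1: "y1 > growth_rate" "y1 > 0" using growth_rate_pos by (auto simp: y1_def)
  \<comment> \<open>The product in \<open>\<Psi>\<close> is split by the inequality of arithmetic
    and geometric means, whence \<open>1 / (2 * c)\<close>. The summands are the Bessel bound for
    the source on the worst line \<open>Im \<omega> = - \<delta>\<close> and the square integral of
    the bound on \<open>dispersion\<close>.\<close>
  define L where "L = (pi * M\<^sup>2 / (\<eta> - \<delta>) + dispersion_const\<^sup>2 * weight_mass) / (2 * c)"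
  have L: "L > 0" unfolding L_def using M d c weight_mass_nonneg
    by (intro divide_pos_pos add_pos_nonneg mult_nonneg_nonneg) auto
  show ?thesis
  proof (rule exI[of _ \<delta>], intro exI[of _ "M + L"] conjI allI impI)
    show "\<delta> > 0" "M + L > 0" using d M L by auto
    fix n q :: "real \<Rightarrow> complex" and k t :: real
    assume k: "k \<ge> 1" and cont: "continuous_on {0..} q" and contn: "continuous_on {0..} n"
      and n: "\<forall>t\<ge>0. norm (n t) \<le> M * exp (- (\<eta> * t))"
      and eq: "\<forall>t\<ge>0. q t = n t - \<i> / of_real k * (LINT v|lborel. g (of_real v) * memory q t v)"
      and t: "t > 0"
    have nM: "norm (n t) \<le> M" if "t \<ge> 0" for t
    proof -
      have "norm (n t) \<le> M * exp (- (\<eta> * t))" using n that by simp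
      also have "\<dots> \<le> M * 1" using M eta that by (intro mult_left_mono) auto
      finally show ?thesis by simp
    qed
    have q: "norm (q t) \<le> 2 * M * exp (growth_rate * t)" if "t \<ge> 0" for t
      by (rule volterra_growth[OF cont M k nM _ that]) (use eq in auto)
    have n': "norm (n t) \<le> M * exp (- (\<eta> * t))" if "t \<ge> 0" for t using n that by blast
    \<comment> \<open>The transform of \<open>n - q\<close>, written without the transform of
      \<open>q\<close>, which so far exists only above the growth rate.\<close>
    define \<Psi> where "\<Psi> \<omega> = laplace n \<omega> * dispersion \<omega> / (of_real k + dispersion \<omega>)" for \<omega>
    have nz: "of_real k + dispersion \<omega> \<noteq> 0" if "Im \<omega> \<ge> - \<delta>0" for \<omega>
      using nv[OF that k] c by auto
    have hol\<Psi>: "\<Psi> holomorphic_on {\<omega>. - min \<delta>0 \<eta> < Im \<omega> \<and> Im \<omega> < y1 + 1}"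
      unfolding \<Psi>_def[abs_def]
    proof (intro holomorphic_intros)
      show "laplace n holomorphic_on {\<omega>. - min \<delta>0 \<eta> < Im \<omega> \<and> Im \<omega> < y1 + 1}"
        by (rule holomorphic_on_subset[OF holomorphic_laplace[OF contn n']]) (use M in auto)
      show "dispersion holomorphic_on {\<omega>. - min \<delta>0 \<eta> < Im \<omega> \<and> Im \<omega> < y1 + 1}"
        by (rule holomorphic_on_subset[OF holomorphic_dispersion]) (use d0 in auto)
      show "dispersion holomorphic_on {\<omega>. - min \<delta>0 \<eta> < Im \<omega> \<and> Im \<omega> < y1 + 1}"
        by (rule holomorphic_on_subset[OF holomorphic_dispersion]) (use d0 in auto)
    qed (auto intro!: nz)
    have cont\<Psi>: "continuous_on UNIV (\<lambda>x. \<Psi> (Complex x y))" if "- \<delta> \<le> y" "y \<le> y1" for y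
      using d that by (intro continuous_on_compose2[OF holomorphic_on_imp_continuous_on[OF hol\<Psi>]] continuous_intros) auto
    have L1: "(\<integral>\<^sup>+x. ennreal (norm (\<Psi> (Complex x y))) \<partial>lborel) \<le> ennreal L" if y: "- \<delta> \<le> y" "y \<le> y1" for y
    proof -
      have contl: "continuous_on UNIV (\<lambda>x. laplace n (Complex x y))"
        by (rule continuous_on_compose2[OF holomorphic_on_imp_continuous_on[OF holomorphic_laplace[OF contn n']]])
           (use M y d in \<open>auto intro!: continuous_intros\<close>)
      have contd: "continuous_on UNIV (\<lambda>x. dispersion (Complex x y))"
        by (rule continuous_on_compose2[OF continuous_on_dispersion]) (use d0 y d in \<open>auto intro!: continuous_intros\<close>)
      note [measurable] = borel_measurable_continuous_onI[OF contl] borel_measurable_continuous_onI[OF contd]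
      have "(\<integral>\<^sup>+x. ennreal (norm (\<Psi> (Complex x y))) \<partial>lborel) \<le>
        (\<integral>\<^sup>+x. ennreal (1 / (2 * c)) * (ennreal ((norm (laplace n (Complex x y)))\<^sup>2) + ennreal ((norm (dispersion (Complex x y)))\<^sup>2)) \<partial>lborel)"
      proof (intro nn_integral_mono)
        fix x
        let ?a = "norm (laplace n (Complex x y))" and ?b = "norm (dispersion (Complex x y))"
        have "norm (\<Psi> (Complex x y)) \<le> (?a * ?b) / c"
          unfolding \<Psi>_def norm_mult norm_divide using c y d k by (intro divide_left_mono nv mult_pos_pos order_less_le_trans[OF c nv]) auto
        also have "\<dots> \<le> ((?a\<^sup>2 + ?b\<^sup>2) / 2) / c"
          using sum_squares_bound[of ?a ?b] c by (intro divide_right_mono) auto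
        also have "\<dots> = 1 / (2 * c) * (?a\<^sup>2 + ?b\<^sup>2)" by simp
        finally have "ennreal (norm (\<Psi> (Complex x y))) \<le> ennreal (1 / (2 * c) * (?a\<^sup>2 + ?b\<^sup>2))" by (rule ennreal_leI)
        then show "ennreal (norm (\<Psi> (Complex x y))) \<le> ennreal (1 / (2 * c)) * (ennreal (?a\<^sup>2) + ennreal (?b\<^sup>2))"
          using c by (subst (asm) ennreal_mult) (auto simp: ennreal_plus)
      qed
      also have "\<dots> = ennreal (1 / (2 * c)) * ((\<integral>\<^sup>+x. ennreal ((norm (laplace n (Complex x y)))\<^sup>2) \<partial>lborel) + (\<integral>\<^sup>+x. ennreal ((norm (dispersion (Complex x y)))\<^sup>2) \<partial>lborel))"
        by (subst nn_integral_cmult, measurable) (subst nn_integral_add, auto)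
      also have "\<dots> \<le> ennreal (1 / (2 * c)) * (ennreal (pi * M\<^sup>2 / (\<eta> - \<delta>)) + ennreal (dispersion_const\<^sup>2 * weight_mass))"
      proof (intro mult_left_mono add_mono)
        have "(\<integral>\<^sup>+x. ennreal ((norm (laplace n (Complex x y)))\<^sup>2) \<partial>lborel) \<le> ennreal (pi * M\<^sup>2 / (\<eta> + y))"
          using M d y by (intro laplace_square[OF contn n']) auto
        also have "\<dots> \<le> ennreal (pi * M\<^sup>2 / (\<eta> - \<delta>))"
          using d y by (intro ennreal_leI divide_left_mono mult_pos_pos) auto
        finally show "(\<integral>\<^sup>+x. ennreal ((norm (laplace n (Complex x y)))\<^sup>2) \<partial>lborel) \<le> ennreal (pi * M\<^sup>2 / (\<eta> - \<delta>))" .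
        have "(\<integral>\<^sup>+x. ennreal ((norm (dispersion (Complex x y)))\<^sup>2) \<partial>lborel) \<le> (\<integral>\<^sup>+x. ennreal (dispersion_const\<^sup>2) * ennreal (weight (x - 0)) \<partial>lborel)"
        proof (intro nn_integral_mono)
          fix x
          have y2: "y \<ge> - \<beta> / 2" using y d d0 by simp
          have "norm (dispersion (Complex x y)) \<le> dispersion_const * (1 + \<bar>x\<bar> + (y + \<beta>)) powr (- 3 / 4)"
            using dispersion_bound[of "Complex x y"] y2 by simp
          also have "\<dots> \<le> dispersion_const * (1 + \<bar>x\<bar>) powr (- 3 / 4)"
            using y2 \<beta> dispersion_const_nonneg by (intro mult_left_mono powr_mono2') auto
          finally have "(norm (dispersion (Complex x y)))\<^sup>2 \<le> (dispersion_const * (1 + \<bar>x\<bar>) powr (- 3 / 4))\<^sup>2"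
            by (rule power_mono) simp
          also have "\<dots> = dispersion_const\<^sup>2 * (1 + \<bar>x\<bar>) powr (- 3 / 2)"
            by (simp add: power_mult_distrib power2_eq_square flip: powr_add)
          also have "\<dots> \<le> dispersion_const\<^sup>2 * weight x"
            unfolding weight_def by (intro mult_left_mono powr_mono) auto
          finally have "ennreal ((norm (dispersion (Complex x y)))\<^sup>2) \<le> ennreal (dispersion_const\<^sup>2 * weight x)" by (rule ennreal_leI)
          then show "ennreal ((norm (dispersion (Complex x y)))\<^sup>2) \<le> ennreal (dispersion_const\<^sup>2) * ennreal (weight (x - 0))"
            using weight_pos[of x] by (simp add: ennreal_mult)
        qed
        also have "\<dots> = ennreal (dispersion_const\<^sup>2) * ennreal weight_mass"
          by (subst nn_integral_cmult) (measurable, simp only: nn_integral_weight)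
        finally show "(\<integral>\<^sup>+x. ennreal ((norm (dispersion (Complex x y)))\<^sup>2) \<partial>lborel) \<le> ennreal (dispersion_const\<^sup>2 * weight_mass)"
          using weight_mass_nonneg by (simp add: ennreal_mult)
      qed simp
      also have "\<dots> = ennreal (1 / (2 * c) * (pi * M\<^sup>2 / (\<eta> - \<delta>) + dispersion_const\<^sup>2 * weight_mass))"
        using c d weight_mass_nonneg by (subst ennreal_mult) (auto simp: ennreal_plus)
      also have "1 / (2 * c) * (pi * M\<^sup>2 / (\<eta> - \<delta>) + dispersion_const\<^sup>2 * weight_mass) = L" by (simp add: L_def)
      finally show ?thesis .
    qed
    define p where "p s = n s - q s" for s
    have contp: "continuous_on {0..} p" unfolding p_def by (intro continuous_intros cont contn)
    have ple: "norm (p s) \<le> (3 * M) * exp (- (- growth_rate * s))" if s: "s \<ge> 0" for s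
    proof -
      have "norm (p s) \<le> M + 2 * M * exp (growth_rate * s)"
        unfolding p_def using nM[OF s] q[OF s] norm_triangle_ineq4[of "n s" "q s"] by linarith
      moreover have "M \<le> M * exp (growth_rate * s)" using M s growth_rate_pos by simp
      ultimately show ?thesis by simp
    qed
    have lap: "fourier (damped p y1) x = \<Psi> (Complex x y1)" for x
    proof -
      let ?w = "Complex x y1"
      have "of_real k * laplace q ?w = of_real k * laplace n ?w - dispersion ?w * laplace q ?w"
        using y1 by (intro laplace_volterra[OF cont contn M k nM]) (use eq in auto)
      then have "laplace q ?w * (of_real k + dispersion ?w) = of_real k * laplace n ?w" by (simp add: algebra_simps)
      then have lq: "laplace q ?w = of_real k * laplace n ?w / (of_real k + dispersion ?w)"
        using nz[of ?w] y1 d0 by (simp add: field_simps)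
      have "fourier (damped p y1) x = laplace n ?w - laplace q ?w"
      proof -
        have "damped p y1 = (\<lambda>s. damped n y1 s - damped q y1 s)"
          by (simp add: fun_eq_iff damped_def p_def algebra_simps)
        moreover have "integrable lborel (\<lambda>s. cis (x * s) * damped n y1 s)"
          using M y1 eta by (intro integrable_cis_mult integrable_damped[OF contn n']) auto
        moreover have "integrable lborel (\<lambda>s. cis (x * s) * damped q y1 s)"
          using M y1 q by (intro integrable_cis_mult integrable_damped[OF cont, of "2 * M" "- growth_rate"]) auto
        ultimately show ?thesis
          unfolding laplace_def fourier_def complex.sel by (simp add: right_diff_distrib)
      qed
      also have "\<dots> = \<Psi> ?w"
        unfolding lq \<Psi>_def using nz[of ?w] y1 d0 by (simp add: field_simps)
      finally show ?thesis .
    qed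
    have int\<Psi>: "integrable lborel (\<lambda>x. \<Psi> (Complex x y1))"
      by (rule integrable_on_line[OF cont\<Psi> L1]) (use y1 d in auto)
    have inv: "(LINT x|lborel. cis (- x * t) * fourier (damped p y1) x) = (2 * pi) *\<^sub>R damped p y1 t"
    proof (rule fourier_inversion[where B = "3 * M"])
      show "integrable lborel (damped p y1)"
        using M y1 by (intro integrable_damped[OF contp ple]) auto
      show "norm (damped p y1 s) \<le> 3 * M" for s
      proof -
        have "norm (damped p y1 s) \<le> 3 * M * (indicator {0..} s * exp (- ((- growth_rate + y1) * s)))"
          using M by (intro norm_damped_le[OF contp ple]) auto
        also have "\<dots> \<le> 3 * M * 1" using M y1 by (intro mult_left_mono) (auto simp: indicator_def)
        finally show ?thesis by simp
      qed
      \<comment> \<open>Here \<open>t > 0\<close> enters: the point stays away from the cut-off at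
        the origin.\<close>
      show "isCont (damped p y1) t"
      proof -
        have "continuous_on {0<..} (\<lambda>s. exp (- (y1 * s)) *\<^sub>R p s)"
          by (intro continuous_intros continuous_on_subset[OF contp]) auto
        then have "continuous_on {0<..} (damped p y1)"
          by (rule continuous_on_eq) (auto simp: damped_def)
        then show ?thesis using t by (simp add: continuous_on_eq_continuous_at)
      qed
      show "integrable lborel (fourier (damped p y1))"
        using int\<Psi> by (simp add: lap[abs_def] lap)
    qed
    let ?\<phi> = "\<lambda>\<omega>. exp (- \<i> * \<omega> * of_real t) * \<Psi> \<omega>"
    have nphi: "norm (?\<phi> (Complex x y)) = exp (y * t) * norm (\<Psi> (Complex x y))" for x y
      by (simp add: norm_mult norm_exp_eq_Re)
    \<comment> \<open>The crude bound by \<open>exp (y1 * t)\<close> merely licenses the shift; the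
      decay comes from estimating the integral on the lower line alone.\<close>
    have shift: "(LINT x|lborel. ?\<phi> (Complex x (- \<delta>))) = (LINT x|lborel. ?\<phi> (Complex x y1))"
    proof (rule strip_line_integral_shift)
      show "?\<phi> holomorphic_on {\<omega>. - min \<delta>0 \<eta> < Im \<omega> \<and> Im \<omega> < y1 + 1}"
        by (intro holomorphic_intros hol\<Psi>)
      fix y assume y: "- \<delta> \<le> y" "y \<le> y1"
      have "(\<integral>\<^sup>+x. ennreal (norm (?\<phi> (Complex x y))) \<partial>lborel) \<le> (\<integral>\<^sup>+x. ennreal (exp (y1 * t)) * ennreal (norm (\<Psi> (Complex x y))) \<partial>lborel)"
        unfolding nphi using y t by (intro nn_integral_mono) (auto simp flip: ennreal_mult intro!: ennreal_leI mult_right_mono)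
      also have "\<dots> = ennreal (exp (y1 * t)) * (\<integral>\<^sup>+x. ennreal (norm (\<Psi> (Complex x y))) \<partial>lborel)"
        using borel_measurable_continuous_onI[OF cont\<Psi>[OF y]] by (intro nn_integral_cmult) auto
      also have "\<dots> \<le> ennreal (exp (y1 * t)) * ennreal L" by (intro mult_left_mono L1 y) auto
      also have "\<dots> = ennreal (exp (y1 * t) * L)" using L by (simp add: ennreal_mult)
      finally show "(\<integral>\<^sup>+x. ennreal (norm (?\<phi> (Complex x y))) \<partial>lborel) \<le> ennreal (exp (y1 * t) * L)" .
    qed (use d y1 in auto)
    have "norm (LINT x|lborel. ?\<phi> (Complex x (- \<delta>))) \<le> exp (- (\<delta> * t)) * L"
    proof -
      have "ennreal (norm (LINT x|lborel. ?\<phi> (Complex x (- \<delta>)))) \<le> (\<integral>\<^sup>+x. ennreal (norm (?\<phi> (Complex x (- \<delta>)))) \<partial>lborel)"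
        by (rule norm_integral_le_nn_integral)
      also have "\<dots> = (\<integral>\<^sup>+x. ennreal (exp (- (\<delta> * t))) * ennreal (norm (\<Psi> (Complex x (- \<delta>)))) \<partial>lborel)"
        unfolding nphi by (simp add: ennreal_mult)
      also have "\<dots> = ennreal (exp (- (\<delta> * t))) * (\<integral>\<^sup>+x. ennreal (norm (\<Psi> (Complex x (- \<delta>)))) \<partial>lborel)"
        using borel_measurable_continuous_onI[OF cont\<Psi>[of "- \<delta>"]] d y1 by (intro nn_integral_cmult) auto
      also have "\<dots> \<le> ennreal (exp (- (\<delta> * t))) * ennreal L" using d y1 by (intro mult_left_mono L1) auto
      also have "\<dots> = ennreal (exp (- (\<delta> * t)) * L)" using L by (simp add: ennreal_mult)
      finally show ?thesis using L by (subst (asm) ennreal_le_iff) auto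
    qed
    moreover have "(LINT x|lborel. ?\<phi> (Complex x y1)) = (2 * pi) *\<^sub>R p t"
    proof -
      have "(LINT x|lborel. ?\<phi> (Complex x y1)) = (LINT x|lborel. of_real (exp (y1 * t)) * (cis (- x * t) * fourier (damped p y1) x))"
        by (intro Bochner_Integration.integral_cong refl) (simp add: lap exp_eq_polar mult.assoc)
      also have "\<dots> = of_real (exp (y1 * t)) * ((2 * pi) *\<^sub>R damped p y1 t)"
        by (simp only: integral_mult_right_zero inv)
      also have "\<dots> = (2 * pi) *\<^sub>R ((exp (y1 * t) * exp (- (y1 * t))) *\<^sub>R p t)"
        using t by (simp add: damped_def scaleR_conv_of_real mult_ac)
      also have "exp (y1 * t) * exp (- (y1 * t)) = 1" by (simp flip: exp_add)
      finally show ?thesis by simp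
    qed
    ultimately have "2 * pi * norm (p t) \<le> exp (- (\<delta> * t)) * L" using shift by simp
    moreover have "1 * norm (p t) \<le> 2 * pi * norm (p t)" using pi_gt3 by (intro mult_right_mono) auto
    ultimately have pt: "norm (p t) \<le> exp (- (\<delta> * t)) * L" by simp
    have "norm (q t) \<le> norm (n t) + norm (p t)"
      using norm_triangle_ineq4[of "n t" "p t"] by (simp add: p_def)
    also have "norm (n t) \<le> M * exp (- (\<delta> * t))"
    proof -
      have "norm (n t) \<le> M * exp (- (\<eta> * t))" using n t by simp
      also have "\<dots> \<le> M * exp (- (\<delta> * t))" using M d t by (intro mult_left_mono) auto
      finally show ?thesis .
    qed
    finally show "norm (q t) \<le> (M + L) * exp (- (\<delta> * t))" using pt by (simp add: algebra_simps)
  qed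
qed

end

section \<open>Fourier coefficients of periodic functions\<close>

definition circ :: "(real \<Rightarrow> 'a::{banach, second_countable_topology}) \<Rightarrow> 'a" where
  "circ f = (LINT x:{0..2*pi}|lborel. f x)"

text \<open>Without the factor \<open>1 / (2 * pi)\<close>, so that convolution over a period turns
  into a plain product of coefficients.\<close>

definition fcoeff :: "(real \<Rightarrow> complex) \<Rightarrow> int \<Rightarrow> complex" where
  "fcoeff u k = circ (\<lambda>x. cis (- (of_int k * x)) * u x)"

section \<open>Integrals over a period\<close>

lemma periodic_of_int:
  fixes f :: "real \<Rightarrow> 'a"
  assumes per: "\<And>x. f (x + 2*pi) = f x"
  shows "f (x + 2*pi * of_int n) = f x"
proof -
  have nat: "f (x + 2*pi * of_nat m) = f x" for m x
  proof (induction m)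
    case (Suc m)
    have "x + 2*pi * of_nat (Suc m) = (x + 2*pi * of_nat m) + 2*pi" by (simp add: algebra_simps)
    then show ?case using Suc by (simp only: per)
  qed simp
  show ?thesis
  proof (cases "n \<ge> 0")
    case True
    then show ?thesis using nat[of x "nat n"] by simp
  next
    case False
    then show ?thesis using nat[of "x + 2*pi * of_int n" "nat (- n)"] by (simp add: algebra_simps)
  qed
qed

lemma shift_into_period:
  fixes x :: real
  obtains n :: int where "x - 2*pi * of_int n \<in> {0..2*pi}"
proof -
  define n where "n = \<lfloor>x / (2*pi)\<rfloor>"
  have "of_int n \<le> x / (2*pi)" "x / (2*pi) < of_int n + 1" unfolding n_def by linarith+
  then have "2*pi * of_int n \<le> x" "x < 2*pi * of_int n + 2*pi"
    by (simp_all add: pos_le_divide_eq pos_divide_less_eq algebra_simps)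
  then show ?thesis by (intro that[of n]) auto
qed

text \<open>Whole periods are removed until the left end \<open>a\<close> of the window lies in
  \<open>{0..2*pi}\<close>. The piece \<open>{0..a}\<close> is then cut off and reattached at the
  right end; the overlaps are single points.\<close>

lemma has_bochner_integral_period:
  fixes f :: "real \<Rightarrow> 'a::{banach, second_countable_topology}"
  assumes per: "\<And>x. f (x + 2*pi) = f x" and f: "set_integrable lborel {0..2*pi} f"
  shows "has_bochner_integral lborel (\<lambda>x. indicator {c..c+2*pi} x *\<^sub>R f x) (circ f)"
proof -
  obtain n :: int where n: "c - 2*pi * of_int n \<in> {0..2*pi}" by (rule shift_into_period)
  define a where "a = c - 2*pi * of_int n"
  have a: "0 \<le> a" "a \<le> 2*pi" using n by (auto simp: a_def)
  have i1: "set_integrable lborel {a..2*pi} f" and i2: "set_integrable lborel {0..a} f"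
    using a by (auto intro!: set_integrable_subset[OF f])
  have h0: "has_bochner_integral lborel (\<lambda>x. indicator {0..2*pi} x *\<^sub>R f x) (circ f)"
    using f by (simp add: has_bochner_integral_iff set_integrable_def circ_def set_lebesgue_integral_def)
  have h1: "has_bochner_integral lborel (\<lambda>x. indicator {a..2*pi} x *\<^sub>R f x) (LINT x:{a..2*pi}|lborel. f x)"
    using i1 by (simp add: has_bochner_integral_iff set_integrable_def set_lebesgue_integral_def)
  have h2: "has_bochner_integral lborel (\<lambda>x. indicator {0..a} x *\<^sub>R f x) (LINT x:{0..a}|lborel. f x)"
    using i2 by (simp add: has_bochner_integral_iff set_integrable_def set_lebesgue_integral_def)
  have h2': "has_bochner_integral lborel (\<lambda>x. indicator {2*pi..a + 2*pi} x *\<^sub>R f x) (LINT x:{0..a}|lborel. f x)"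
  proof (subst lborel_has_bochner_integral_real_affine_iff[of 1 _ _ "2*pi"])
    have "(\<lambda>x. indicator {2*pi..a + 2*pi} (2*pi + 1 * x) *\<^sub>R f (2*pi + 1 * x)) = (\<lambda>x. indicator {0..a} x *\<^sub>R f x)"
      using per by (auto simp: fun_eq_iff indicator_def add.commute)
    then show "has_bochner_integral lborel (\<lambda>x. indicator {2*pi..a + 2*pi} (2*pi + 1 * x) *\<^sub>R f (2*pi + 1 * x)) ((LINT x:{0..a}|lborel. f x) /\<^sub>R \<bar>1\<bar>)"
      using h2 by simp
  qed simp
  have s1: "has_bochner_integral lborel (\<lambda>x. indicator {a..2*pi} x *\<^sub>R f x + indicator {0..a} x *\<^sub>R f x) ((LINT x:{a..2*pi}|lborel. f x) + (LINT x:{0..a}|lborel. f x))"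
    by (rule has_bochner_integral_add[OF h1 h2])
  have s2: "has_bochner_integral lborel (\<lambda>x. indicator {a..2*pi} x *\<^sub>R f x + indicator {2*pi..a + 2*pi} x *\<^sub>R f x) ((LINT x:{a..2*pi}|lborel. f x) + (LINT x:{0..a}|lborel. f x))"
    by (rule has_bochner_integral_add[OF h1 h2'])
  have "has_bochner_integral lborel (\<lambda>x. indicator {0..2*pi} x *\<^sub>R f x) ((LINT x:{a..2*pi}|lborel. f x) + (LINT x:{0..a}|lborel. f x))"
  proof (rule has_bochner_integralI_AE[OF s1])
    show "(\<lambda>x. indicator {0..2*pi} x *\<^sub>R f x) \<in> borel_measurable lborel" using h0 by (rule borel_measurable_has_bochner_integral)
    show "AE x in lborel. indicator {a..2*pi} x *\<^sub>R f x + indicator {0..a} x *\<^sub>R f x = indicator {0..2*pi} x *\<^sub>R f x"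
      using AE_lborel_singleton[of a] by eventually_elim (use a in \<open>auto simp: indicator_def\<close>)
  qed
  then have eq: "circ f = (LINT x:{a..2*pi}|lborel. f x) + (LINT x:{0..a}|lborel. f x)"
    using h0 has_bochner_integral_eq by blast
  have m: "(\<lambda>x. indicator {a..a + 2*pi} x *\<^sub>R f x) \<in> borel_measurable lborel"
  proof -
    have [measurable]: "(\<lambda>x. indicator {a..2*pi} x *\<^sub>R f x) \<in> borel_measurable lborel" "(\<lambda>x. indicator {2*pi..a + 2*pi} x *\<^sub>R f x) \<in> borel_measurable lborel"
      using h1 h2' by (auto dest: borel_measurable_has_bochner_integral)
    \<comment> \<open>The overlap at \<open>2*pi\<close> is removed exactly: Borel measurability
      does not pass to functions that are equal only almost everywhere.\<close>
    have "(\<lambda>x. indicator {a..2*pi} x *\<^sub>R f x + (if x = 2*pi then 0 else indicator {2*pi..a + 2*pi} x *\<^sub>R f x)) \<in> borel_measurable lborel"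
      by measurable
    also have "(\<lambda>x. indicator {a..2*pi} x *\<^sub>R f x + (if x = 2*pi then 0 else indicator {2*pi..a + 2*pi} x *\<^sub>R f x)) = (\<lambda>x. indicator {a..a + 2*pi} x *\<^sub>R f x)"
      using a by (auto simp: fun_eq_iff indicator_def)
    finally show ?thesis .
  qed
  have ha: "has_bochner_integral lborel (\<lambda>x. indicator {a..a + 2*pi} x *\<^sub>R f x) (circ f)"
    unfolding eq
  proof (rule has_bochner_integralI_AE[OF s2 m])
    show "AE x in lborel. indicator {a..2*pi} x *\<^sub>R f x + indicator {2*pi..a + 2*pi} x *\<^sub>R f x = indicator {a..a + 2*pi} x *\<^sub>R f x"
      using AE_lborel_singleton[of "2*pi"] by eventually_elim (use a in \<open>auto simp: indicator_def\<close>)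
  qed
  show ?thesis
  proof (subst lborel_has_bochner_integral_real_affine_iff[of 1 _ _ "2*pi * of_int n"])
    have "(\<lambda>x. indicator {c..c + 2*pi} (2*pi * of_int n + 1 * x) *\<^sub>R f (2*pi * of_int n + 1 * x)) = (\<lambda>x. indicator {a..a + 2*pi} x *\<^sub>R f x)"
    proof
      fix x
      have "f (2*pi * of_int n + 1 * x) = f x" using periodic_of_int[of f x n, OF per] by (simp add: add.commute)
      then show "indicator {c..c + 2*pi} (2*pi * of_int n + 1 * x) *\<^sub>R f (2*pi * of_int n + 1 * x) = indicator {a..a + 2*pi} x *\<^sub>R f x"
        by (auto simp: a_def indicator_def)
    qed
    then show "has_bochner_integral lborel (\<lambda>x. indicator {c..c + 2*pi} (2*pi * of_int n + 1 * x) *\<^sub>R f (2*pi * of_int n + 1 * x)) (circ f /\<^sub>R \<bar>1\<bar>)"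
      using ha by simp
  qed simp
qed

lemma circ_shift:
  fixes f :: "real \<Rightarrow> 'a::{banach, second_countable_topology}"
  assumes per: "\<And>x. f (x + 2*pi) = f x" and f: "set_integrable lborel {0..2*pi} f"
  shows "set_integrable lborel {0..2*pi} (\<lambda>x. f (x + c))" "circ (\<lambda>x. f (x + c)) = circ f"
proof -
  have "has_bochner_integral lborel (\<lambda>x. indicator {c..c+2*pi} (c + 1 * x) *\<^sub>R f (c + 1 * x)) (circ f /\<^sub>R \<bar>1\<bar>)"
    using has_bochner_integral_period[OF assms, of c] by (subst (asm) lborel_has_bochner_integral_real_affine_iff[of 1 _ _ c]) auto
  also have "(\<lambda>x. indicator {c..c+2*pi} (c + 1 * x) *\<^sub>R f (c + 1 * x)) = (\<lambda>x. indicator {0..2*pi} x *\<^sub>R f (x + c))"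
    by (auto simp: indicator_def add.commute)
  finally show "set_integrable lborel {0..2*pi} (\<lambda>x. f (x + c))" "circ (\<lambda>x. f (x + c)) = circ f"
    by (auto simp: set_integrable_def circ_def set_lebesgue_integral_def has_bochner_integral_iff)
qed

lemma circ_reflect:
  fixes f :: "real \<Rightarrow> 'a::{banach, second_countable_topology}"
  assumes per: "\<And>x. f (x + 2*pi) = f x" and f: "set_integrable lborel {0..2*pi} f"
  shows "set_integrable lborel {0..2*pi} (\<lambda>x. f (c - x))" "circ (\<lambda>x. f (c - x)) = circ f"
proof -
  have "has_bochner_integral lborel (\<lambda>x. indicator {c - 2*pi..c - 2*pi + 2*pi} (c + (-1) * x) *\<^sub>R f (c + (-1) * x)) (circ f /\<^sub>R \<bar>-1\<bar>)"
    using has_bochner_integral_period[OF assms, of "c - 2*pi"] by (subst (asm) lborel_has_bochner_integral_real_affine_iff[of "-1" _ _ c]) auto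
  also have "(\<lambda>x. indicator {c - 2*pi..c - 2*pi + 2*pi} (c + (-1) * x) *\<^sub>R f (c + (-1) * x)) = (\<lambda>x. indicator {0..2*pi} x *\<^sub>R f (c - x))"
    by (auto simp: indicator_def)
  finally show "set_integrable lborel {0..2*pi} (\<lambda>x. f (c - x))" "circ (\<lambda>x. f (c - x)) = circ f"
    by (auto simp: set_integrable_def circ_def set_lebesgue_integral_def has_bochner_integral_iff)
qed

lemma set_integrable_circ:
  fixes f :: "real \<Rightarrow> 'a::{banach, second_countable_topology}"
  shows "continuous_on {0..2*pi} f \<Longrightarrow> set_integrable lborel {0..2*pi} f"
  by (rule borel_integrable_atLeastAtMost')

lemma circ_add:
  fixes f g :: "real \<Rightarrow> 'a::{banach, second_countable_topology}"
  shows "continuous_on {0..2*pi} f \<Longrightarrow> continuous_on {0..2*pi} g \<Longrightarrow> circ (\<lambda>x. f x + g x) = circ f + circ g"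
  unfolding circ_def by (intro set_integral_add set_integrable_circ)

lemma circ_diff:
  fixes f g :: "real \<Rightarrow> 'a::{banach, second_countable_topology}"
  shows "continuous_on {0..2*pi} f \<Longrightarrow> continuous_on {0..2*pi} g \<Longrightarrow> circ (\<lambda>x. f x - g x) = circ f - circ g"
  unfolding circ_def by (intro set_integral_diff set_integrable_circ)

lemma circ_mult_right:
  fixes a :: "'a::{real_normed_field, banach, second_countable_topology}"
  shows "circ (\<lambda>x. a * f x) = a * circ f"
  unfolding circ_def by (rule set_integral_mult_right)

lemma circ_cnj: "circ (\<lambda>x. cnj (f x)) = cnj (circ f)"
proof -
  have "circ (\<lambda>x. cnj (f x)) = (LINT x|lborel. cnj (indicator {0..2*pi} x *\<^sub>R f x))"
    unfolding circ_def set_lebesgue_integral_def by (intro Bochner_Integration.integral_cong refl) simp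
  then show ?thesis
    unfolding circ_def set_lebesgue_integral_def by (simp only: Bochner_Integration.integral_cnj)
qed

lemma fcoeff_cnj: "fcoeff (\<lambda>x. cnj (u x)) k = cnj (fcoeff u (- k))"
  unfolding fcoeff_def by (subst circ_cnj[symmetric]) (simp add: cis_cnj)

lemma fcoeff_of_real_minus: "fcoeff (\<lambda>x. of_real (u x)) (- k) = cnj (fcoeff (\<lambda>x. of_real (u x)) k)"
  using fcoeff_cnj[of "\<lambda>x. of_real (u x)" "- k"] by simp

lemma circ_cis: "circ (\<lambda>x. cis (of_int m * x)) = (if m = 0 then 2 * of_real pi else 0)"
proof (cases "m = 0")
  case True
  have "circ (\<lambda>x. 1 :: complex) = of_real (2*pi)"
    unfolding circ_def set_lebesgue_integral_def by (simp add: scaleR_conv_of_real)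
  then show ?thesis using True by simp
next
  case False
  have "(LINT x|lborel. indicator {0..2*pi} x *\<^sub>R cis (of_int m * x)) = cis (of_int m * (2*pi)) / (\<i> * of_int m) - cis (of_int m * 0) / (\<i> * of_int m)"
  proof (rule integral_FTC_Icc)
    show "((\<lambda>x. cis (of_int m * x) / (\<i> * of_int m)) has_vector_derivative cis (of_int m * x)) (at x within {0..2*pi})" for x
    proof -
      have "((\<lambda>z. exp (\<i> * of_int m * z) / (\<i> * of_int m)) has_field_derivative exp (\<i> * of_int m * of_real x)) (at (of_real x))"
        using False by (auto intro!: derivative_eq_intros)
      from has_vector_derivative_real_field[OF this]
      show ?thesis by (simp add: cis_conv_exp mult_ac)
    qed
  qed (auto intro!: continuous_intros)
  also have "cis (of_int m * (2*pi)) = 1"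
    using cis_multiple_2pi[of "of_int m"] by (simp add: mult_ac)
  finally show ?thesis using False by (simp add: circ_def set_lebesgue_integral_def)
qed

section \<open>Uniqueness of Fourier coefficients\<close>

lemma continuous_on_real_polynomial:
  fixes p :: "complex \<Rightarrow> real"
  shows "real_polynomial_function p \<Longrightarrow> continuous_on UNIV p"
  by (simp add: continuous_on_eq_continuous_at continuous_real_polymonial_function)

text \<open>Multiplication by a linear function of \<open>cis x\<close> only shifts the index by one
  in both directions, so vanishing of all coefficients is preserved by polynomial factors.
  \<open>w\<close> varies in the induction because a product of polynomials is absorbed factor by
  factor.\<close>

lemma fcoeff_trig_polynomial:
  fixes p :: "complex \<Rightarrow> real"
  assumes "real_polynomial_function p" "continuous_on UNIV w" "\<And>k. fcoeff w k = 0"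
  shows "fcoeff (\<lambda>x. w x * of_real (p (cis x))) k = 0"
  using assms
proof (induction arbitrary: w k rule: real_polynomial_function.induct)
  case (linear f)
  interpret f: bounded_linear f by fact
  \<comment> \<open>The coefficients of a real linear form on the circle, written in terms of
    \<open>cis x\<close> and \<open>cis (- x)\<close>.\<close>
  define \<alpha> \<beta> where "\<alpha> = (of_real (f 1) - \<i> * of_real (f \<i>)) / 2" and "\<beta> = (of_real (f 1) + \<i> * of_real (f \<i>)) / 2"
  have f: "of_real (f (cis x)) = \<alpha> * cis x + \<beta> * cis (- x)" for x
  proof -
    have "cis x = cos x *\<^sub>R 1 + sin x *\<^sub>R \<i>" by (simp add: complex_eq_iff)
    then have "f (cis x) = cos x * f 1 + sin x * f \<i>" by (simp only: f.add f.scaleR real_scaleR_def)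
    then show ?thesis by (simp add: \<alpha>_def \<beta>_def complex_eq_iff field_simps)
  qed
  have "fcoeff (\<lambda>x. w x * of_real (f (cis x))) k = circ (\<lambda>x. \<alpha> * (cis (- (of_int (k - 1) * x)) * w x) + \<beta> * (cis (- (of_int (k + 1) * x)) * w x))"
    unfolding fcoeff_def
  proof (intro arg_cong[where f = circ] ext)
    fix x
    have 1: "cis (- (of_int k * x)) * cis x = cis (- (of_int (k - 1) * x))"
      and 2: "cis (- (of_int k * x)) * cis (- x) = cis (- (of_int (k + 1) * x))"
      by (simp_all add: cis_mult algebra_simps)
    have "cis (- (of_int k * x)) * (w x * of_real (f (cis x))) = \<alpha> * ((cis (- (of_int k * x)) * cis x) * w x) + \<beta> * ((cis (- (of_int k * x)) * cis (- x)) * w x)"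
      unfolding f by (simp add: algebra_simps)
    then show "cis (- (of_int k * x)) * (w x * of_real (f (cis x))) = \<alpha> * (cis (- (of_int (k - 1) * x)) * w x) + \<beta> * (cis (- (of_int (k + 1) * x)) * w x)"
      unfolding 1 2 .
  qed
  also have "\<dots> = \<alpha> * fcoeff w (k - 1) + \<beta> * fcoeff w (k + 1)"
    unfolding fcoeff_def
    by (subst circ_add) (simp_all add: circ_mult_right, (intro continuous_intros continuous_on_subset[OF linear(2)] subset_UNIV)+)
  finally show ?case using linear by simp
next
  case (const c)
  have "fcoeff (\<lambda>x. w x * of_real c) k = of_real c * fcoeff w k"
    unfolding fcoeff_def circ_mult_right[symmetric] by (simp add: mult_ac)
  then show ?case using const by simp
next
  case (add p q)
  have cont: "continuous_on UNIV (\<lambda>x. w x * of_real (f (cis x)))" if "real_polynomial_function f" for f :: "complex \<Rightarrow> real"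
    using add.prems that by (intro continuous_intros continuous_on_compose2[OF continuous_on_real_polynomial]) auto
  have "fcoeff (\<lambda>x. w x * of_real (p (cis x) + q (cis x))) k = fcoeff (\<lambda>x. w x * of_real (p (cis x))) k + fcoeff (\<lambda>x. w x * of_real (q (cis x))) k"
    unfolding fcoeff_def
    by (subst circ_add[symmetric], (intro continuous_intros continuous_on_subset[OF cont] add.hyps subset_UNIV)+)
       (simp add: algebra_simps)
  then show ?case using add.IH add.prems by simp
next
  case (mult p q)
  have cont: "continuous_on UNIV (\<lambda>x. w x * of_real (p (cis x)))"
    using mult by (intro continuous_intros continuous_on_compose2[OF continuous_on_real_polynomial]) auto
  have "fcoeff (\<lambda>x. (w x * of_real (p (cis x))) * of_real (q (cis x))) k = 0"
    by (rule mult.IH(2)[OF cont]) (rule mult.IH(1)[OF mult.prems])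
  then show ?case by (simp add: mult.assoc)
qed

text \<open>Transports a periodic function to the compact circle for Stone-Weierstrass.
  \<open>Arg\<close> is discontinuous on the negative real axis and \<open>Arg2pi\<close> on the
  positive one; between them they cover the circle, and periodicity makes \<open>u\<close> blind to
  the choice.\<close>

lemma continuous_on_circle_lift:
  fixes u :: "real \<Rightarrow> real"
  assumes cont: "continuous_on UNIV u" and per: "\<And>x. u (x + 2*pi) = u x"
  shows "continuous_on (sphere 0 1) (\<lambda>z. u (Arg z))" "u (Arg (cis x)) = u x"
proof -
  have uc: "isCont u x" for x using cont by (simp add: continuous_on_eq_continuous_at)
  have arg: "u (Arg z) = u x" if "z = cis x" for z x
  proof -
    have "cis (Arg z) = cis x" using that cis_Arg[of z] by (simp add: sgn_div_norm)
    then have "cis (Arg z - x) = 1" by (simp add: cis_divide[symmetric])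
    then obtain n :: int where "Arg z - x = 2*pi * of_int n"
      by (auto simp: cis_conv_exp exp_eq_1 mult_ac)
    then have "Arg z = x + 2*pi * of_int n" by simp
    then show ?thesis using periodic_of_int[of u x n, OF per] by simp
  qed
  show "u (Arg (cis x)) = u x" by (rule arg) simp
  show "continuous_on (sphere 0 1) (\<lambda>z. u (Arg z))"
    unfolding continuous_on_eq_continuous_within
  proof
    fix z :: complex assume z: "z \<in> sphere 0 1"
    show "continuous (at z within sphere 0 1) (\<lambda>z. u (Arg z))"
    proof (cases "z \<in> \<real>\<^sub>\<le>\<^sub>0")
      case False
      have "isCont (\<lambda>z. u (Arg z)) z"
        by (rule isCont_o2[OF continuous_at_Arg[OF False] uc])
      then show ?thesis by (rule continuous_at_imp_continuous_at_within)
    next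
      case True
      then have "z \<notin> \<real>\<^sub>\<ge>\<^sub>0" using z by (auto simp: complex_nonneg_Reals_iff complex_nonpos_Reals_iff cmod_def)
      then have "isCont (\<lambda>z. u (Arg2pi z)) z"
        by (intro isCont_o2[OF continuous_at_Arg2pi uc])
      then have "continuous (at z within sphere 0 1) (\<lambda>z. u (Arg2pi z))" by (rule continuous_at_imp_continuous_at_within)
      moreover have "u (Arg2pi w) = u (Arg w)" if "w \<in> sphere 0 1" for w
        using that Arg2pi_eq[of w] by (intro arg[symmetric]) (simp add: cis_conv_exp)
      ultimately show ?thesis
        using z by (auto simp: continuous_within intro: Lim_transform_within_set_eq[THEN iffD1] tendsto_cong[THEN iffD1, rotated]
            simp: eventually_at_filter)
    qed
  qed
qed

text \<open>\<open>u\<close> is orthogonal to every polynomial in \<open>cis x\<close> and uniformly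
  close to one of them, so the integral of its square is at most \<open>e\<close> times the integral
  of its modulus, for every \<open>e\<close>. This uniqueness later identifies \<open>u\<close> with
  the sum of its Fourier series.\<close>

theorem fcoeff_zero_imp_zero:
  fixes u :: "real \<Rightarrow> real"
  assumes cont: "continuous_on UNIV u" and per: "\<And>x. u (x + 2*pi) = u x"
    and zero: "\<And>k. fcoeff (\<lambda>x. of_real (u x)) k = 0"
  shows "u x = 0"
proof -
  have cont': "continuous_on {0..2*pi} u" using cont by (rule continuous_on_subset) auto
  have small: "circ (\<lambda>x. (u x)\<^sup>2) \<le> e * circ (\<lambda>x. \<bar>u x\<bar>)" if e: "e > 0" for e
  proof -
    obtain p where p: "real_polynomial_function p" "\<And>z. z \<in> sphere 0 1 \<Longrightarrow> \<bar>u (Arg z) - p z\<bar> < e"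
      using Stone_Weierstrass_real_polynomial_function[OF compact_sphere continuous_on_circle_lift(1)[OF cont per] e] by blast
    have contp: "continuous_on {0..2*pi} (\<lambda>x. p (cis x))"
      by (intro continuous_on_compose2[OF continuous_on_real_polynomial[OF p(1)]] continuous_intros) auto
    have "fcoeff (\<lambda>x. of_real (u x) * of_real (p (cis x))) 0 = 0"
      by (rule fcoeff_trig_polynomial[OF p(1)]) (auto intro!: continuous_intros cont zero)
    moreover have "fcoeff (\<lambda>x. of_real (u x) * of_real (p (cis x))) 0 = of_real (circ (\<lambda>x. u x * p (cis x)))"
      unfolding fcoeff_def circ_def set_lebesgue_integral_def
      by (subst integral_complex_of_real[symmetric]) (simp add: scaleR_conv_of_real)
    ultimately have z: "circ (\<lambda>x. u x * p (cis x)) = 0" by simp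
    have "circ (\<lambda>x. (u x)\<^sup>2) = circ (\<lambda>x. u x * (u x - p (cis x)) + u x * p (cis x))"
      by (simp add: algebra_simps power2_eq_square)
    also have "\<dots> = circ (\<lambda>x. u x * (u x - p (cis x)))"
      using z cont' contp by (subst circ_add) (auto intro!: continuous_intros)
    also have "\<dots> \<le> circ (\<lambda>x. e * \<bar>u x\<bar>)"
      unfolding circ_def
    proof (rule set_integral_mono)
      show "u x * (u x - p (cis x)) \<le> e * \<bar>u x\<bar>" for x
      proof -
        have "u x * (u x - p (cis x)) \<le> \<bar>u x\<bar> * \<bar>u x - p (cis x)\<bar>" by (metis abs_ge_self abs_mult)
        also have "\<dots> \<le> \<bar>u x\<bar> * e"
          using p(2)[of "cis x"] by (intro mult_left_mono) (auto simp: continuous_on_circle_lift(2)[OF cont per])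
        finally show ?thesis by (simp add: mult.commute)
      qed
    qed (use cont' contp in \<open>auto intro!: set_integrable_circ continuous_intros\<close>)
    also have "\<dots> = e * circ (\<lambda>x. \<bar>u x\<bar>)" by (rule circ_mult_right)
    finally show ?thesis .
  qed
  have "circ (\<lambda>x. (u x)\<^sup>2) \<le> 0"
  proof (rule field_le_epsilon)
    fix e :: real assume "e > 0"
    define A where "A = circ (\<lambda>x. \<bar>u x\<bar>)"
    have A: "A \<ge> 0" unfolding A_def circ_def set_lebesgue_integral_def by (intro Bochner_Integration.integral_nonneg) auto
    \<comment> \<open>\<open>A + 1\<close> instead of \<open>A\<close> keeps the denominator
      positive.\<close>
    have "circ (\<lambda>x. (u x)\<^sup>2) \<le> e / (A + 1) * A" unfolding A_def
      by (rule small) (use \<open>e > 0\<close> A in \<open>auto simp: A_def[symmetric]\<close>)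
    also have "\<dots> \<le> e" using A \<open>e > 0\<close> by (simp add: field_simps)
    finally show "circ (\<lambda>x. (u x)\<^sup>2) \<le> 0 + e" by simp
  qed
  moreover have "circ (\<lambda>x. (u x)\<^sup>2) = integral {0..2*pi} (\<lambda>x. (u x)\<^sup>2)"
    unfolding circ_def using cont' by (intro set_borel_integral_eq_integral set_integrable_circ continuous_intros)
  ultimately have "integral {0..2*pi} (\<lambda>x. (u x)\<^sup>2) \<le> 0" by simp
  moreover have "integral {0..2*pi} (\<lambda>x. (u x)\<^sup>2) \<ge> 0" by (rule integral_nonneg) (use cont' in \<open>auto intro!: integrable_continuous_interval continuous_intros\<close>)
  ultimately have *: "((\<lambda>x. (u x)\<^sup>2) has_integral 0) {0..2*pi}"
  proof -
    assume *: "integral {0..2*pi} (\<lambda>x. (u x)\<^sup>2) \<le> 0" "integral {0..2*pi} (\<lambda>x. (u x)\<^sup>2) \<ge> 0"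
    have "(\<lambda>x. (u x)\<^sup>2) integrable_on {0..2*pi}"
      using cont' by (intro integrable_continuous_interval continuous_intros)
    from integrable_integral[OF this] show ?thesis using * by simp
  qed
  have on: "(u y)\<^sup>2 = 0" if "y \<in> {0..2*pi}" for y
  proof (rule has_integral_0_cbox_imp_0[of 0 "2*pi" "\<lambda>x. (u x)\<^sup>2" y])
    show "continuous_on (cbox 0 (2*pi)) (\<lambda>x. (u x)\<^sup>2)" unfolding cbox_interval by (intro continuous_intros cont')
  qed (use that pi_gt_zero in \<open>simp_all add: * box_ne_empty not_le del: pi_gt_zero\<close>)
  obtain n :: int where "x - 2*pi * of_int n \<in> {0..2*pi}" by (rule shift_into_period)
  then have "(u (x - 2*pi * of_int n))\<^sup>2 = 0" by (rule on)
  then show ?thesis using periodic_of_int[of u "x - 2*pi * of_int n" n, OF per] by simp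
qed

section \<open>The interaction potential\<close>

lemma W_measurable [measurable]: "W \<in> borel_measurable borel"
proof -
  have [measurable]: "(\<lambda>x::real. cos x / sin x) \<in> borel_measurable borel"
    by measurable
  show ?thesis unfolding W_def[abs_def] cot_def by measurable
qed

text \<open>A shift by \<open>pi\<close> turns \<open>cot (x / 2)\<close> into
  \<open>- tan (x / 2)\<close>, its reciprocal up to sign. This antisymmetry is what makes the even
  Fourier coefficients vanish.\<close>

lemma W_half_period: "W (x + pi) = - W x"
proof -
  have e: "(x + pi) / 2 = x / 2 + pi / 2" by (simp add: field_simps)
  have "cot ((x + pi) / 2) = - tan (x / 2)"
    unfolding e by (simp add: cot_def tan_def sin_add cos_add)
  then have "\<bar>cot ((x + pi) / 2)\<bar> = inverse \<bar>cot (x / 2)\<bar>"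
    by (simp add: cot_def tan_def abs_divide)
  \<comment> \<open>Where \<open>cot\<close> is \<open>0\<close>, as a true zero or as the default
    value at a pole, both sides vanish by the convention \<open>ln 0 = 0\<close>.\<close>
  then show ?thesis by (cases "cot (x / 2) = 0") (simp_all add: W_def ln_inverse)
qed

lemma W_periodic: "W (x + 2*pi) = W x"
proof -
  have "W (x + 2*pi) = W ((x + pi) + pi)" by (simp add: add.assoc)
  then show ?thesis by (simp only: W_half_period minus_minus)
qed

lemma W_even: "W (- x) = W x"
  by (simp add: W_def)

text \<open>For \<open>y = \<bar>cot (x / 2)\<bar>\<close> the second factor is
  \<open>\<bar>sin x\<bar>\<close>, so this measures the logarithmic singularity against the zeros
  of the sine. The expression is invariant under \<open>y\<close> to \<open>1 / y\<close>, which
  reduces it to \<open>y \<ge> 1\<close>, where \<open>ln y \<le> 2 * sqrt y\<close>.\<close>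

lemma ln_square_le: "y > 0 \<Longrightarrow> (ln y)\<^sup>2 * (2 * y / (1 + y\<^sup>2)) \<le> (8::real)"
proof -
  have *: "(ln y)\<^sup>2 * (2 * y / (1 + y\<^sup>2)) \<le> (8::real)" if "y \<ge> 1" for y
  proof -
    have "ln y = 2 * ln (sqrt y)" using that by (simp add: ln_sqrt)
    also have "\<dots> \<le> 2 * sqrt y" using ln_le_minus_one[of "sqrt y"] that by simp
    finally have "(ln y)\<^sup>2 \<le> (2 * sqrt y)\<^sup>2" using that by (intro power_mono) auto
    then have "(ln y)\<^sup>2 * (2 * y / (1 + y\<^sup>2)) \<le> 4 * y * (2 * y / (1 + y\<^sup>2))"
      using that by (intro mult_right_mono) (auto simp: power_mult_distrib)
    also have "\<dots> = 8 * (y\<^sup>2 / (1 + y\<^sup>2))" by (simp add: power2_eq_square)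
    also have "\<dots> \<le> 8 * 1" by (intro mult_left_mono) (auto simp: divide_le_eq add_pos_nonneg)
    finally show ?thesis by simp
  qed
  assume y: "y > 0"
  show ?thesis
  proof (cases "y \<ge> 1")
    case False
    have "(ln (inverse y))\<^sup>2 * (2 * inverse y / (1 + (inverse y)\<^sup>2)) \<le> 8"
      using y False by (intro *) (simp add: one_le_inverse_iff)
    moreover have "2 * inverse y / (1 + (inverse y)\<^sup>2) = 2 * y / (1 + y\<^sup>2)"
    proof -
      have "1 + (inverse y)\<^sup>2 = (1 + y\<^sup>2) / y\<^sup>2" using y by (simp add: field_simps)
      then show ?thesis using y by (simp add: field_simps power2_eq_square)
    qed
    ultimately show ?thesis using y by (simp add: ln_inverse)
  qed (rule *)
qed

definition lncot :: "real \<Rightarrow> real" where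
  "lncot x = ln \<bar>cot (x / 2)\<bar>"

text \<open>The square root of \<open>ln_square_le\<close>, with \<open>8\<close> rounded up to
  \<open>9\<close>. The remaining power of the sine forces the product to vanish at the
  singularities.\<close>

lemma lncot_sin: "\<bar>lncot x * sin x\<bar> \<le> 3 * sqrt \<bar>sin x\<bar>"
proof (cases "sin x = 0")
  case False
  define y where "y = \<bar>cot (x / 2)\<bar>"
  have s: "sin x = 2 * sin (x / 2) * cos (x / 2)" using sin_double[of "x / 2"] by simp
  then have nz: "sin (x / 2) \<noteq> 0" "cos (x / 2) \<noteq> 0" using False by auto
  then have y: "y > 0" by (simp add: y_def cot_def)
  have "y\<^sup>2 = (cos (x / 2))\<^sup>2 / (sin (x / 2))\<^sup>2" by (simp add: y_def cot_def power_divide)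
  then have "1 + y\<^sup>2 = 1 / (sin (x / 2))\<^sup>2" using nz by (simp add: field_simps)
  then have "2 * y / (1 + y\<^sup>2) = 2 * y * (sin (x / 2))\<^sup>2" by simp
  also have "\<dots> = 2 * y * (\<bar>sin (x / 2)\<bar> * \<bar>sin (x / 2)\<bar>)" by (simp only: abs_mult_self_eq power2_eq_square)
  also have "\<dots> = \<bar>sin x\<bar>"
  proof -
    have "y * \<bar>sin (x / 2)\<bar> = \<bar>cos (x / 2)\<bar>" using nz by (simp add: y_def cot_def abs_divide)
    moreover have "2 * y * (\<bar>sin (x / 2)\<bar> * \<bar>sin (x / 2)\<bar>) = 2 * (y * \<bar>sin (x / 2)\<bar>) * \<bar>sin (x / 2)\<bar>" by simp
    ultimately have "2 * y * (\<bar>sin (x / 2)\<bar> * \<bar>sin (x / 2)\<bar>) = 2 * \<bar>cos (x / 2)\<bar> * \<bar>sin (x / 2)\<bar>" by (simp only:)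
    then show ?thesis unfolding s by (simp only: abs_mult abs_numeral mult_ac)
  qed
  finally have e: "2 * y / (1 + y\<^sup>2) = \<bar>sin x\<bar>" .
  have "\<bar>lncot x * sin x\<bar>\<^sup>2 = ((lncot x)\<^sup>2 * \<bar>sin x\<bar>) * \<bar>sin x\<bar>"
    by (simp add: power_mult_distrib power2_eq_square)
  also have "\<dots> \<le> 8 * \<bar>sin x\<bar>"
    using ln_square_le[OF y] unfolding e lncot_def y_def[symmetric] by (intro mult_right_mono) auto
  also have "\<dots> \<le> (3 * sqrt \<bar>sin x\<bar>)\<^sup>2" by (simp add: power_mult_distrib)
  finally have F: "\<bar>lncot x * sin x\<bar>\<^sup>2 \<le> (3 * sqrt \<bar>sin x\<bar>)\<^sup>2" .
  show ?thesis by (rule power2_le_imp_le[OF F]) simp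
qed simp

lemma abs_sin_of_nat_le: "\<bar>sin (real k * x)\<bar> \<le> real k * \<bar>sin x\<bar>"
proof (induction k)
  case (Suc k)
  have "sin (real (Suc k) * x) = sin (real k * x + x)" by (simp add: algebra_simps)
  also have "\<dots> = sin (real k * x) * cos x + cos (real k * x) * sin x" by (rule sin_add)
  finally have "\<bar>sin (real (Suc k) * x)\<bar> \<le> \<bar>sin (real k * x)\<bar> * \<bar>cos x\<bar> + \<bar>cos (real k * x)\<bar> * \<bar>sin x\<bar>"
    by (metis abs_mult abs_triangle_ineq)
  also have "\<dots> \<le> \<bar>sin (real k * x)\<bar> * 1 + 1 * \<bar>sin x\<bar>"
    by (intro add_mono mult_left_mono mult_right_mono) auto
  also have "\<dots> \<le> real (Suc k) * \<bar>sin x\<bar>" using Suc by (simp add: algebra_simps)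
  finally show ?case .
qed simp

lemma DERIV_lncot:
  assumes "sin x \<noteq> 0"
  shows "(lncot has_real_derivative - 1 / sin x) (at x)"
proof -
  have s: "sin x = 2 * sin (x / 2) * cos (x / 2)" using sin_double[of "x / 2"] by simp
  then have nz: "sin (x / 2) \<noteq> 0" "cos (x / 2) \<noteq> 0" using assms by auto
  then have c: "cot (x / 2) \<noteq> 0" by (simp add: cot_def)
  \<comment> \<open>Squaring replaces the absolute value by something differentiable.\<close>
  have eq: "lncot = (\<lambda>x. ln ((cot (x / 2))\<^sup>2) / 2)"
  proof
    fix x show "lncot x = ln ((cot (x / 2))\<^sup>2) / 2"
    proof (cases "cot (x / 2) = 0")
      case False
      have "ln ((cot (x / 2))\<^sup>2) = ln (\<bar>cot (x / 2)\<bar>\<^sup>2)" by simp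
      also have "\<dots> = 2 * ln \<bar>cot (x / 2)\<bar>" using False by (subst ln_realpow) auto
      finally show ?thesis by (simp add: lncot_def)
    qed (simp add: lncot_def)
  qed
  have "((\<lambda>x. ln ((cot (x / 2))\<^sup>2) / 2) has_real_derivative
     (inverse ((cot (x / 2))\<^sup>2) * (2 * cot (x / 2) * (- inverse ((sin (x / 2))\<^sup>2) * (1 / 2)))) / 2) (at x)"
  proof -
    have "((\<lambda>x. x / 2) has_real_derivative 1 / 2) (at x)" by (auto intro!: derivative_eq_intros)
    from DERIV_chain2[OF DERIV_cot this] nz
    have "((\<lambda>x. cot (x / 2)) has_real_derivative (- inverse ((sin (x / 2))\<^sup>2) * (1 / 2))) (at x)" by simp
    from DERIV_power[OF this, of 2]
    have "((\<lambda>x. (cot (x / 2))\<^sup>2) has_real_derivative (2 * cot (x / 2) * (- inverse ((sin (x / 2))\<^sup>2) * (1 / 2)))) (at x)"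
      by (simp add: mult_ac)
    from DERIV_cdivide[OF DERIV_chain2[OF DERIV_ln this]] c show ?thesis by simp
  qed
  also have "(inverse ((cot (x / 2))\<^sup>2) * (2 * cot (x / 2) * (- inverse ((sin (x / 2))\<^sup>2) * (1 / 2)))) / 2 = - 1 / sin x"
    unfolding s using nz by (simp add: cot_def field_simps power2_eq_square)
  finally show ?thesis unfolding eq .
qed

text \<open>At the zeros of the sine \<open>sin (k * x)\<close> is at most \<open>k\<close> times as
  large as \<open>sin x\<close> and thus beats the logarithm. This continuity carries the
  fundamental theorem of calculus across the singularities.\<close>

lemma continuous_lncot_sin: "continuous_on A (\<lambda>x. lncot x * sin (real k * x))"
proof -
  have "isCont (\<lambda>x. lncot x * sin (real k * x)) x" for x
  proof (cases "sin x = 0")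
    case False
    show ?thesis using DERIV_isCont[OF DERIV_lncot[OF False]] by (intro continuous_intros)
  next
    case True
    have b: "\<bar>lncot y * sin (real k * y)\<bar> \<le> real k * (3 * sqrt \<bar>sin y\<bar>)" for y
    proof -
      have "\<bar>lncot y * sin (real k * y)\<bar> \<le> \<bar>lncot y\<bar> * (real k * \<bar>sin y\<bar>)"
        unfolding abs_mult by (intro mult_left_mono abs_sin_of_nat_le) auto
      also have "\<dots> = real k * \<bar>lncot y * sin y\<bar>" by (simp add: abs_mult)
      also have "\<dots> \<le> real k * (3 * sqrt \<bar>sin y\<bar>)" by (intro mult_left_mono lncot_sin) auto
      finally show ?thesis .
    qed
    have "((\<lambda>y. real k * (3 * sqrt \<bar>sin y\<bar>)) \<longlongrightarrow> real k * (3 * sqrt \<bar>sin x\<bar>)) (at x)"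
      by (intro tendsto_intros)
    then have "((\<lambda>y. real k * (3 * sqrt \<bar>sin y\<bar>)) \<longlongrightarrow> 0) (at x)" using True by simp
    then have "((\<lambda>y. lncot y * sin (real k * y)) \<longlongrightarrow> 0) (at x)"
      by (rule Lim_null_comparison[rotated]) (use b in \<open>auto intro: always_eventually\<close>)
    moreover have "lncot x * sin (real k * x) = 0" using b[of x] True by simp
    ultimately show ?thesis by (simp only: isCont_def)
  qed
  then show ?thesis by (intro continuous_at_imp_continuous_on) auto
qed

text \<open>The Dirichlet kernel: for an odd index the quotient by \<open>sin x\<close> is a cosine
  polynomial with constant term \<open>1\<close>.\<close>

lemma sin_odd_sum:
  "sin (real (2 * m + 1) * x) = sin x * (1 + 2 * (\<Sum>j=1..m. cos (real (2 * j) * x)))"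
proof (induction m)
  case (Suc m)
  have "sin (real (2 * Suc m + 1) * x) - sin (real (2 * m + 1) * x) = 2 * sin x * cos (real (2 * Suc m) * x)"
    by (subst sin_diff_sin) (simp add: algebra_simps add_divide_distrib)
  then show ?case using Suc by (simp add: algebra_simps)
qed simp

lemma finite_sin_zeros: "finite {x \<in> {0..2*pi}. sin x = 0}"
proof (rule finite_subset)
  show "{x \<in> {0..2*pi}. sin x = 0} \<subseteq> (\<lambda>i::int. of_int i * pi) ` {0..2}"
  proof
    fix x assume x: "x \<in> {x \<in> {0..2*pi}. sin x = 0}"
    then obtain i :: int where i: "x = of_int i * pi" by (auto simp: sin_zero_iff_int2)
    with x have "0 \<le> of_int i * pi" "of_int i * pi \<le> 2 * pi" by auto
    then have "0 \<le> i" "i \<le> 2" using pi_gt_zero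
      by (simp_all add: zero_le_mult_iff)
    then show "x \<in> (\<lambda>i::int. of_int i * pi) ` {0..2}" using i by auto
  qed
qed simp

text \<open>Integration by parts with the primitive \<open>lncot x * sin (k * x) / k\<close>, which
  is continuous and vanishes at both ends. Since the derivative of \<open>lncot\<close> is
  \<open>- 1 / sin x\<close>, the other term is the Dirichlet kernel over \<open>k\<close>, with
  integral \<open>2 * pi / k\<close>.\<close>

lemma has_integral_lncot_cos:
  fixes m :: nat
  defines "k \<equiv> 2 * m + 1"
  shows "((\<lambda>x. lncot x * cos (real k * x)) has_integral (2 * pi / real k)) {0..2*pi}"
proof -
  define D where "D x = 1 + 2 * (\<Sum>j=1..m. cos (real (2 * j) * x))" for x
  have D: "(D has_integral 2*pi) {0..2*pi}"
  proof -
    have "((\<lambda>x. 1 + 2 * (\<Sum>j=1..m. cos (real (2 * j) * x))) has_integral (2*pi + 2 * (\<Sum>j=1..m. 0))) {0..2*pi}"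
    proof (intro has_integral_add has_integral_mult_right has_integral_sum)
      show "((\<lambda>x::real. 1::real) has_integral (2*pi)) {0..2*pi}" using has_integral_const_real[of "1::real" 0 "2*pi"] by simp
      fix j assume j: "j \<in> {1..m}"
      have "((\<lambda>x. cos (real (2 * j) * x)) has_integral (sin (real (2 * j) * (2*pi)) / real (2 * j) - sin (real (2 * j) * 0) / real (2 * j))) {0..2*pi}"
        using j by (intro fundamental_theorem_of_calculus)
          (auto intro!: derivative_eq_intros simp: has_real_derivative_iff_has_vector_derivative[symmetric])
      moreover have "sin (real (2 * j) * (2*pi)) = 0"
        using sin_npi[of "4 * j"] by (simp add: mult_ac)
      ultimately show "((\<lambda>x. cos (real (2 * j) * x)) has_integral 0) {0..2*pi}" by simp
    qed simp
    then show ?thesis by (simp add: D_def[abs_def])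
  qed
  have k: "real k > 0" by (simp add: k_def)
  have "((\<lambda>x. lncot x * cos (real k * x) - D x / real k) has_integral
     (lncot (2*pi) * sin (real k * (2*pi)) / real k - lncot 0 * sin (real k * 0) / real k)) {0..2*pi}"
  proof (rule fundamental_theorem_of_calculus_interior_strong[OF finite_sin_zeros])
    fix x assume "x \<in> {0<..<2*pi} - {x \<in> {0..2*pi}. sin x = 0}"
    then have nz: "sin x \<noteq> 0" by auto
    have "((\<lambda>x. lncot x * sin (real k * x) / real k) has_real_derivative
      (lncot x * (cos (real k * x) * real k) + (- 1 / sin x) * sin (real k * x)) / real k) (at x)"
    proof -
      have "((\<lambda>x. sin (real k * x)) has_real_derivative cos (real k * x) * real k) (at x)"
        by (auto intro!: derivative_eq_intros)
      from DERIV_cdivide[OF DERIV_mult[OF DERIV_lncot[OF nz] this], of "real k"]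
      show ?thesis by (simp add: add_ac mult_ac)
    qed
    moreover have "sin (real k * x) = sin x * D x" unfolding k_def D_def by (rule sin_odd_sum)
    ultimately show "((\<lambda>x. lncot x * sin (real k * x) / real k) has_vector_derivative lncot x * cos (real k * x) - D x / real k) (at x)"
      using nz k by (simp add: has_real_derivative_iff_has_vector_derivative[symmetric] add_divide_distrib diff_divide_distrib)
  qed (use k in \<open>auto intro!: continuous_intros continuous_lncot_sin\<close>)
  moreover have "sin (real k * (2*pi)) = 0" using sin_npi[of "2 * k"] by (simp add: mult_ac)
  ultimately have "((\<lambda>x. lncot x * cos (real k * x) - D x / real k) has_integral 0) {0..2*pi}" by simp
  from has_integral_add[OF this has_integral_divide[OF D, of "real k"]]
  show ?thesis by simp
qed

text \<open>
  The sign makes Henstock-Kurzweil integrability, which the fundamental theorem provides across the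
  singularities, absolute.
\<close>

lemma lncot_cos_nonneg: "lncot x * cos x \<ge> 0"
proof (cases "cot (x / 2) = 0")
  case False
  then have nz: "sin (x / 2) \<noteq> 0" by (auto simp: cot_def)
  have c: "cos x = (cos (x / 2))\<^sup>2 - (sin (x / 2))\<^sup>2" using cos_double[of "x / 2"] by simp
  have iff: "\<bar>cot (x / 2)\<bar> \<ge> 1 \<longleftrightarrow> cos x \<ge> 0"
  proof -
    have "\<bar>cot (x / 2)\<bar> \<ge> 1 \<longleftrightarrow> \<bar>sin (x / 2)\<bar> \<le> \<bar>cos (x / 2)\<bar>"
      using nz by (simp add: cot_def abs_divide le_divide_eq)
    also have "\<dots> \<longleftrightarrow> (sin (x / 2))\<^sup>2 \<le> (cos (x / 2))\<^sup>2" by (rule abs_le_square_iff)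
    finally show ?thesis unfolding c by simp
  qed
  show ?thesis
  proof (cases "cos x \<ge> 0")
    case True
    then show ?thesis using iff by (simp add: lncot_def)
  next
    case False
    then have "\<bar>cot (x / 2)\<bar> < 1" using iff by simp
    then have "ln \<bar>cot (x / 2)\<bar> \<le> 0" using \<open>cot (x / 2) \<noteq> 0\<close> by (simp add: ln_le_zero_iff)
    then show ?thesis using False by (simp add: lncot_def mult_nonpos_nonpos)
  qed
qed (simp add: lncot_def)

lemma lncot_measurable [measurable]: "lncot \<in> borel_measurable borel"
proof -
  have eq: "lncot = (\<lambda>x. (2*pi) * W x)" by (simp add: W_def lncot_def fun_eq_iff)
  show ?thesis by (subst eq) measurable
qed

text \<open>From \<open>lncot x = (lncot x * cos x) * cos x + (lncot x * sin x) * sin x\<close>: the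
  first bracket is absolutely integrable as a nonnegative Henstock-Kurzweil integrable function, and
  the second is bounded by \<open>3\<close>.\<close>

lemma set_integrable_lncot: "set_integrable lborel {0..2*pi} lncot"
proof -
  have "(\<lambda>x. lncot x * cos x) integrable_on {0..2*pi}"
    using has_integral_lncot_cos[of 0] by (auto simp: integrable_on_def)
  then have "(\<lambda>x. lncot x * cos x) absolutely_integrable_on {0..2*pi}"
    by (rule nonnegative_absolutely_integrable_1) (rule lncot_cos_nonneg)
  then have "integrable lborel (\<lambda>x. indicator {0..2*pi} x *\<^sub>R (lncot x * cos x))"
    unfolding set_integrable_def by (subst (asm) integrable_completion) auto
  moreover have "integrable lborel (\<lambda>x. indicator {0..2*pi} x *\<^sub>R (3::real))"
    by (intro integrable_scaleR_left integrable_real_indicator) (auto simp: emeasure_lborel_Icc_eq)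
  ultimately have 1: "integrable lborel (\<lambda>x. \<bar>indicator {0..2*pi} x *\<^sub>R (lncot x * cos x)\<bar> + indicator {0..2*pi} x *\<^sub>R 3)"
    by (intro Bochner_Integration.integrable_add integrable_abs)
  show ?thesis
    unfolding set_integrable_def
  proof (rule Bochner_Integration.integrable_bound[OF 1])
    show "AE x in lborel. norm (indicator {0..2*pi} x *\<^sub>R lncot x) \<le> norm (\<bar>indicator {0..2*pi} x *\<^sub>R (lncot x * cos x)\<bar> + indicator {0..2*pi} x *\<^sub>R 3)"
    proof (intro AE_I2)
      fix x
      have "lncot x = (lncot x * cos x) * cos x + (lncot x * sin x) * sin x"
        using sin_cos_squared_add[of x] by (simp add: algebra_simps power2_eq_square flip: distrib_left)
      then have "\<bar>lncot x\<bar> \<le> \<bar>lncot x * cos x\<bar> * \<bar>cos x\<bar> + \<bar>lncot x * sin x\<bar> * \<bar>sin x\<bar>"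
        by (metis abs_mult abs_triangle_ineq)
      also have "\<dots> \<le> \<bar>lncot x * cos x\<bar> * 1 + 3 * 1"
      proof (intro add_mono mult_mono)
        show "\<bar>lncot x * sin x\<bar> \<le> 3" using lncot_sin[of x] real_sqrt_le_1_iff[of "\<bar>sin x\<bar>"] by (smt (verit) abs_sin_le_one)
      qed auto
      finally show "norm (indicator {0..2*pi} x *\<^sub>R lncot x) \<le> norm (\<bar>indicator {0..2*pi} x *\<^sub>R (lncot x * cos x)\<bar> + indicator {0..2*pi} x *\<^sub>R 3)"
        by (auto simp: indicator_def)
    qed
  qed measurable
qed

lemma set_integrable_W: "set_integrable lborel {0..2*pi} W"
proof -
  have "W = (\<lambda>x. 1 / (2*pi) * lncot x)" by (simp add: W_def lncot_def fun_eq_iff)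
  then show ?thesis using set_integrable_mult_right[OF set_integrable_lncot, of "1 / (2*pi)"] by simp
qed

lemma set_integrable_cis_mult:
  fixes f :: "real \<Rightarrow> complex"
  assumes "set_integrable lborel A f"
  shows "set_integrable lborel A (\<lambda>x. cis (c * x) * f x)"
proof -
  have "integrable lborel (\<lambda>x. cis (c * x) * (indicator A x *\<^sub>R f x))"
    using assms unfolding set_integrable_def by (rule integrable_cis_mult)
  then show ?thesis unfolding set_integrable_def by simp
qed

lemma set_integrable_W_complex: "set_integrable lborel {0..2*pi} (\<lambda>x. complex_of_real (W x))"
proof -
  have "integrable lborel (\<lambda>x. complex_of_real (indicator {0..2*pi} x *\<^sub>R W x))"
    using set_integrable_W unfolding set_integrable_def by (rule integrable_of_real)
  then show ?thesis by (simp add: set_integrable_def scaleR_conv_of_real)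
qed

section \<open>Fourier coefficients of the potential\<close>

lemma cis_period: "cis (- (of_int k * (x + 2*pi))) = cis (- (of_int k * x))"
proof -
  have "cis (- (of_int k * (x + 2*pi))) = cis (- (of_int k * x)) * cis (2*pi * of_int (- k))"
    by (simp add: cis_mult algebra_simps)
  then show ?thesis using cis_multiple_2pi[of "of_int (- k)"] by simp
qed

lemma fcoeff_W_even:
  assumes "even k"
  shows "fcoeff (\<lambda>x. of_real (W x)) k = 0"
proof -
  let ?f = "\<lambda>x. cis (- (of_int k * x)) * complex_of_real (W x)"
  have f: "set_integrable lborel {0..2*pi} ?f"
    using set_integrable_cis_mult[OF set_integrable_W_complex, of "- of_int k"] by simp
  have "circ ?f = circ (\<lambda>x. ?f (x + pi))"
    by (rule circ_shift(2)[symmetric, OF _ f]) (simp only: cis_period W_periodic)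
  also have "\<dots> = circ (\<lambda>x. - 1 * ?f x)"
  proof (intro arg_cong[where f = circ] ext)
    fix x
    obtain j where j: "k = 2 * j" using assms by (auto elim: evenE)
    have "cis (- (of_int k * (x + pi))) = cis (- (of_int k * x)) * cis (2*pi * of_int (- j))"
      by (simp add: cis_mult algebra_simps j)
    then have "cis (- (of_int k * (x + pi))) = cis (- (of_int k * x))"
      using cis_multiple_2pi[of "of_int (- j)"] by simp
    then show "?f (x + pi) = - 1 * ?f x" by (simp add: W_half_period)
  qed
  also have "\<dots> = - 1 * circ ?f" by (rule circ_mult_right)
  finally show ?thesis by (simp add: fcoeff_def)
qed

text \<open>\<open>W\<close> is even, so the coefficient is real and equals a cosine integral. The
  value \<open>1 / k\<close> cancels the factor \<open>k\<close> from the derivative of the density: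
  a force coefficient is just \<open>\<i>\<close> times a density coefficient.\<close>

lemma fcoeff_W_odd:
  assumes "odd k"
  shows "fcoeff (\<lambda>x. of_real (W x)) (int k) = 1 / of_nat k"
proof -
  let ?f = "\<lambda>j x. cis (- (of_int j * x)) * complex_of_real (W x)"
  have f: "set_integrable lborel {0..2*pi} (?f j)" for j
    using set_integrable_cis_mult[OF set_integrable_W_complex, of "- of_int j"] by simp
  have "fcoeff (\<lambda>x. of_real (W x)) (- int k) = circ (\<lambda>x. ?f (int k) (0 - x))"
    unfolding fcoeff_def by (simp add: W_even)
  also have "\<dots> = fcoeff (\<lambda>x. of_real (W x)) (int k)"
    unfolding fcoeff_def by (rule circ_reflect(2)[OF _ f]) (simp only: cis_period W_periodic)
  finally have "cnj (fcoeff (\<lambda>x. of_real (W x)) (int k)) = fcoeff (\<lambda>x. of_real (W x)) (int k)"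
    by (simp add: fcoeff_of_real_minus)
  then have r: "fcoeff (\<lambda>x. of_real (W x)) (int k) = of_real (Re (fcoeff (\<lambda>x. of_real (W x)) (int k)))"
    by (simp add: complex_eq_iff)
  obtain m where m: "k = 2 * m + 1" using assms by (auto elim: oddE)
  have "Re (fcoeff (\<lambda>x. of_real (W x)) (int k)) = (LINT x|lborel. Re (indicator {0..2*pi} x *\<^sub>R ?f (int k) x))"
    unfolding fcoeff_def circ_def set_lebesgue_integral_def
    using f[of "int k"] by (intro integral_Re[symmetric]) (simp add: set_integrable_def)
  also have "\<dots> = (LINT x:{0..2*pi}|lborel. lncot x * cos (real k * x) / (2*pi))"
    unfolding set_lebesgue_integral_def
    by (intro Bochner_Integration.integral_cong refl) (simp add: W_def lncot_def)
  also have "\<dots> = integral {0..2*pi} (\<lambda>x. lncot x * cos (real k * x) / (2*pi))"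
  proof (rule set_borel_integral_eq_integral(2))
    have "integrable lborel (\<lambda>x. Re (indicator {0..2*pi} x *\<^sub>R ?f (int k) x))"
      using f[of "int k"] by (intro integrable_Re) (simp add: set_integrable_def)
    then show "set_integrable lborel {0..2*pi} (\<lambda>x. lncot x * cos (real k * x) / (2*pi))"
      unfolding set_integrable_def by (simp add: W_def lncot_def mult_ac)
  qed
  also have "\<dots> = (2 * pi / real k) / (2*pi)"
    unfolding m by (intro integral_unique has_integral_divide has_integral_lncot_cos)
  finally show ?thesis by (subst r) simp
qed

text \<open>Moves the dependence on \<open>x\<close> from the singular factor to the regular one, so
  that the singularities stay in place and a majorant independent of \<open>x\<close>
  exists.\<close>

lemma periodic_convolution_eq:
  fixes g :: "real \<Rightarrow> real"
  assumes cont: "continuous_on UNIV g" and per: "\<And>x. g (x + 2*pi) = g x"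
  shows "periodic_convolution W g x = circ (\<lambda>z. W z * g (x - z))"
proof -
  have [measurable]: "g \<in> borel_measurable borel" using cont by (rule borel_measurable_continuous_onI)
  obtain B where B: "\<And>y. \<bar>g y\<bar> \<le> B"
  proof -
    have "compact (g ` {0..2*pi})"
      by (intro compact_continuous_image continuous_on_subset[OF cont]) auto
    then obtain B where B: "\<And>y. y \<in> {0..2*pi} \<Longrightarrow> \<bar>g y\<bar> \<le> B"
      by (meson bounded_real compact_imp_bounded image_eqI)
    show ?thesis
    proof (rule that[of B])
      fix y
      obtain n :: int where "y - 2*pi * of_int n \<in> {0..2*pi}" by (rule shift_into_period)
      then have "\<bar>g (y - 2*pi * of_int n)\<bar> \<le> B" by (rule B)
      then show "\<bar>g y\<bar> \<le> B" using periodic_of_int[of g "y - 2*pi * of_int n" n, OF per] by simp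
    qed
  qed
  have per': "g (y - 2*pi) = g y" for y using per[of "y - 2*pi"] by simp
  have int: "set_integrable lborel {0..2*pi} (\<lambda>z. W z * g (x - z))"
    unfolding set_integrable_def
  proof (rule Bochner_Integration.integrable_bound)
    show "integrable lborel (\<lambda>z. B * (indicator {0..2*pi} z *\<^sub>R W z))"
      using set_integrable_W unfolding set_integrable_def by (rule integrable_mult_right)
    show "AE z in lborel. norm (indicator {0..2*pi} z *\<^sub>R (W z * g (x - z))) \<le> norm (B * (indicator {0..2*pi} z *\<^sub>R W z))"
    proof (intro AE_I2)
      fix z
      have "\<bar>W z\<bar> * \<bar>g (x - z)\<bar> \<le> \<bar>W z\<bar> * \<bar>B\<bar>"
        by (intro mult_left_mono order_trans[OF B abs_ge_self]) simp
      then show "norm (indicator {0..2*pi} z *\<^sub>R (W z * g (x - z))) \<le> norm (B * (indicator {0..2*pi} z *\<^sub>R W z))"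
        by (cases "z \<in> {0..2*pi}") (simp_all add: abs_mult mult.commute)
    qed
  qed measurable
  have "circ (\<lambda>y. W (x - y) * g (x - (x - y))) = circ (\<lambda>z. W z * g (x - z))"
    by (rule circ_reflect(2)[OF _ int]) (simp add: W_periodic per' diff_diff_eq[symmetric])
  then show ?thesis by (simp add: periodic_convolution_def circ_def)
qed

section \<open>Convolution with the potential and smoothness of Fourier series\<close>

text \<open>By periodicity, translates of \<open>W\<close> have the same integral of the modulus
  over a period, which gives Fubini's theorem; the inner integral is then the coefficient of
  \<open>W\<close> times a phase.\<close>

lemma fcoeff_convolution:
  fixes g :: "real \<Rightarrow> real"
  assumes cont: "continuous_on UNIV g"
  shows "fcoeff (\<lambda>x. of_real (periodic_convolution W g x)) k =
    fcoeff (\<lambda>x. of_real (W x)) k * fcoeff (\<lambda>x. of_real (g x)) k"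
proof -
  have [measurable]: "g \<in> borel_measurable borel" using cont by (rule borel_measurable_continuous_onI)
  let ?I = "indicator {0..2*pi} :: real \<Rightarrow> real"
  let ?c = "\<lambda>x. cis (- (of_int k * x))"
  let ?f = "\<lambda>y x. (?I y *\<^sub>R of_real (g y)) * (?I x *\<^sub>R (?c x * complex_of_real (W (x - y))))"
  let ?w = "\<lambda>x. ?c x * complex_of_real (W x)"
  have w: "set_integrable lborel {0..2*pi} ?w"
    using set_integrable_cis_mult[OF set_integrable_W_complex, of "- of_int k"] by simp
  have wper: "?w (x + 2*pi) = ?w x" for x by (simp only: cis_period W_periodic)
  have shift: "?c x * complex_of_real (W (x - y)) = ?c y * ?w (x + - y)" for x y
  proof -
    have "?c y * ?c (x + - y) = ?c x" by (simp add: cis_mult algebra_simps)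
    then show ?thesis by (simp flip: mult.assoc)
  qed
  have inner_int: "set_integrable lborel {0..2*pi} (\<lambda>x. ?c x * complex_of_real (W (x - y)))"
    and inner: "circ (\<lambda>x. ?c x * complex_of_real (W (x - y))) = ?c y * fcoeff (\<lambda>x. of_real (W x)) k" for y
    unfolding shift using circ_shift[OF wper w, of "- y"]
    by (auto intro: set_integrable_mult_right simp: circ_mult_right fcoeff_def)
  have Wn: "set_integrable lborel {0..2*pi} (\<lambda>x. \<bar>W (x + - y)\<bar>)" "circ (\<lambda>x. \<bar>W (x + - y)\<bar>) = circ (\<lambda>x. \<bar>W x\<bar>)" for y
    using circ_shift[of "\<lambda>x. \<bar>W x\<bar>" "- y"] set_integrable_abs[OF set_integrable_W] by (simp_all add: W_periodic)
  have int: "integrable (lborel \<Otimes>\<^sub>M lborel) (\<lambda>(y, x). ?f y x)"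
  proof (rule lborel_pair.Fubini_integrable)
    have "(LINT x|lborel. norm (?f y x)) = (?I y * \<bar>g y\<bar>) * circ (\<lambda>x. \<bar>W x\<bar>)" for y
    proof -
      have "(LINT x|lborel. norm (?f y x)) = (LINT x|lborel. (?I y * \<bar>g y\<bar>) * (?I x *\<^sub>R \<bar>W (x + - y)\<bar>))"
        by (intro Bochner_Integration.integral_cong refl) (simp add: norm_mult)
      also have "\<dots> = (?I y * \<bar>g y\<bar>) * circ (\<lambda>x. \<bar>W (x + - y)\<bar>)"
        unfolding circ_def set_lebesgue_integral_def by (rule integral_mult_right_zero)
      finally show ?thesis unfolding Wn(2) .
    qed
    moreover have "integrable lborel (\<lambda>y. ?I y * \<bar>g y\<bar>)"
      using borel_integrable_atLeastAtMost'[of 0 "2*pi" "\<lambda>y. \<bar>g y\<bar>"] continuous_on_subset[OF cont]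
      by (auto simp: set_integrable_def intro!: continuous_intros)
    ultimately show "integrable lborel (\<lambda>y. LINT x|lborel. norm (case (y, x) of (y, x) \<Rightarrow> ?f y x))"
      by (simp add: integrable_mult_left)
    show "AE y in lborel. integrable lborel (\<lambda>x. case (y, x) of (y, x) \<Rightarrow> ?f y x)"
      unfolding prod.case using inner_int by (intro AE_I2 integrable_mult_right) (simp add: set_integrable_def)
  qed measurable
  have "fcoeff (\<lambda>x. of_real (periodic_convolution W g x)) k = (LINT x|lborel. LINT y|lborel. ?f y x)"
    unfolding fcoeff_def circ_def set_lebesgue_integral_def
  proof (intro Bochner_Integration.integral_cong refl)
    fix x
    have "of_real (periodic_convolution W g x) = (LINT y|lborel. complex_of_real (?I y *\<^sub>R (W (x - y) * g y)))"
      unfolding periodic_convolution_def set_lebesgue_integral_def by (rule integral_complex_of_real[symmetric])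
    then have "?I x *\<^sub>R (?c x * of_real (periodic_convolution W g x)) = (LINT y|lborel. (?I x *\<^sub>R ?c x) * complex_of_real (?I y *\<^sub>R (W (x - y) * g y)))"
      by simp
    also have "\<dots> = (LINT y|lborel. ?f y x)"
      by (intro Bochner_Integration.integral_cong refl) (simp add: scaleR_conv_of_real mult_ac)
    finally show "?I x *\<^sub>R (?c x * of_real (periodic_convolution W g x)) = (LINT y|lborel. ?f y x)" .
  qed
  also have "\<dots> = (LINT y|lborel. LINT x|lborel. ?f y x)"
    by (rule lborel_pair.Fubini_integral[OF int])
  also have "\<dots> = (LINT y|lborel. (?I y *\<^sub>R of_real (g y)) * (?c y * fcoeff (\<lambda>x. of_real (W x)) k))"
    unfolding inner[symmetric] circ_def set_lebesgue_integral_def by (simp only: integral_mult_right_zero)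
  also have "\<dots> = (LINT y|lborel. fcoeff (\<lambda>x. of_real (W x)) k * (?I y *\<^sub>R (?c y * of_real (g y))))"
    by (intro Bochner_Integration.integral_cong refl) (simp add: mult_ac)
  also have "\<dots> = fcoeff (\<lambda>x. of_real (W x)) k * fcoeff (\<lambda>x. of_real (g x)) k"
    unfolding fcoeff_def[of "\<lambda>x. of_real (g x)"] circ_def set_lebesgue_integral_def by (rule integral_mult_right_zero)
  finally show ?thesis .
qed

lemma periodic_convolution_periodic: "periodic_convolution W g (x + 2*pi) = periodic_convolution W g x"
proof -
  have "W (x + 2*pi - y) = W (x - y)" for y using W_periodic[of "x - y"] by (simp add: algebra_simps)
  then show ?thesis by (simp add: periodic_convolution_def)
qed

text \<open>After \<open>periodic_convolution_eq\<close> only the continuous factor varies. Along a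
  convergent sequence its arguments stay in a compact set, so a multiple of the modulus of
  \<open>W\<close> dominates.\<close>

lemma continuous_periodic_convolution:
  fixes g :: "real \<Rightarrow> real \<Rightarrow> real"
  assumes cont: "continuous_on ({0..} \<times> UNIV) (\<lambda>(t, y). g t y)"
    and per: "\<And>t x. t \<ge> 0 \<Longrightarrow> g t (x + 2*pi) = g t x"
  shows "continuous_on ({0..} \<times> UNIV) (\<lambda>(t, x). periodic_convolution W (g t) x)"
proof -
  have contt: "continuous_on UNIV (g t)" if "t \<ge> 0" for t
  proof -
    have "continuous_on UNIV (\<lambda>y. case (t, y) of (t, y) \<Rightarrow> g t y)"
      by (rule continuous_on_compose2[OF cont], intro continuous_on_Pair continuous_on_const continuous_on_id) (use that in auto)
    then show ?thesis by simp
  qed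
  have "continuous_on ({0..} \<times> UNIV) (\<lambda>(t, x). circ (\<lambda>z. W z * g t (x - z)))"
    unfolding continuous_on_sequentially
  proof (intro allI ballI impI, elim conjE)
    fix s :: "nat \<Rightarrow> real \<times> real" and p
    assume p: "p \<in> {0..} \<times> (UNIV :: real set)" and s: "\<forall>n. s n \<in> {0..} \<times> UNIV" and lim: "s \<longlonglongrightarrow> p"
    obtain t x where tx: "p = (t, x)" by (cases p)
    have "bounded (range s)" using lim by (rule convergent_imp_bounded)
    then have "bounded (insert p (range s))" by (simp only: bounded_insert)
    then obtain R where R: "\<And>q. q \<in> insert p (range s) \<Longrightarrow> norm q \<le> R" unfolding bounded_iff by blast
    \<comment> \<open>Contains every pair of a time of the sequence and a position
      \<open>x - z\<close> with \<open>z\<close> in one period.\<close>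
    define K where "K = {0..R} \<times> {- R - 2*pi..R}"
    have "compact ((\<lambda>(t, y). g t y) ` K)"
      unfolding K_def by (intro compact_continuous_image continuous_on_subset[OF cont] compact_Times) auto
    then obtain B where B: "\<And>t y. (t, y) \<in> K \<Longrightarrow> \<bar>g t y\<bar> \<le> B"
      by (force simp: bounded_iff dest!: compact_imp_bounded)
    have sR: "0 \<le> fst (s n)" "fst (s n) \<le> R" "\<bar>snd (s n)\<bar> \<le> R" for n
    proof -
      have "s n \<in> {0..} \<times> UNIV" using s by blast
      then show "0 \<le> fst (s n)" by (auto simp: mem_Times_iff)
      have "norm (s n) \<le> R" by (intro R) auto
      then show "fst (s n) \<le> R" "\<bar>snd (s n)\<bar> \<le> R"
        using norm_fst_le[of "fst (s n)" "snd (s n)"] norm_snd_le[of "snd (s n)" "fst (s n)"] by auto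
    qed
    have meas: "(\<lambda>z. indicator {0..2*pi} z *\<^sub>R (W z * g t (x - z))) \<in> borel_measurable lborel" if "t \<ge> 0" for t x
    proof -
      have [measurable]: "g t \<in> borel_measurable borel" using contt[OF that] by (rule borel_measurable_continuous_onI)
      show ?thesis by measurable
    qed
    have "(\<lambda>n. LINT z|lborel. indicator {0..2*pi} z *\<^sub>R (W z * g (fst (s n)) (snd (s n) - z))) \<longlonglongrightarrow>
      (LINT z|lborel. indicator {0..2*pi} z *\<^sub>R (W z * g t (x - z)))"
    proof (rule integral_dominated_convergence[where w = "\<lambda>z. B * norm (indicator {0..2*pi} z *\<^sub>R W z)"])
      show "(\<lambda>z. indicator {0..2*pi} z *\<^sub>R (W z * g t (x - z))) \<in> borel_measurable lborel"
        by (rule meas) (use p tx in auto)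
      show "(\<lambda>z. indicator {0..2*pi} z *\<^sub>R (W z * g (fst (s n)) (snd (s n) - z))) \<in> borel_measurable lborel" for n
        by (rule meas) (rule sR)
      show "integrable lborel (\<lambda>z. B * norm (indicator {0..2*pi} z *\<^sub>R W z))"
        using set_integrable_W unfolding set_integrable_def by (intro integrable_mult_right integrable_norm)
      show "AE z in lborel. norm (indicator {0..2*pi} z *\<^sub>R (W z * g (fst (s n)) (snd (s n) - z))) \<le> B * norm (indicator {0..2*pi} z *\<^sub>R W z)" for n
      proof (intro AE_I2)
        fix z
        show "norm (indicator {0..2*pi} z *\<^sub>R (W z * g (fst (s n)) (snd (s n) - z))) \<le> B * norm (indicator {0..2*pi} z *\<^sub>R W z)"
        proof (cases "z \<in> {0..2*pi}")
          case True
          then have "\<bar>g (fst (s n)) (snd (s n) - z)\<bar> \<le> B"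
            using sR[of n] by (intro B) (auto simp: K_def)
          then have "\<bar>W z\<bar> * \<bar>g (fst (s n)) (snd (s n) - z)\<bar> \<le> \<bar>W z\<bar> * B" by (rule mult_left_mono) simp
          then show ?thesis using True by (simp add: abs_mult mult.commute)
        qed simp
      qed
      show "AE z in lborel. (\<lambda>n. indicator {0..2*pi} z *\<^sub>R (W z * g (fst (s n)) (snd (s n) - z))) \<longlonglongrightarrow> indicator {0..2*pi} z *\<^sub>R (W z * g t (x - z))"
      proof (intro AE_I2 tendsto_intros)
        fix z
        have l: "(\<lambda>n. (fst (s n), snd (s n) - z)) \<longlonglongrightarrow> (t, x - z)"
          using tendsto_fst[OF lim] tendsto_snd[OF lim] tx by (auto intro!: tendsto_intros)
        have "((\<lambda>(t, y). g t y) \<circ> (\<lambda>n. (fst (s n), snd (s n) - z))) \<longlonglongrightarrow> (\<lambda>(t, y). g t y) (t, x - z)"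
          using cont[unfolded continuous_on_sequentially, rule_format, of "(t, x - z)" "\<lambda>n. (fst (s n), snd (s n) - z)"] l p tx sR by auto
        then show "(\<lambda>n. g (fst (s n)) (snd (s n) - z)) \<longlonglongrightarrow> g t (x - z)" by (simp add: o_def)
      qed
    qed
    then show "((\<lambda>(t, x). circ (\<lambda>z. W z * g t (x - z))) \<circ> s) \<longlonglongrightarrow> (\<lambda>(t, x). circ (\<lambda>z. W z * g t (x - z))) p"
      by (simp add: tx o_def circ_def set_lebesgue_integral_def case_prod_unfold)
  qed
  then show ?thesis
    by (rule continuous_on_eq) (auto simp: periodic_convolution_eq contt per)
qed

lemma fcoeff_deriv:
  fixes u :: "real \<Rightarrow> real"
  assumes d: "\<And>x. u differentiable (at x)" and cont: "continuous_on UNIV (deriv u)" and per: "\<And>x. u (x + 2*pi) = u x"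
  shows "fcoeff (\<lambda>x. of_real (deriv u x)) k = \<i> * of_int k * fcoeff (\<lambda>x. of_real (u x)) k"
proof -
  have du: "(u has_real_derivative deriv u x) (at x)" for x
    using d[of x] by (simp add: DERIV_deriv_iff_real_differentiable)
  have contu: "continuous_on UNIV u"
    using du by (intro continuous_at_imp_continuous_on) (auto intro: DERIV_isCont)
  let ?c = "\<lambda>x. cis (- (of_int k * x))"
  have "(LINT x|lborel. indicator {0..2*pi} x *\<^sub>R (?c x * of_real (deriv u x) - \<i> * of_int k * (?c x * of_real (u x)))) = ?c (2*pi) * of_real (u (2*pi)) - ?c 0 * of_real (u 0)"
  proof (rule integral_FTC_Icc)
    fix x
    have "((\<lambda>z. exp (- (\<i> * of_int k) * z)) has_field_derivative exp (- (\<i> * of_int k) * of_real x) * (- (\<i> * of_int k))) (at (of_real x))"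
      by (auto intro!: derivative_eq_intros)
    from has_vector_derivative_real_field[OF this, of "{0..2*pi}"]
    have 1: "(?c has_vector_derivative - (\<i> * of_int k) * ?c x) (at x within {0..2*pi})"
      by (simp add: cis_conv_exp mult_ac)
    have 2: "((\<lambda>x. complex_of_real (u x)) has_vector_derivative of_real (deriv u x)) (at x within {0..2*pi})"
      using du[of x] has_vector_derivative_at_within by (auto intro!: has_vector_derivative_of_real simp: has_real_derivative_iff_has_vector_derivative)
    show "((\<lambda>x. ?c x * of_real (u x)) has_vector_derivative ?c x * of_real (deriv u x) - \<i> * of_int k * (?c x * of_real (u x))) (at x within {0..2*pi})"
      using has_vector_derivative_mult[OF 1 2] by (simp add: algebra_simps)
  qed (auto intro!: continuous_intros continuous_on_subset[OF cont] continuous_on_subset[OF contu])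
  also have "?c (2*pi) * of_real (u (2*pi)) = ?c 0 * of_real (u 0)"
    using cis_period[of k 0] per[of 0] by simp
  finally have "circ (\<lambda>x. ?c x * of_real (deriv u x) - \<i> * of_int k * (?c x * of_real (u x))) = 0"
    by (simp add: circ_def set_lebesgue_integral_def)
  also have "circ (\<lambda>x. ?c x * of_real (deriv u x) - \<i> * of_int k * (?c x * of_real (u x))) =
     fcoeff (\<lambda>x. of_real (deriv u x)) k - \<i> * of_int k * fcoeff (\<lambda>x. of_real (u x)) k"
    unfolding fcoeff_def
    by (subst circ_diff) (auto simp: circ_mult_right intro!: continuous_intros continuous_on_subset[OF cont] continuous_on_subset[OF contu])
  finally show ?thesis by simp
qed

section \<open>From decaying Fourier coefficients to bounds on all derivatives\<close>

lemma higher_deriv_Re: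
  assumes hol: "U holomorphic_on S" and S: "open S" "\<And>x. of_real x \<in> S" and u: "\<And>x. u x = Re (U (of_real x))"
  shows "(deriv ^^ n) u = (\<lambda>x. Re ((deriv ^^ n) U (of_real x)))"
    and "((deriv ^^ n) u has_real_derivative Re ((deriv ^^ Suc n) U (of_real x))) (at x)"
proof -
  have step: "((\<lambda>x. Re ((deriv ^^ n) U (of_real x))) has_real_derivative Re ((deriv ^^ Suc n) U (of_real x))) (at x)" for n x
  proof -
    have "((deriv ^^ n) U has_field_derivative deriv ((deriv ^^ n) U) (of_real x)) (at (of_real x))"
      by (rule holomorphic_derivI[OF holomorphic_higher_deriv[OF hol S(1)] S(1) S(2)])
    from has_vector_derivative_real_field[OF this]
    have "((\<lambda>x. (deriv ^^ n) U (of_real x)) has_vector_derivative (deriv ^^ Suc n) U (of_real x)) (at x)"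
      by (simp add: o_def)
    from bounded_linear.has_vector_derivative[OF bounded_linear_Re this]
    show ?thesis by (simp add: has_real_derivative_iff_has_vector_derivative)
  qed
  have eq: "(deriv ^^ n) u = (\<lambda>x. Re ((deriv ^^ n) U (of_real x)))" for n
  proof (induction n)
    case 0
    then show ?case using u by auto
  next
    case (Suc n)
    have "(deriv ^^ Suc n) u = deriv ((deriv ^^ n) u)" by simp
    also have "\<dots> = (\<lambda>x. Re ((deriv ^^ Suc n) U (of_real x)))"
      unfolding Suc using DERIV_imp_deriv[OF step] by (simp add: fun_eq_iff)
    finally show ?case .
  qed
  show "(deriv ^^ n) u = (\<lambda>x. Re ((deriv ^^ n) U (of_real x)))" by (rule eq)
  show "((deriv ^^ n) u has_real_derivative Re ((deriv ^^ Suc n) U (of_real x))) (at x)"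
    unfolding eq by (rule step)
qed

text \<open>Cauchy's inequality on circles of radius \<open>d\<close> around real points. With
  \<open>d \<le> 1\<close> the estimate of order \<open>r\<close> majorises those of lower
  order.\<close>

lemma Cr_norm_le_Re:
  assumes hol: "U holomorphic_on {z. Im z > - a}" and d: "0 < d" "d < a" "d \<le> 1"
    and B: "\<And>z. Im z > - a \<Longrightarrow> norm (U z) \<le> B" and u: "\<And>x. u x = Re (U (of_real x))"
  shows "Cr_norm r u \<le> ennreal (fact r * B / d ^ r)"
proof -
  have S: "open {z. Im z > - a}" "\<And>x. of_real x \<in> {z. Im z > - a}"
    using d by (auto simp: open_halfspace_Im_gt)
  note hd = higher_deriv_Re[OF hol S u]
  have B0: "B \<ge> 0" by (rule order_trans[OF norm_ge_zero B[of 0]]) (use d in simp)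
  have le: "\<bar>(deriv ^^ n) u x\<bar> \<le> fact r * B / d ^ r" if "n \<le> r" for n x
  proof -
    have sub: "cball (of_real x) d \<subseteq> {z. Im z > - a}"
    proof
      fix z assume "z \<in> cball (complex_of_real x) d"
      then have "\<bar>Im (of_real x - z)\<bar> \<le> d" using abs_Im_le_cmod[of "of_real x - z"] by (simp add: dist_norm)
      then show "z \<in> {z. Im z > - a}" using d by simp
    qed
    have "\<bar>(deriv ^^ n) u x\<bar> \<le> norm ((deriv ^^ n) U (of_real x))"
      unfolding hd(1) by (rule abs_Re_le_cmod)
    also have "\<dots> \<le> fact n * B / d ^ n"
    proof (rule Cauchy_inequality)
      show "U holomorphic_on ball (of_real x) d"
        by (rule holomorphic_on_subset[OF hol subset_trans[OF ball_subset_cball sub]])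
      show "continuous_on (cball (of_real x) d) U"
        by (rule holomorphic_on_imp_continuous_on[OF holomorphic_on_subset[OF hol sub]])
      show "norm (U z) \<le> B" if "norm (of_real x - z) = d" for z
      proof (rule B)
        have "z \<in> cball (of_real x) d" using that by (simp add: dist_norm)
        then show "Im z > - a" using sub by blast
      qed
    qed (use d in auto)
    also have "\<dots> \<le> fact r * B / d ^ r"
      using that d B0 by (intro frac_le mult_right_mono fact_mono power_decreasing mult_nonneg_nonneg) auto
    finally show ?thesis .
  qed
  have "(\<forall>n<r. (deriv ^^ n) u differentiable_on {0<..<2*pi})"
    unfolding differentiable_on_def real_differentiable_def
    using has_field_derivative_at_within[OF hd(2)] by blast
  moreover have "continuous_on {0<..<2*pi} ((deriv ^^ r) u)"
    by (intro continuous_at_imp_continuous_on ballI DERIV_isCont[OF hd(2)])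
  ultimately have "Cr_norm r u = (SUP n\<in>{..r}. SUP x\<in>{0<..<2*pi}. ennreal \<bar>(deriv ^^ n) u x\<bar>)"
    by (simp add: Cr_norm_def)
  also have "\<dots> \<le> ennreal (fact r * B / d ^ r)"
    by (intro SUP_least ennreal_leI le) auto
  finally show ?thesis .
qed

lemma sums_geometric_from_one:
  assumes "0 \<le> q" "q < (1::real)"
  shows "(\<lambda>k. if k = 0 then 0 else q ^ k) sums (q / (1 - q))"
proof -
  have "(\<lambda>k. q ^ k - (if k = 0 then 1 else 0)) sums (1 / (1 - q) - 1)"
    using assms sums_single[of 0 "\<lambda>_. 1::real"] by (intro sums_diff geometric_sums) auto
  also have "(\<lambda>k. q ^ k - (if k = 0 then 1 else 0)) = (\<lambda>k. if k = 0 then 0 else q ^ k)" by auto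
  also have "1 / (1 - q) - 1 = q / (1 - q)" using assms by (simp add: field_simps)
  finally show ?thesis .
qed

text \<open>Half of the exponent is spent on analyticity: as \<open>t \<ge> 1\<close>, the bound
  \<open>exp (- \<delta> k t)\<close> still beats the growth \<open>exp (\<delta> / 2) ^ k\<close>
  and leaves the geometric ratio \<open>exp (- \<delta> t / 2)\<close>. So the power series in
  \<open>w = exp (\<i> z)\<close> converges for \<open>Im z > - \<delta> / 2\<close>. Since
  \<open>u\<close> is real, nonnegative frequencies suffice, and \<open>u\<close> is the real part
  of this one series.\<close>

theorem Cr_norm_le_fcoeff:
  fixes u :: "real \<Rightarrow> real"
  assumes cont: "continuous_on UNIV u" and per: "\<And>x. u (x + 2*pi) = u x"
    and dl: "\<delta> > 0" and A: "A \<ge> 0" and t: "t \<ge> 1"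
    and zero: "fcoeff (\<lambda>x. of_real (u x)) 0 = 0"
    and le: "\<And>k. k \<ge> 1 \<Longrightarrow> norm (fcoeff (\<lambda>x. of_real (u x)) (int k)) \<le> A * exp (- (\<delta> * real k * t))"
  shows "Cr_norm r u \<le> ennreal (fact r / (pi * (1 - exp (- (\<delta> / 2))) * (min (\<delta> / 4) 1) ^ r) * A * exp (- (\<delta> / 2) * t))"
proof -
  \<comment> \<open>Taking the real part halves each positive frequency, hence the division by
    \<open>pi\<close> instead of \<open>2 * pi\<close>. The index \<open>0\<close> is left out
    because the mean vanishes.\<close>
  define a where "a k = (if k = 0 then 0 else fcoeff (\<lambda>x. of_real (u x)) (int k) / pi)" for k
  define q where "q = exp (- (\<delta> / 2) * t)"
  have q: "0 < q" "q < 1" using dl t by (auto simp: q_def)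
  have q1: "q \<le> exp (- (\<delta> / 2))" using dl t by (simp add: q_def)
  have term_le: "norm (a k * w ^ k) \<le> A / pi * (if k = 0 then 0 else q ^ k)" if w: "norm w < exp (\<delta> / 2)" for k w
  proof (cases "k = 0")
    case False
    have "norm (a k * w ^ k) = norm (fcoeff (\<lambda>x. of_real (u x)) (int k)) / pi * norm w ^ k"
      using False by (simp add: a_def norm_mult norm_divide norm_power)
    also have "\<dots> \<le> (A * exp (- (\<delta> * real k * t))) / pi * exp (\<delta> / 2) ^ k"
      using w False A by (intro mult_mono divide_right_mono le power_mono) auto
    also have "\<dots> = A / pi * exp (- (\<delta> * real k * t) + real k * (\<delta> / 2))"
      by (simp only: exp_add exp_of_nat_mult) simp
    also have "\<dots> \<le> A / pi * exp (real k * (- (\<delta> / 2) * t))"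
    proof -
      have "\<delta> / 2 * real k * 1 \<le> \<delta> / 2 * real k * t" using dl t by (intro mult_left_mono) auto
      then show ?thesis using A by (intro mult_left_mono) (auto simp: algebra_simps)
    qed
    also have "exp (real k * (- (\<delta> / 2) * t)) = q ^ k" unfolding q_def by (rule exp_of_nat_mult)
    finally show ?thesis using False by simp
  qed (simp add: a_def)
  have geo: "(\<lambda>k. A / pi * (if k = 0 then 0 else q ^ k)) sums (A / pi * (q / (1 - q)))"
    using q by (intro sums_mult sums_geometric_from_one) auto
  define P where "P w = (\<Sum>k. a k * w ^ k)" for w
  have summ: "summable (\<lambda>k. norm (a k * w ^ k))" if "norm w < exp (\<delta> / 2)" for w
    by (rule summable_comparison_test[OF _ sums_summable[OF geo]]) (use term_le[OF that] in auto)
  have Psums: "(\<lambda>k. a k * w ^ k) sums P w" if "norm w < exp (\<delta> / 2)" for w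
    unfolding P_def by (rule summable_sums[OF summable_norm_cancel[OF summ[OF that]]])
  have Pbound: "norm (P w) \<le> A / pi * (q / (1 - q))" if w: "norm w < exp (\<delta> / 2)" for w
    unfolding P_def
    by (rule order_trans[OF summable_norm[OF summ[OF w]]])
       (use suminf_le[OF term_le[OF w] summ[OF w] sums_summable[OF geo]] in \<open>simp only: sums_unique[OF geo, symmetric]\<close>)
  have Phol: "P holomorphic_on ball 0 (exp (\<delta> / 2))"
    by (rule power_series_holomorphic[where a = a]) (use Psums in auto)
  define U where "U z = P (exp (\<i> * z))" for z
  have nexp: "norm (exp (\<i> * z)) < exp (\<delta> / 2)" if "Im z > - (\<delta> / 2)" for z
    using that by (simp add: norm_exp_eq_Re)
  have Uhol: "U holomorphic_on {z. Im z > - (\<delta> / 2)}"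
    unfolding U_def[abs_def]
    by (rule holomorphic_on_compose_gen[OF _ Phol, unfolded o_def]) (use nexp in \<open>auto intro!: holomorphic_intros\<close>)
  have U_real: "U (of_real x) = P (cis x)" for x by (simp add: U_def cis_conv_exp)
  have ncis: "norm (cis x) < exp (\<delta> / 2)" for x using dl by simp
  have contP: "continuous_on UNIV (\<lambda>x. P (cis x))"
    by (rule continuous_on_compose2[OF holomorphic_on_imp_continuous_on[OF Phol]]) (use dl in \<open>auto intro!: continuous_intros\<close>)
  have coeffP: "fcoeff (\<lambda>x. P (cis x)) m = (if m \<ge> 0 then 2 * of_real pi * a (nat m) else 0)" for m
  proof -
    let ?f = "\<lambda>k x. indicator {0..2*pi} x *\<^sub>R (cis (- (of_int m * x)) * (a k * cis x ^ k))"
    have fint: "integrable lborel (?f k)" for k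
      by (rule borel_integrable_atLeastAtMost'[unfolded set_integrable_def]) (auto intro!: continuous_intros)
    have nf: "norm (?f k x) = norm (a k) * indicator {0..2*pi} x" for k x
      by (simp add: norm_mult norm_power)
    have suma: "summable (\<lambda>k. norm (a k))" using summ[of 1] dl by simp
    have "fcoeff (\<lambda>x. P (cis x)) m = (LINT x|lborel. (\<Sum>k. ?f k x))"
      unfolding fcoeff_def circ_def set_lebesgue_integral_def
    proof (intro Bochner_Integration.integral_cong refl)
      fix x
      have "(\<lambda>k. ?f k x) sums (indicator {0..2*pi} x *\<^sub>R (cis (- (of_int m * x)) * P (cis x)))"
        by (intro sums_scaleR_right sums_mult Psums ncis)
      then show "indicator {0..2*pi} x *\<^sub>R (cis (- (of_int m * x)) * P (cis x)) = (\<Sum>k. ?f k x)" by (rule sums_unique)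
    qed
    also have "\<dots> = (\<Sum>k. LINT x|lborel. ?f k x)"
    proof (rule integral_suminf[OF fint])
      show "AE x in lborel. summable (\<lambda>k. norm (?f k x))"
        unfolding nf using suma by (intro AE_I2 summable_mult2)
      have "(LINT x|lborel. norm (?f k x)) = norm (a k) * (2*pi)" for k
        unfolding nf by simp
      then show "summable (\<lambda>k. LINT x|lborel. norm (?f k x))"
        using summable_mult2[OF suma] by simp
    qed
    also have "(\<lambda>k. LINT x|lborel. ?f k x) = (\<lambda>k. if k = nat m \<and> m \<ge> 0 then 2 * of_real pi * a k else 0)"
    proof
      fix k
      have "(LINT x|lborel. ?f k x) = circ (\<lambda>x. a k * cis (of_int (int k - m) * x))"
        unfolding circ_def set_lebesgue_integral_def
      proof (intro Bochner_Integration.integral_cong refl)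
        fix x
        have "cis (- (of_int m * x)) * cis x ^ k = cis (of_int (int k - m) * x)"
        proof -
          have "cis (- (of_int m * x)) * cis x ^ k = cis (- (of_int m * x) + real k * x)"
            by (simp only: Complex.DeMoivre cis_mult)
          also have "- (of_int m * x) + real k * x = of_int (int k - m) * x" by (simp add: left_diff_distrib)
          finally show ?thesis .
        qed
        then have "cis (- (of_int m * x)) * (a k * cis x ^ k) = a k * cis (of_int (int k - m) * x)"
          by (simp only: mult.left_commute[of _ "a k"])
        then show "?f k x = indicator {0..2*pi} x *\<^sub>R (a k * cis (of_int (int k - m) * x))" by (simp only:)
      qed
      also have "\<dots> = a k * (if int k - m = 0 then 2 * of_real pi else 0)"
        unfolding circ_mult_right circ_cis by simp
      finally show "(LINT x|lborel. ?f k x) = (if k = nat m \<and> m \<ge> 0 then 2 * of_real pi * a k else 0)" by auto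
    qed
    also have "(\<Sum>k. if k = nat m \<and> m \<ge> 0 then 2 * of_real pi * a k else 0) = (if m \<ge> 0 then 2 * of_real pi * a (nat m) else 0)"
      using sums_unique[OF sums_single[of "nat m" "\<lambda>k. 2 * of_real pi * a k"]] by (cases "m \<ge> 0") simp_all
    finally show ?thesis .
  qed
  define s where "s x = Re (P (cis x))" for x
  have conts: "continuous_on UNIV s" unfolding s_def by (intro continuous_intros contP)
  have s2: "complex_of_real (s x) = (1 / 2) * P (cis x) + (1 / 2) * cnj (P (cis x))" for x
    using complex_add_cnj[of "P (cis x)"] by (simp add: s_def field_simps)
  have coeffs: "fcoeff (\<lambda>x. of_real (s x)) m = (1 / 2) * fcoeff (\<lambda>x. P (cis x)) m + (1 / 2) * cnj (fcoeff (\<lambda>x. P (cis x)) (- m))" for m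
  proof -
    have "fcoeff (\<lambda>x. of_real (s x)) m = circ (\<lambda>x. (1 / 2) * (cis (- (of_int m * x)) * P (cis x)) + (1 / 2) * (cis (- (of_int m * x)) * cnj (P (cis x))))"
      unfolding fcoeff_def s2
    proof (rule arg_cong[where f = circ], rule ext)
      fix x
      have "c * (b * p + b * q) = b * (c * p) + b * (c * q)" for b c p q :: complex by (simp add: algebra_simps)
      then show "cis (- (of_int m * x)) * ((1 / 2) * P (cis x) + (1 / 2) * cnj (P (cis x))) =
        (1 / 2) * (cis (- (of_int m * x)) * P (cis x)) + (1 / 2) * (cis (- (of_int m * x)) * cnj (P (cis x)))" .
    qed
    also have "\<dots> = (1 / 2) * fcoeff (\<lambda>x. P (cis x)) m + (1 / 2) * fcoeff (\<lambda>x. cnj (P (cis x))) m"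
      unfolding fcoeff_def
      by (subst circ_add, (intro continuous_intros continuous_on_subset[OF contP] subset_UNIV)+) (simp only: circ_mult_right)
    finally show ?thesis unfolding fcoeff_cnj .
  qed
  have pos: "fcoeff (\<lambda>x. of_real (u x)) m = fcoeff (\<lambda>x. of_real (s x)) m" if "m \<ge> 0" for m
  proof (cases "m = 0")
    case True
    then show ?thesis unfolding coeffs coeffP by (simp add: zero a_def)
  next
    case False
    then show ?thesis using that unfolding coeffs coeffP by (simp add: a_def)
  qed
  have all: "fcoeff (\<lambda>x. of_real (u x)) m = fcoeff (\<lambda>x. of_real (s x)) m" for m
    using pos[of m] pos[of "- m"] fcoeff_of_real_minus[of u "- m"] fcoeff_of_real_minus[of s "- m"]
    by (cases "m \<ge> 0") auto
  have "u x - s x = 0" for x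
  proof (rule fcoeff_zero_imp_zero[of "\<lambda>x. u x - s x"])
    show "continuous_on UNIV (\<lambda>x. u x - s x)" by (intro continuous_intros cont conts)
    show "u (x + 2*pi) - s (x + 2*pi) = u x - s x" for x
      using cis_period[of "- 1" x] per by (simp add: s_def add.commute)
    fix k
    have "fcoeff (\<lambda>x. of_real (u x - s x)) k = fcoeff (\<lambda>x. of_real (u x)) k - fcoeff (\<lambda>x. of_real (s x)) k"
      unfolding fcoeff_def
      by (subst circ_diff[symmetric], (intro continuous_intros continuous_on_subset[OF cont] continuous_on_subset[OF conts] subset_UNIV)+)
         (simp add: right_diff_distrib)
    then show "fcoeff (\<lambda>x. of_real (u x - s x)) k = 0" using all by simp
  qed
  then have uU: "u x = Re (U (of_real x))" for x unfolding U_real by (simp add: s_def)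
  \<comment> \<open>A Cauchy radius strictly below the depth \<open>\<delta> / 2\<close> of the
    domain of \<open>U\<close>, capped at \<open>1\<close> as \<open>Cr_norm_le_Re\<close>
    requires.\<close>
  let ?d = "min (\<delta> / 4) 1"
  have "Cr_norm r u \<le> ennreal (fact r * (A / pi * (q / (1 - q))) / ?d ^ r)"
    by (rule Cr_norm_le_Re[OF Uhol _ _ _ _ uU]) (use dl nexp Pbound in \<open>auto simp: U_def\<close>)
  also have "\<dots> \<le> ennreal (fact r / (pi * (1 - exp (- (\<delta> / 2))) * ?d ^ r) * A * q)"
  proof (rule ennreal_leI)
    have e: "exp (- (\<delta> / 2)) < 1" using dl by simp
    have "0 < 1 - q" "0 < 1 - exp (- (\<delta> / 2))" "1 - exp (- (\<delta> / 2)) \<le> 1 - q" using q(2) q1 e by linarith+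
    \<comment> \<open>As \<open>t \<ge> 1\<close> keeps the ratio \<open>q\<close> away from
      \<open>1\<close>, the geometric sum is at most a fixed multiple of \<open>q\<close>.\<close>
    then have "q / (1 - q) \<le> q / (1 - exp (- (\<delta> / 2)))" using q(1) by (intro divide_left_mono mult_pos_pos) linarith+
    then have "fact r * (A / pi * (q / (1 - q))) / ?d ^ r \<le> fact r * (A / pi * (q / (1 - exp (- (\<delta> / 2))))) / ?d ^ r"
      using A dl by (intro divide_right_mono mult_left_mono) auto
    also have "\<dots> = fact r / (pi * (1 - exp (- (\<delta> / 2))) * ?d ^ r) * A * q" by simp
    finally show "fact r * (A / pi * (q / (1 - q))) / ?d ^ r \<le> fact r / (pi * (1 - exp (- (\<delta> / 2))) * ?d ^ r) * A * q" .
  qed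
  finally show ?thesis by (simp add: q_def)
qed

section \<open>The initial data\<close>

lemma continuous_on_fourier:
  assumes f: "integrable lborel f"
  shows "continuous_on A (fourier f)"
proof -
  have [measurable]: "f \<in> borel_measurable borel" using f borel_measurable_integrable by force
  have "isCont (fourier f) x" for x
    unfolding isCont_def tendsto_at_iff_sequentially o_def fourier_def
  proof safe
    fix X :: "nat \<Rightarrow> real" assume X: "X \<longlonglongrightarrow> x"
    show "(\<lambda>n. LINT s|lborel. cis (X n * s) * f s) \<longlonglongrightarrow> (LINT s|lborel. cis (x * s) * f s)"
    proof (rule integral_dominated_convergence[where w = "\<lambda>s. norm (f s)"])
      show "AE s in lborel. (\<lambda>n. cis (X n * s) * f s) \<longlonglongrightarrow> cis (x * s) * f s"
      proof (intro AE_I2 tendsto_mult tendsto_const)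
        fix s
        have "continuous_on UNIV cis" by (intro continuous_intros)
        then have "isCont cis (x * s)" by (simp add: continuous_on_eq_continuous_at)
        then show "(\<lambda>n. cis (X n * s)) \<longlonglongrightarrow> cis (x * s)"
          by (rule isCont_tendsto_compose) (intro tendsto_intros X)
      qed
    qed (use f in \<open>auto simp: norm_mult\<close>)
  qed
  then show ?thesis by (intro continuous_at_imp_continuous_on) auto
qed

lemma fcoeff_shift:
  assumes cont: "continuous_on UNIV u" and per: "\<And>x. u (x + 2*pi) = u x"
  shows "fcoeff (\<lambda>x. u (x - c)) k = cis (- (of_int k * c)) * fcoeff u k"
proof -
  let ?f = "\<lambda>x. cis (- (of_int k * x)) * u x"
  have "fcoeff (\<lambda>x. u (x - c)) k = circ (\<lambda>x. cis (- (of_int k * c)) * ?f (x + - c))"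
    unfolding fcoeff_def
  proof (rule arg_cong[where f = circ], rule ext)
    fix x
    have "cis (- (of_int k * c)) * cis (- (of_int k * (x + - c))) = cis (- (of_int k * x))"
      by (simp add: cis_mult algebra_simps)
    then show "cis (- (of_int k * x)) * u (x - c) = cis (- (of_int k * c)) * ?f (x + - c)"
      by (simp flip: mult.assoc)
  qed
  also have "\<dots> = cis (- (of_int k * c)) * circ ?f"
    unfolding circ_mult_right
    by (subst circ_shift(2)) (auto simp only: cis_period per intro!: set_integrable_circ continuous_intros continuous_on_subset[OF cont])
  finally show ?thesis by (simp add: fcoeff_def)
qed

lemma open_strip: "open (strip a)"
proof -
  have "strip a = {z. Im z > - a} \<inter> {z. Im z < a}" by (auto simp: strip_def)
  then show ?thesis by (simp add: open_Int open_halfspace_Im_lt open_halfspace_Im_gt)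
qed

lemma extension_deriv_real:
  assumes ext: "holomorphic_extension a f G" and a: "a > 0"
  shows "deriv G (of_real v) = of_real (deriv f v)"
proof -
  note S = open_strip[of a]
  have "(G has_field_derivative deriv G (of_real v)) (at (of_real v))"
    using ext a by (intro holomorphic_derivI[OF _ S]) (auto simp: holomorphic_extension_def strip_def)
  from has_vector_derivative_real_field[OF this]
  have d: "((\<lambda>x. of_real (f x)) has_vector_derivative deriv G (of_real v)) (at v)"
    using ext by (simp add: holomorphic_extension_def)
  have "(f has_real_derivative Re (deriv G (of_real v))) (at v)"
    using bounded_linear.has_vector_derivative[OF bounded_linear_Re d] by (simp add: has_real_derivative_iff_has_vector_derivative)
  moreover have "((\<lambda>x. 0) has_real_derivative Im (deriv G (of_real v))) (at v)"
    using bounded_linear.has_vector_derivative[OF bounded_linear_Im d] by (simp add: has_real_derivative_iff_has_vector_derivative)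
  then have "Im (deriv G (of_real v)) = 0" using DERIV_unique[OF _ DERIV_const] by blast
  ultimately show ?thesis by (simp add: complex_eq_iff DERIV_imp_deriv)
qed

text \<open>The growth condition controls \<open>deriv G\<close> outside some ball; inside, the
  strip is narrowed so that the remaining set is compact in the domain. Width \<open>a / 4\<close>
  leaves \<open>2 * \<beta> = a / 2\<close>, well inside the given strip.\<close>

lemma profile_of_extension:
  assumes ext: "holomorphic_extension a f G" and a: "a > 0"
    and growth: "deriv G \<in> O[inf at_infinity (principal (strip a))](\<lambda>z. 1 / z)"
  shows "\<exists>C. analytic_profile (deriv G) (deriv f) (a / 4) C"
proof -
  note S = open_strip[of a]
  have hol: "deriv G holomorphic_on strip a"
    using ext S by (auto simp: holomorphic_extension_def intro: holomorphic_deriv)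
  obtain c where c: "c > 0" "\<forall>\<^sub>F z in inf at_infinity (principal (strip a)). norm (deriv G z) \<le> c * norm (1 / z)"
    using growth by (elim landau_o.bigE)
  then obtain b where b: "\<And>z. norm z \<ge> b \<Longrightarrow> z \<in> strip a \<Longrightarrow> norm (deriv G z) \<le> c * norm (1 / z)"
    by (auto simp: eventually_inf_principal eventually_at_infinity)
  define R where "R = max b 1"
  define K where "K = cball 0 R \<inter> {z. Im z \<ge> - (a / 4)} \<inter> {z. Im z \<le> a / 4}"
  have "compact K" unfolding K_def
    by (intro compact_Int_closed compact_cball closed_halfspace_Im_ge closed_halfspace_Im_le)
  moreover have "K \<subseteq> strip a" using a by (auto simp: K_def strip_def)
  then have "continuous_on K (deriv G)"
    by (rule holomorphic_on_imp_continuous_on[OF holomorphic_on_subset[OF hol]])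
  ultimately have "bounded (deriv G ` K)" by (intro compact_imp_bounded compact_continuous_image)
  then obtain B where B: "\<And>z. z \<in> K \<Longrightarrow> norm (deriv G z) \<le> B" by (auto simp: bounded_iff)
  \<comment> \<open>The first term uses \<open>1 + \<bar>Re z\<bar> \<le> 2 * norm z\<close> outside
    the ball, the second covers the compact part.\<close>
  define C where "C = 2 * c + \<bar>B\<bar> * (1 + R)"
  have R: "R \<ge> 1" by (simp add: R_def)
  show ?thesis
  proof (intro exI[of _ C] analytic_profile.intro)
    show "a / 4 > 0" using a by simp
    show "C > 0" unfolding C_def using c R by (intro add_pos_nonneg mult_pos_pos mult_nonneg_nonneg) auto
    show "deriv G holomorphic_on {z. \<bar>Im z\<bar> < 2 * (a / 4)}"
      by (rule holomorphic_on_subset[OF hol]) (use a in \<open>auto simp: strip_def\<close>)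
    show "deriv G (of_real v) = of_real (deriv f v)" for v
      by (rule extension_deriv_real[OF ext a])
    fix z assume z: "\<bar>Im z\<bar> \<le> a / 4"
    have "norm (deriv G z) * (1 + \<bar>Re z\<bar>) \<le> C"
    proof (cases "norm z \<ge> R")
      case True
      then have n: "norm z \<ge> 1" "norm z \<ge> b" by (auto simp: R_def)
      have "norm (deriv G z) \<le> c * norm (1 / z)" using z a n by (intro b) (auto simp: strip_def)
      then have "norm (deriv G z) * (1 + \<bar>Re z\<bar>) \<le> c * norm (1 / z) * (2 * norm z)"
        using n abs_Re_le_cmod[of z] c by (intro mult_mono) auto
      also have "\<dots> = 2 * c" using n by (auto simp: norm_divide)
      also have "\<dots> \<le> C" unfolding C_def using R by simp
      finally show ?thesis .
    next
      case False
      then have "z \<in> K" using z by (auto simp: K_def)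
      have "norm (deriv G z) * (1 + \<bar>Re z\<bar>) \<le> \<bar>B\<bar> * (1 + R)"
        using B[OF \<open>z \<in> K\<close>] False abs_Re_le_cmod[of z] by (intro mult_mono) auto
      also have "\<dots> \<le> C" unfolding C_def using c by simp
      finally show ?thesis .
    qed
    then show "norm (deriv G z) \<le> C / (1 + \<bar>Re z\<bar>)" by (simp add: pos_le_divide_eq)
  qed
qed

section \<open>Free transport of the initial datum\<close>

definition Hcoeff :: "(complex \<Rightarrow> complex \<Rightarrow> complex) \<Rightarrow> int \<Rightarrow> complex \<Rightarrow> complex" where
  "Hcoeff H k w = circ (\<lambda>x. cis (- (of_int k * x)) * H (of_real x) w)"

text \<open>The density coefficient produced by free transport in the rescaled time
  \<open>\<tau> = k t\<close>; it is the source of the Volterra equation.\<close>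

definition free_coeff :: "(real \<Rightarrow> real \<Rightarrow> real) \<Rightarrow> int \<Rightarrow> real \<Rightarrow> complex" where
  "free_coeff h0 k \<tau> = (LINT v|lborel. cis (- (v * \<tau>)) * fcoeff (\<lambda>x. of_real (h0 x v)) k)"

context
  fixes a :: real and h0 :: "real \<Rightarrow> real \<Rightarrow> real" and H :: "complex \<Rightarrow> complex \<Rightarrow> complex"
  assumes a: "a > 0" and ext: "holomorphic_extension2 a h0 H" and lines: "integrable_on_lines a H"
begin

lemma H_continuous: "continuous_on (strip a \<times> strip a) (\<lambda>(z, w). H z w)"
  using ext by (simp add: holomorphic_extension2_def)

lemma H_real: "H (of_real x) (of_real v) = of_real (h0 x v)"
  using ext by (simp add: holomorphic_extension2_def)

lemma of_real_in_strip: "of_real x \<in> strip a"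
  using a by (simp add: strip_def)

lemma H_continuous_line:
  assumes "\<bar>y\<bar> < a"
  shows "continuous_on UNIV (\<lambda>p. H (of_real (fst p)) (Complex (snd p) y))"
proof -
  have "continuous_on UNIV (\<lambda>p. (\<lambda>(z, w). H z w) (of_real (fst p), Complex (snd p) y))"
    by (rule continuous_on_compose2[OF H_continuous])
       (use assms a in \<open>auto intro!: continuous_intros simp: strip_def\<close>)
  then show ?thesis by simp
qed

lemma h0_continuous: "continuous_on UNIV (\<lambda>(x, v). h0 x v)"
proof -
  have "continuous_on UNIV (\<lambda>p. Re (H (of_real (fst p)) (Complex (snd p) 0)))"
    using a by (intro continuous_on_Re H_continuous_line) simp
  then show ?thesis by (simp add: complex_of_real_def[symmetric] H_real case_prod_unfold)
qed

lemma Hcoeff_real: "Hcoeff H k (of_real v) = fcoeff (\<lambda>x. of_real (h0 x v)) k"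
  by (simp add: Hcoeff_def fcoeff_def H_real)

lemma Hcoeff_holomorphic: "Hcoeff H k holomorphic_on strip a"
  unfolding Hcoeff_def[abs_def] circ_def set_lebesgue_integral_def
proof (rule holomorphic_on_integral)
  show S: "open (strip a)" by (rule open_strip)
  show "(\<lambda>x. indicator {0..2*pi} x *\<^sub>R (cis (- (of_int k * x)) * H (of_real x) w)) \<in> borel_measurable lborel"
    if w: "w \<in> strip a" for w
  proof -
    have "continuous_on UNIV (\<lambda>p. H (of_real (fst p)) (Complex (snd p) (Im w)))"
      using w by (intro H_continuous_line) (simp add: strip_def)
    then have "continuous_on UNIV (\<lambda>x. H (of_real (fst (x, Re w))) (Complex (snd (x, Re w)) (Im w)))"
      by (rule continuous_on_compose2) (auto intro!: continuous_intros)
    then have [measurable]: "(\<lambda>x. H (of_real x) w) \<in> borel_measurable borel"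
      by (intro borel_measurable_continuous_onI) simp
    show ?thesis by measurable
  qed
  show "(\<lambda>w. indicator {0..2*pi} x *\<^sub>R (cis (- (of_int k * x)) * H (of_real x) w)) holomorphic_on strip a" for x
    unfolding scaleR_conv_of_real using ext of_real_in_strip[of x]
    by (intro holomorphic_intros) (simp add: holomorphic_extension2_def)
  fix w assume w: "w \<in> strip a"
  obtain r where r: "r > 0" "cball w r \<subseteq> strip a"
    using S w open_contains_cball by blast
  have "compact ((\<lambda>(z, w). H z w) ` ((of_real ` {0..2*pi}) \<times> cball w r))"
    using r of_real_in_strip
    by (intro compact_continuous_image compact_Times continuous_on_subset[OF H_continuous] continuous_intros compact_Icc compact_cball) auto
  then obtain B where B: "\<And>x z. x \<in> {0..2*pi} \<Longrightarrow> z \<in> cball w r \<Longrightarrow> norm (H (of_real x) z) \<le> B"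
    by (force simp: bounded_iff dest!: compact_imp_bounded)
  show "\<exists>r>0. \<exists>B. integrable lborel B \<and> ball w r \<subseteq> strip a \<and>
      (\<forall>z\<in>ball w r. \<forall>x\<in>space lborel. norm (indicator {0..2*pi} x *\<^sub>R (cis (- (of_int k * x)) * H (of_real x) z)) \<le> B x)"
  proof (intro exI[of _ r] conjI exI[of _ "\<lambda>x. indicator {0..2*pi} x *\<^sub>R B"] ballI)
    show "integrable lborel (\<lambda>x. indicator {0..2*pi} x *\<^sub>R B)"
      by (intro integrable_scaleR_left integrable_real_indicator) (auto simp: emeasure_lborel_Icc_eq)
    show "ball w r \<subseteq> strip a" using r ball_subset_cball by blast
    fix z x assume "z \<in> ball w r"
    then show "norm (indicator {0..2*pi} x *\<^sub>R (cis (- (of_int k * x)) * H (of_real x) z)) \<le> indicator {0..2*pi} x *\<^sub>R B"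
      using B[of x z] by (cases "x \<in> {0..2*pi}") (auto simp: norm_mult)
  qed (rule r)
qed

text \<open>The phase in the Fourier coefficient has modulus one, so the bound of
  \<open>integrable_on_lines\<close> serves all \<open>k\<close> at once.\<close>

lemma Hcoeff_lines:
  shows "\<exists>M>0. \<forall>k y. \<bar>y\<bar> < a \<longrightarrow> (\<integral>\<^sup>+u. ennreal (norm (Hcoeff H k (Complex u y))) \<partial>lborel) \<le> ennreal M"
proof -
  obtain M where M: "\<And>y. \<bar>y\<bar> < a \<Longrightarrow>
     (\<integral>\<^sup>+p\<in>{0..2*pi} \<times> UNIV. ennreal (norm (H (of_real (fst p)) (Complex (snd p) y))) \<partial>(lborel :: (real \<times> real) measure)) \<le> ennreal M"
    using lines unfolding integrable_on_lines_def by blast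
  show ?thesis
  proof (intro exI[of _ "max M 1"] conjI allI impI)
    fix k y assume y: "\<bar>y\<bar> < a"
    have [measurable]: "(\<lambda>p. H (of_real (fst p)) (Complex (snd p) y)) \<in> borel_measurable (borel \<Otimes>\<^sub>M borel)"
      using borel_measurable_continuous_onI[OF H_continuous_line[OF y]] by (simp add: borel_prod)
    have "(\<integral>\<^sup>+u. ennreal (norm (Hcoeff H k (Complex u y))) \<partial>lborel) \<le>
      (\<integral>\<^sup>+u. \<integral>\<^sup>+x. ennreal (norm (H (of_real x) (Complex u y))) * indicator {0..2*pi} x \<partial>lborel \<partial>lborel)"
    proof (intro nn_integral_mono)
      fix u
      have "ennreal (norm (Hcoeff H k (Complex u y))) \<le>
        (\<integral>\<^sup>+x. ennreal (norm (indicator {0..2*pi} x *\<^sub>R (cis (- (of_int k * x)) * H (of_real x) (Complex u y)))) \<partial>lborel)"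
        unfolding Hcoeff_def circ_def set_lebesgue_integral_def by (rule norm_integral_le_nn_integral)
      also have "\<dots> = (\<integral>\<^sup>+x. ennreal (norm (H (of_real x) (Complex u y))) * indicator {0..2*pi} x \<partial>lborel)"
        by (intro nn_integral_cong) (auto simp: norm_mult indicator_def)
      finally show "ennreal (norm (Hcoeff H k (Complex u y))) \<le> \<dots>" .
    qed
    also have "\<dots> = (\<integral>\<^sup>+p. ennreal (norm (H (of_real (fst p)) (Complex (snd p) y))) * indicator {0..2*pi} (fst p) \<partial>(lborel \<Otimes>\<^sub>M lborel))"
      by (subst lborel_pair.nn_integral_snd[symmetric]) (auto simp: case_prod_unfold)
    also have "\<dots> = (\<integral>\<^sup>+p\<in>{0..2*pi} \<times> UNIV. ennreal (norm (H (of_real (fst p)) (Complex (snd p) y))) \<partial>(lborel :: (real \<times> real) measure))"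
      unfolding lborel_prod by (intro nn_integral_cong) (auto simp: indicator_def mem_Times_iff)
    also have "\<dots> \<le> ennreal M" by (rule M[OF y])
    also have "\<dots> \<le> ennreal (max M 1)" by (intro ennreal_leI) simp
    finally show "(\<integral>\<^sup>+u. ennreal (norm (Hcoeff H k (Complex u y))) \<partial>lborel) \<le> ennreal (max M 1)" .
  qed simp
qed

lemma integrable_fcoeff_initial: "integrable lborel (\<lambda>v. fcoeff (\<lambda>x. of_real (h0 x v)) k)"
proof -
  obtain M where "\<And>k y. \<bar>y\<bar> < a \<Longrightarrow> (\<integral>\<^sup>+u. ennreal (norm (Hcoeff H k (Complex u y))) \<partial>lborel) \<le> ennreal M"
    using Hcoeff_lines by blast
  then have "(\<integral>\<^sup>+u. ennreal (norm (Hcoeff H k (Complex u 0))) \<partial>lborel) \<le> ennreal M" using a by simp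
  moreover have "continuous_on UNIV (\<lambda>u. Hcoeff H k (Complex u 0))"
    by (rule continuous_on_compose2[OF holomorphic_on_imp_continuous_on[OF Hcoeff_holomorphic]])
       (use a in \<open>auto intro!: continuous_intros simp: strip_def\<close>)
  ultimately have "integrable lborel (\<lambda>u. Hcoeff H k (Complex u 0))" by (intro integrable_on_line)
  then show ?thesis by (simp add: complex_of_real_def[symmetric] Hcoeff_real)
qed

lemma continuous_on_free_coeff: "continuous_on A (free_coeff h0 k)"
proof -
  have "free_coeff h0 k = (\<lambda>\<tau>. fourier (\<lambda>v. fcoeff (\<lambda>x. of_real (h0 x v)) k) (- \<tau>))"
    by (simp add: free_coeff_def fourier_def mult.commute fun_eq_iff)
  then show ?thesis
    using continuous_on_compose2[OF continuous_on_fourier[OF integrable_fcoeff_initial, of UNIV] continuous_on_minus[OF continuous_on_id]]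
    by simp
qed

text \<open>Lowering the velocity line to \<open>Im w = - a / 2\<close> turns the oscillation
  \<open>exp (- \<i> w \<tau>)\<close> into the factor \<open>exp (- a \<tau> / 2)\<close>. Half of
  the strip is given up to stay inside it.\<close>

theorem free_coeff_decay:
  shows "\<exists>M>0. \<forall>k. \<forall>\<tau>\<ge>0. norm (free_coeff h0 k \<tau>) \<le> M * exp (- (a / 2 * \<tau>))"
proof -
  obtain M where M: "M > 0" "\<And>k y. \<bar>y\<bar> < a \<Longrightarrow> (\<integral>\<^sup>+u. ennreal (norm (Hcoeff H k (Complex u y))) \<partial>lborel) \<le> ennreal M"
    using Hcoeff_lines by blast
  show ?thesis
  proof (intro exI[of _ M] conjI allI impI)
    show "M > 0" by fact
    fix k and \<tau> :: real assume \<tau>: "\<tau> \<ge> 0"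
    let ?\<phi> = "\<lambda>w. exp (- \<i> * w * of_real \<tau>) * Hcoeff H k w"
    have n: "norm (?\<phi> (Complex u y)) = exp (y * \<tau>) * norm (Hcoeff H k (Complex u y))" for u y
      by (simp add: norm_mult norm_exp_eq_Re)
    have b: "(\<integral>\<^sup>+u. ennreal (norm (?\<phi> (Complex u y))) \<partial>lborel) \<le> ennreal (exp (y * \<tau>) * M)" if "\<bar>y\<bar> < a" for y
    proof -
      have c: "continuous_on UNIV (\<lambda>u. Hcoeff H k (Complex u y))"
        by (rule continuous_on_compose2[OF holomorphic_on_imp_continuous_on[OF Hcoeff_holomorphic]])
           (use a that in \<open>auto intro!: continuous_intros simp: strip_def\<close>)
      have "(\<integral>\<^sup>+u. ennreal (norm (?\<phi> (Complex u y))) \<partial>lborel) = (\<integral>\<^sup>+u. ennreal (exp (y * \<tau>)) * ennreal (norm (Hcoeff H k (Complex u y))) \<partial>lborel)"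
        unfolding n by (simp add: ennreal_mult)
      also have "\<dots> = ennreal (exp (y * \<tau>)) * (\<integral>\<^sup>+u. ennreal (norm (Hcoeff H k (Complex u y))) \<partial>lborel)"
        using borel_measurable_continuous_onI[OF c] by (intro nn_integral_cmult) auto
      also have "\<dots> \<le> ennreal (exp (y * \<tau>)) * ennreal M" using that by (intro mult_left_mono M) auto
      finally show ?thesis using M by (simp add: ennreal_mult)
    qed
    have "(LINT u|lborel. ?\<phi> (Complex u (- (a / 2)))) = (LINT u|lborel. ?\<phi> (Complex u 0))"
    proof (rule strip_line_integral_shift)
      show "?\<phi> holomorphic_on {z. - a < Im z \<and> Im z < a}"
        by (intro holomorphic_intros holomorphic_on_subset[OF Hcoeff_holomorphic]) (auto simp: strip_def)
      fix y assume y: "- (a / 2) \<le> y" "y \<le> 0"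
      have "(\<integral>\<^sup>+u. ennreal (norm (?\<phi> (Complex u y))) \<partial>lborel) \<le> ennreal (exp (y * \<tau>) * M)"
        using y a by (intro b) auto
      also have "\<dots> \<le> ennreal M"
        using y \<tau> M by (intro ennreal_leI mult_left_le_one_le) (auto simp: mult_nonpos_nonneg)
      finally show "(\<integral>\<^sup>+u. ennreal (norm (?\<phi> (Complex u y))) \<partial>lborel) \<le> ennreal M" .
    qed (use a in auto)
    also have "\<dots> = free_coeff h0 k \<tau>"
      unfolding free_coeff_def
      by (intro Bochner_Integration.integral_cong refl) (simp add: complex_of_real_def[symmetric] Hcoeff_real cis_conv_exp mult_ac)
    finally have "ennreal (norm (free_coeff h0 k \<tau>)) = ennreal (norm (LINT u|lborel. ?\<phi> (Complex u (- (a / 2)))))" by simp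
    also have "\<dots> \<le> (\<integral>\<^sup>+u. ennreal (norm (?\<phi> (Complex u (- (a / 2))))) \<partial>lborel)"
      by (rule norm_integral_le_nn_integral)
    also have "\<dots> \<le> ennreal (exp (- (a / 2) * \<tau>) * M)" using a by (intro b) auto
    finally show "norm (free_coeff h0 k \<tau>) \<le> M * exp (- (a / 2 * \<tau>))"
      using M by (subst (asm) ennreal_le_iff) (auto simp: mult.commute)
  qed
qed

end

section \<open>Solutions of the linearized system\<close>

text \<open>\<open>deriv\<close> is a choice from the derivative relation, so agreement of the
  relation at both points gives equality without any differentiability.\<close>

lemma deriv_periodic:
  fixes u :: "real \<Rightarrow> real"
  assumes per: "\<And>x. u (x + p) = u x"
  shows "deriv u (x + p) = deriv u x"
proof -
  have "(u has_real_derivative D) (at (x + p)) \<longleftrightarrow> (u has_real_derivative D) (at x)" for D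
    using DERIV_shift[of u D x p] per by simp
  then show ?thesis by (simp add: deriv_def)
qed

definition density_coeff :: "(real \<Rightarrow> real \<Rightarrow> real \<Rightarrow> real) \<Rightarrow> int \<Rightarrow> real \<Rightarrow> complex" where
  "density_coeff h k t = fcoeff (\<lambda>x. of_real (mass_density h t x)) k"

context
  fixes f0 :: "real \<Rightarrow> real" and h0 :: "real \<Rightarrow> real \<Rightarrow> real" and h :: "real \<Rightarrow> real \<Rightarrow> real \<Rightarrow> real"
  assumes sol: "linearized_solution f0 h0 h"
    and per0: "\<And>x v. h0 (x + 2*pi) v = h0 x v"
    and cont0: "continuous_on UNIV (\<lambda>(x, v). h0 x v)"
begin

lemma solution_derivative:
  assumes "t \<ge> 0"
  obtains ht hx where "((\<lambda>(s, y). h s y v) has_derivative (\<lambda>(s, y). ht * s + hx * y)) (at (t, x) within {0..} \<times> UNIV)"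
    "ht + v * hx + force h t x * deriv f0 v = 0"
proof -
  have "\<forall>t\<ge>0. \<forall>x v. \<exists>ht hx.
        ((\<lambda>(s, y). h s y v) has_derivative (\<lambda>(s, y). ht * s + hx * y)) (at (t, x) within {0..} \<times> UNIV) \<and>
        ht + v * hx + force h t x * deriv f0 v = 0"
    using sol unfolding linearized_solution_def by (elim conjE)
  from this[rule_format, OF assms, of v x] that show ?thesis by (elim exE conjE)
qed

lemma h_periodic: "t \<ge> 0 \<Longrightarrow> h t (x + 2*pi) v = h t x v"
  using sol by (simp add: linearized_solution_def)

lemma density_periodic: "t \<ge> 0 \<Longrightarrow> mass_density h t (x + 2*pi) = mass_density h t x"
  by (simp add: mass_density_def h_periodic)

lemma density_differentiable: "t \<ge> 0 \<Longrightarrow> mass_density h t differentiable (at x)"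
  using sol by (simp add: linearized_solution_def)

lemma deriv_density_continuous: "continuous_on ({0..} \<times> UNIV) (\<lambda>(t, x). deriv (mass_density h t) x)"
  using sol by (simp add: linearized_solution_def)

lemma deriv_density_continuous_at: "t \<ge> 0 \<Longrightarrow> continuous_on UNIV (deriv (mass_density h t))"
proof -
  assume t: "t \<ge> 0"
  have "continuous_on UNIV (\<lambda>x. case (t, x) of (t, x) \<Rightarrow> deriv (mass_density h t) x)"
    by (rule continuous_on_compose2[OF deriv_density_continuous], intro continuous_on_Pair continuous_on_const continuous_on_id) (use t in auto)
  then show ?thesis by simp
qed

lemma density_continuous: "t \<ge> 0 \<Longrightarrow> continuous_on UNIV (mass_density h t)"
  using density_differentiable by (intro continuous_at_imp_continuous_on) (auto intro: differentiable_imp_continuous_within)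

lemma force_continuous: "continuous_on ({0..} \<times> UNIV) (\<lambda>(t, x). force h t x)"
  unfolding force_def
  by (rule continuous_periodic_convolution[OF deriv_density_continuous]) (intro deriv_periodic density_periodic)

lemma force_continuous_at: "t \<ge> 0 \<Longrightarrow> continuous_on UNIV (force h t)"
proof -
  assume t: "t \<ge> 0"
  have "continuous_on UNIV (\<lambda>x. case (t, x) of (t, x) \<Rightarrow> force h t x)"
    by (rule continuous_on_compose2[OF force_continuous], intro continuous_on_Pair continuous_on_const continuous_on_id) (use t in auto)
  then show ?thesis by simp
qed

lemma force_periodic: "force h t (x + 2*pi) = force h t x"
  unfolding force_def by (rule periodic_convolution_periodic)

lemma force_coeff:
  assumes "t \<ge> 0"
  shows "fcoeff (\<lambda>x. of_real (force h t x)) k = fcoeff (\<lambda>x. of_real (W x)) k * (\<i> * of_int k * density_coeff h k t)"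
  unfolding force_def density_coeff_def
  by (simp only: fcoeff_convolution[OF deriv_density_continuous_at[OF assms]]
      fcoeff_deriv[OF density_differentiable[OF assms] deriv_density_continuous_at[OF assms] density_periodic[OF assms]])

text \<open>Joint continuity is available for the space derivative of the density, not for the
  density itself. The coefficient is therefore recovered from that of the derivative, at the price
  of dividing by \<open>k\<close>.\<close>

lemma continuous_on_density_coeff:
  assumes k: "k \<noteq> 0"
  shows "continuous_on {0..} (density_coeff h k)"
proof -
  have "continuous_on ({0..} \<times> cbox 0 (2*pi)) (\<lambda>(t, x). cis (- (of_int k * x)) * of_real (deriv (mass_density h t) x))"
    unfolding case_prod_unfold
    by (intro continuous_intros continuous_on_subset[OF deriv_density_continuous[unfolded case_prod_unfold]]) auto
  then have "continuous_on {0..} (\<lambda>t. integral (cbox 0 (2*pi)) (\<lambda>x. cis (- (of_int k * x)) * of_real (deriv (mass_density h t) x)))"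
    by (rule integral_continuous_on_param)
  then have "continuous_on {0..} (\<lambda>t. integral (cbox 0 (2*pi)) (\<lambda>x. cis (- (of_int k * x)) * of_real (deriv (mass_density h t) x)) / (\<i> * of_int k))"
    using k by (intro continuous_intros) auto
  then show ?thesis
  proof (rule continuous_on_eq)
    fix t :: real assume "t \<in> {0..}"
    then have t: "t \<ge> 0" by simp
    have "fcoeff (\<lambda>x. of_real (deriv (mass_density h t) x)) k = integral {0..2*pi} (\<lambda>x. cis (- (of_int k * x)) * of_real (deriv (mass_density h t) x))"
      unfolding fcoeff_def circ_def
      by (intro set_borel_integral_eq_integral set_integrable_circ continuous_intros continuous_on_subset[OF deriv_density_continuous_at[OF t]]) auto
    then have "integral {0..2*pi} (\<lambda>x. cis (- (of_int k * x)) * of_real (deriv (mass_density h t) x)) = \<i> * of_int k * density_coeff h k t"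
      unfolding density_coeff_def
      by (simp only: fcoeff_deriv[OF density_differentiable[OF t] deriv_density_continuous_at[OF t] density_periodic[OF t]])
    then show "integral (cbox 0 (2*pi)) (\<lambda>x. cis (- (of_int k * x)) * of_real (deriv (mass_density h t) x)) / (\<i> * of_int k) = density_coeff h k t"
      using k by simp
  qed
qed

text \<open>Duhamel's formula: along the straight line with velocity \<open>v\<close> through
  \<open>(t, x)\<close> the equation is an ordinary differential equation in \<open>s\<close>. The
  total derivative on the closed half plane permits the chain rule up to and including
  \<open>s = 0\<close>.\<close>

lemma characteristics:
  assumes t: "t \<ge> 0"
  shows "h t x v = h0 (x - v * t) v - deriv f0 v * (LINT s:{0..t}|lborel. force h s (x - v * (t - s)))"
proof -
  have contF: "continuous_on {0..t} (\<lambda>s. force h s (x - v * (t - s)))"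
  proof -
    have "continuous_on {0..t} (\<lambda>s. case (s, x - v * (t - s)) of (t, x) \<Rightarrow> force h t x)"
      by (rule continuous_on_compose2[OF force_continuous], intro continuous_intros) auto
    then show ?thesis by simp
  qed
  have d: "((\<lambda>s. h s (x - v * (t - s)) v) has_vector_derivative - (deriv f0 v * force h s (x - v * (t - s)))) (at s within {0..t})"
    if s: "0 \<le> s" "s \<le> t" for s
  proof -
    obtain ht hx where D: "((\<lambda>(s, y). h s y v) has_derivative (\<lambda>(s, y). ht * s + hx * y)) (at (s, x - v * (t - s)) within {0..} \<times> UNIV)"
      and eq: "ht + v * hx + force h s (x - v * (t - s)) * deriv f0 v = 0"
      using solution_derivative[OF s(1)] .
    have c: "((\<lambda>s. (s, x - v * (t - s))) has_derivative (\<lambda>d. (d, v * d))) (at s within {0..t})"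
      by (auto intro!: derivative_eq_intros)
    have "((\<lambda>s. (\<lambda>(s, y). h s y v) (s, x - v * (t - s))) has_derivative (\<lambda>d. (\<lambda>(s, y). ht * s + hx * y) (d, v * d))) (at s within {0..t})"
      by (rule has_derivative_in_compose[OF c has_derivative_subset[OF D]]) auto
    then have "((\<lambda>s. h s (x - v * (t - s)) v) has_derivative (\<lambda>d. d *\<^sub>R (ht + v * hx))) (at s within {0..t})"
      by (simp add: algebra_simps)
    moreover have "ht + v * hx = - (deriv f0 v * force h s (x - v * (t - s)))"
      using eq by (simp add: eq_neg_iff_add_eq_0 mult.commute)
    ultimately show ?thesis by (simp only: has_vector_derivative_def)
  qed
  have "(LINT s|lborel. indicator {0..t} s *\<^sub>R (- (deriv f0 v * force h s (x - v * (t - s))))) = h t (x - v * (t - t)) v - h 0 (x - v * (t - 0)) v"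
    by (rule integral_FTC_Icc[OF t d]) (auto intro!: continuous_intros contF)
  moreover have "(LINT s|lborel. indicator {0..t} s *\<^sub>R (- (deriv f0 v * force h s (x - v * (t - s))))) = - deriv f0 v * (LINT s:{0..t}|lborel. force h s (x - v * (t - s)))"
    unfolding set_lebesgue_integral_def by (subst integral_mult_right_zero[symmetric]) (intro Bochner_Integration.integral_cong refl, simp)
  moreover have "h 0 (x - v * (t - 0)) v = h0 (x - v * t) v" using sol by (simp add: linearized_solution_def)
  ultimately show ?thesis by simp
qed

lemma force_history_coeff:
  assumes t: "t \<ge> 0"
  shows "fcoeff (\<lambda>x. of_real (LINT s:{0..t}|lborel. force h s (x - v * (t - s)))) k =
    (LINT s|lborel. indicator {0..t} s *\<^sub>R (cis (- (of_int k * (v * (t - s)))) * fcoeff (\<lambda>x. of_real (force h s x)) k))"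
proof -
  let ?J = "indicator {0..t} :: real \<Rightarrow> real" and ?I = "indicator {0..2*pi} :: real \<Rightarrow> real"
  let ?c = "\<lambda>x. cis (- (of_int k * x))"
  let ?f = "\<lambda>s x. ?J s *\<^sub>R (?I x *\<^sub>R (?c x * complex_of_real (force h s (x - v * (t - s)))))"
  have int: "integrable (lborel \<Otimes>\<^sub>M lborel) (\<lambda>(s, x). ?f s x)"
  proof -
    have "continuous_on ({0..t} \<times> {0..2*pi}) (\<lambda>p. (\<lambda>(t, x). force h t x) (fst p, snd p - v * (t - fst p)))"
      by (rule continuous_on_compose2[OF force_continuous]) (auto intro!: continuous_intros)
    then have "continuous_on ({0..t} \<times> {0..2*pi}) (\<lambda>p. ?c (snd p) * complex_of_real (force h (fst p) (snd p - v * (t - fst p))))"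
      by (intro continuous_intros) simp
    then have "integrable lborel (\<lambda>p. indicator ({0..t} \<times> {0..2*pi}) p *\<^sub>R (?c (snd p) * complex_of_real (force h (fst p) (snd p - v * (t - fst p)))))"
      by (intro borel_integrable_compact compact_Times) auto
    also have "(\<lambda>p. indicator ({0..t} \<times> {0..2*pi}) p *\<^sub>R (?c (snd p) * complex_of_real (force h (fst p) (snd p - v * (t - fst p))))) = (\<lambda>(s, x). ?f s x)"
      by (auto simp: fun_eq_iff indicator_def)
    finally show ?thesis by (simp add: lborel_prod)
  qed
  have "fcoeff (\<lambda>x. of_real (LINT s:{0..t}|lborel. force h s (x - v * (t - s)))) k = (LINT x|lborel. LINT s|lborel. ?f s x)"
    unfolding fcoeff_def circ_def set_lebesgue_integral_def
  proof (intro Bochner_Integration.integral_cong refl)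
    fix x
    have "complex_of_real (LINT s|lborel. ?J s *\<^sub>R force h s (x - v * (t - s))) = (LINT s|lborel. complex_of_real (?J s *\<^sub>R force h s (x - v * (t - s))))"
      by (rule integral_complex_of_real[symmetric])
    then have "?I x *\<^sub>R (?c x * complex_of_real (LINT s|lborel. ?J s *\<^sub>R force h s (x - v * (t - s)))) =
      (LINT s|lborel. (?I x *\<^sub>R ?c x) * complex_of_real (?J s *\<^sub>R force h s (x - v * (t - s))))"
      by simp
    also have "\<dots> = (LINT s|lborel. ?f s x)"
      by (intro Bochner_Integration.integral_cong refl) (simp add: scaleR_conv_of_real mult_ac)
    finally show "?I x *\<^sub>R (?c x * complex_of_real (LINT s|lborel. ?J s *\<^sub>R force h s (x - v * (t - s)))) = (LINT s|lborel. ?f s x)" .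
  qed
  also have "\<dots> = (LINT s|lborel. LINT x|lborel. ?f s x)" by (rule lborel_pair.Fubini_integral[OF int])
  also have "\<dots> = (LINT s|lborel. ?J s *\<^sub>R (cis (- (of_int k * (v * (t - s)))) * fcoeff (\<lambda>x. of_real (force h s x)) k))"
  proof (intro Bochner_Integration.integral_cong refl)
    fix s
    show "(LINT x|lborel. ?f s x) = ?J s *\<^sub>R (cis (- (of_int k * (v * (t - s)))) * fcoeff (\<lambda>x. of_real (force h s x)) k)"
    proof (cases "s \<in> {0..t}")
      case True
      then have s: "s \<ge> 0" by simp
      have "(LINT x|lborel. ?f s x) = fcoeff (\<lambda>x. of_real (force h s (x - v * (t - s)))) k"
        using True by (simp add: fcoeff_def circ_def set_lebesgue_integral_def)
      also have "\<dots> = cis (- (of_int k * (v * (t - s)))) * fcoeff (\<lambda>x. of_real (force h s x)) k"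
        by (rule fcoeff_shift[of "\<lambda>x. of_real (force h s x)"]) (auto intro!: continuous_intros force_continuous_at s simp: force_periodic)
      finally show ?thesis using True by simp
    qed simp
  qed
  finally show ?thesis .
qed

lemma solution_coeff:
  assumes t: "t \<ge> 0"
  shows "fcoeff (\<lambda>x. of_real (h t x v)) k = cis (- (v * (of_int k * t))) * fcoeff (\<lambda>x. of_real (h0 x v)) k -
    of_real (deriv f0 v) * (LINT s|lborel. indicator {0..t} s *\<^sub>R (cis (- (of_int k * (v * (t - s)))) * fcoeff (\<lambda>x. of_real (force h s x)) k))"
proof -
  have c0: "continuous_on UNIV (\<lambda>x. h0 x v)"
  proof -
    have "continuous_on UNIV (\<lambda>x. case (x, v) of (x, v) \<Rightarrow> h0 x v)"
      by (rule continuous_on_compose2[OF cont0]) (auto intro!: continuous_intros)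
    then show ?thesis by simp
  qed
  have ch: "continuous_on UNIV (\<lambda>x. h t x v)"
  proof -
    have "continuous_on ({0..} \<times> UNIV) (\<lambda>(s, y). h s y v)"
      unfolding continuous_on_eq_continuous_within
    proof
      fix p :: "real \<times> real" assume "p \<in> {0..} \<times> UNIV"
      then obtain s y where p: "p = (s, y)" "s \<ge> 0" by auto
      then obtain ht hx where "((\<lambda>(s, y). h s y v) has_derivative (\<lambda>(s, y). ht * s + hx * y)) (at (s, y) within {0..} \<times> UNIV)"
        using solution_derivative[OF p(2)] by metis
      then show "continuous (at p within {0..} \<times> UNIV) (\<lambda>(s, y). h s y v)"
        unfolding p by (rule has_derivative_continuous)
    qed
    then have "continuous_on UNIV (\<lambda>x. (\<lambda>(s, y). h s y v) (t, x))"
      by (rule continuous_on_compose2, intro continuous_on_Pair continuous_on_const continuous_on_id) (use t in auto)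
    then show ?thesis by simp
  qed
  define I where "I x = (LINT s:{0..t}|lborel. force h s (x - v * (t - s)))" for x
  have "fcoeff (\<lambda>x. of_real (h t x v)) k = fcoeff (\<lambda>x. of_real (h0 (x - v * t) v)) k - of_real (deriv f0 v) * fcoeff (\<lambda>x. of_real (I x)) k"
  \<comment> \<open>Continuity of the history integral in \<open>x\<close> is read off from
    \<open>characteristics\<close> by solving for it, which requires a nonzero derivative; otherwise
    the term is absent.\<close>
  proof (cases "deriv f0 v = 0")
    case True
    then show ?thesis using characteristics[OF t, of _ v] by (simp add: I_def)
  next
    case False
    have I: "I x = (h0 (x - v * t) v - h t x v) / deriv f0 v" for x
      using characteristics[OF t, of x v] False by (simp add: I_def)
    have cI: "continuous_on UNIV I" unfolding I using False
      by (intro continuous_intros ch continuous_on_compose2[OF c0]) auto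
    have "fcoeff (\<lambda>x. of_real (h t x v)) k = circ (\<lambda>x. cis (- (of_int k * x)) * of_real (h0 (x - v * t) v) - of_real (deriv f0 v) * (cis (- (of_int k * x)) * of_real (I x)))"
      unfolding fcoeff_def
      by (rule arg_cong[where f = circ], rule ext) (simp add: characteristics[OF t, of _ v] I_def algebra_simps)
    also have "\<dots> = fcoeff (\<lambda>x. of_real (h0 (x - v * t) v)) k - of_real (deriv f0 v) * fcoeff (\<lambda>x. of_real (I x)) k"
      unfolding fcoeff_def circ_mult_right[symmetric]
    proof (rule circ_diff)
      have "continuous_on UNIV (\<lambda>x. h0 (x - v * t) v)"
        by (rule continuous_on_compose2[OF c0]) (auto intro!: continuous_intros)
      then show "continuous_on {0..2*pi} (\<lambda>x. cis (- (of_int k * x)) * complex_of_real (h0 (x - v * t) v))"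
        by (intro continuous_intros) (rule continuous_on_subset[OF _ subset_UNIV])
      show "continuous_on {0..2*pi} (\<lambda>x. of_real (deriv f0 v) * (cis (- (of_int k * x)) * complex_of_real (I x)))"
        by (intro continuous_intros continuous_on_subset[OF cI] subset_UNIV)
    qed
    finally show ?thesis .
  qed
  also have "fcoeff (\<lambda>x. of_real (h0 (x - v * t) v)) k = cis (- (of_int k * (v * t))) * fcoeff (\<lambda>x. of_real (h0 x v)) k"
    by (rule fcoeff_shift[of "\<lambda>x. of_real (h0 x v)"]) (auto intro!: continuous_intros c0 simp: per0)
  also have "of_int k * (v * t) = v * (of_int k * t)" by simp
  also have "fcoeff (\<lambda>x. of_real (I x)) k = (LINT s|lborel. indicator {0..t} s *\<^sub>R (cis (- (of_int k * (v * (t - s)))) * fcoeff (\<lambda>x. of_real (force h s x)) k))"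
    unfolding I_def by (rule force_history_coeff[OF t])
  finally show ?thesis .
qed

text \<open>Integrability of a solution over one period times the velocity line allows the velocity
  integral to be exchanged with the Fourier coefficient, after which \<open>solution_coeff\<close>
  applies for each \<open>v\<close>.\<close>

lemma density_coeff_eq:
  assumes t: "t \<ge> 0" and int0: "integrable lborel (\<lambda>v. fcoeff (\<lambda>x. of_real (h0 x v)) k)"
  shows "density_coeff h k t = (LINT v|lborel. cis (- (v * (of_int k * t))) * fcoeff (\<lambda>x. of_real (h0 x v)) k) -
    (LINT v|lborel. of_real (deriv f0 v) * (LINT s|lborel. indicator {0..t} s *\<^sub>R (cis (- (of_int k * (v * (t - s)))) * fcoeff (\<lambda>x. of_real (force h s x)) k)))"
proof -
  let ?I = "indicator {0..2*pi} :: real \<Rightarrow> real"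
  let ?c = "\<lambda>x. cis (- (of_int k * x))"
  let ?f = "\<lambda>x v. ?I x *\<^sub>R (?c x * complex_of_real (h t x v))"
  have int: "integrable (lborel \<Otimes>\<^sub>M lborel) (\<lambda>(x, v). ?f x v)"
  proof -
    have "set_integrable (lborel :: (real \<times> real) measure) ({0..2*pi} \<times> UNIV) (\<lambda>(x, v). h t x v)"
      using sol t by (simp add: linearized_solution_def)
    then have i: "integrable (lborel \<Otimes>\<^sub>M lborel) (\<lambda>p. complex_of_real (indicator ({0..2*pi} \<times> UNIV) p *\<^sub>R (\<lambda>(x, v). h t x v) p))"
      unfolding set_integrable_def lborel_prod by (rule integrable_of_real)
    have m: "(\<lambda>p. ?c (fst p) * complex_of_real (indicator ({0..2*pi} \<times> UNIV) p *\<^sub>R (\<lambda>(x, v). h t x v) p)) \<in> borel_measurable (lborel \<Otimes>\<^sub>M lborel)"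
    proof (rule borel_measurable_times[OF _ borel_measurable_integrable[OF i]])
      show "(\<lambda>p. ?c (fst p)) \<in> borel_measurable (lborel \<Otimes>\<^sub>M lborel)" by measurable
    qed
    have "integrable (lborel \<Otimes>\<^sub>M lborel) (\<lambda>p. ?c (fst p) * complex_of_real (indicator ({0..2*pi} \<times> UNIV) p *\<^sub>R (\<lambda>(x, v). h t x v) p))"
      by (rule Bochner_Integration.integrable_bound[OF i m]) (auto simp: norm_mult)
    also have "(\<lambda>p. ?c (fst p) * complex_of_real (indicator ({0..2*pi} \<times> UNIV) p *\<^sub>R (\<lambda>(x, v). h t x v) p)) = (\<lambda>(x, v). ?f x v)"
      by (auto simp: fun_eq_iff indicator_def)
    finally show ?thesis .
  qed
  have co: "(LINT x|lborel. ?f x v) = fcoeff (\<lambda>x. of_real (h t x v)) k" for v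
    by (simp add: fcoeff_def circ_def set_lebesgue_integral_def)
  have intk: "integrable lborel (\<lambda>v. fcoeff (\<lambda>x. of_real (h t x v)) k)"
    using lborel_pair.integrable_snd[OF int] by (simp only: co)
  have int1: "integrable lborel (\<lambda>v. cis (- (v * (of_int k * t))) * fcoeff (\<lambda>x. of_real (h0 x v)) k)"
    using integrable_cis_mult[OF int0, of "- (of_int k * t)"] by (simp add: mult.commute)
  have "density_coeff h k t = (LINT x|lborel. LINT v|lborel. ?f x v)"
    unfolding density_coeff_def fcoeff_def circ_def set_lebesgue_integral_def mass_density_def
    by (intro Bochner_Integration.integral_cong refl) (simp flip: integral_complex_of_real)
  also have "\<dots> = (LINT v|lborel. LINT x|lborel. ?f x v)"
    by (rule lborel_pair.Fubini_integral[OF int, symmetric])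
  also have "\<dots> = (LINT v|lborel. fcoeff (\<lambda>x. of_real (h t x v)) k)" by (simp only: co)
  \<comment> \<open>The history term is integrable in \<open>v\<close> as the difference of the two
    other terms of \<open>solution_coeff\<close>, so it is introduced in this form.\<close>
  also have "\<dots> = (LINT v|lborel. cis (- (v * (of_int k * t))) * fcoeff (\<lambda>x. of_real (h0 x v)) k) -
    (LINT v|lborel. cis (- (v * (of_int k * t))) * fcoeff (\<lambda>x. of_real (h0 x v)) k - fcoeff (\<lambda>x. of_real (h t x v)) k)"
    by (simp add: Bochner_Integration.integral_diff[OF int1 intk])
  also have "(\<lambda>v. cis (- (v * (of_int k * t))) * fcoeff (\<lambda>x. of_real (h0 x v)) k - fcoeff (\<lambda>x. of_real (h t x v)) k) =
    (\<lambda>v. of_real (deriv f0 v) * (LINT s|lborel. indicator {0..t} s *\<^sub>R (cis (- (of_int k * (v * (t - s)))) * fcoeff (\<lambda>x. of_real (force h s x)) k)))"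
    by (simp add: solution_coeff[OF t])
  finally show ?thesis .
qed

lemma density_coeff_even:
  assumes "even k" "t \<ge> 0" "integrable lborel (\<lambda>v. fcoeff (\<lambda>x. of_real (h0 x v)) k)"
  shows "density_coeff h k t = (LINT v|lborel. cis (- (v * (of_int k * t))) * fcoeff (\<lambda>x. of_real (h0 x v)) k)"
proof -
  have z: "indicator {0..t} s *\<^sub>R (cis (- (of_int k * (v * (t - s)))) * fcoeff (\<lambda>x. of_real (force h s x)) k) = 0" for s v
    by (cases "s \<ge> 0") (simp_all add: force_coeff fcoeff_W_even[OF assms(1)])
  show ?thesis unfolding density_coeff_eq[OF assms(2,3)] z by simp
qed

text \<open>Replacing \<open>s\<close> by \<open>s / k\<close> removes \<open>k\<close> from the
  phase and contributes the factor \<open>1 / k\<close>; the factor \<open>\<i>\<close> is the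
  symbol of the force on odd modes.\<close>

lemma density_coeff_volterra:
  assumes k: "odd k" and \<tau>: "\<tau> \<ge> 0" and int0: "integrable lborel (\<lambda>v. fcoeff (\<lambda>x. of_real (h0 x v)) (int k))"
  shows "density_coeff h (int k) (\<tau> / real k) = (LINT v|lborel. cis (- (v * \<tau>)) * fcoeff (\<lambda>x. of_real (h0 x v)) (int k)) -
    \<i> / of_real (real k) * (LINT v|lborel. of_real (deriv f0 v) * memory (\<lambda>s. density_coeff h (int k) (s / real k)) \<tau> v)"
proof -
  have k0: "real k > 0" using k by (cases k) auto
  have t: "\<tau> / real k \<ge> 0" using \<tau> k0 by simp
  have "(LINT s|lborel. indicator {0..\<tau> / real k} s *\<^sub>R (cis (- (of_int (int k) * (v * (\<tau> / real k - s)))) * fcoeff (\<lambda>x. of_real (force h s x)) (int k)))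
     = \<i> / of_real (real k) * memory (\<lambda>s. density_coeff h (int k) (s / real k)) \<tau> v" for v
  proof -
    let ?F = "\<lambda>s. indicator {0..\<tau> / real k} s *\<^sub>R (cis (- (of_int (int k) * (v * (\<tau> / real k - s)))) * fcoeff (\<lambda>x. of_real (force h s x)) (int k))"
    have "(LINT s|lborel. ?F s) = \<bar>1 / real k\<bar> *\<^sub>R (LINT s|lborel. ?F (0 + (1 / real k) * s))"
      using k0 by (intro lborel_integral_real_affine) simp
    also have "(\<lambda>s. ?F (0 + (1 / real k) * s)) = (\<lambda>s. \<i> * (indicator {0..\<tau>} s *\<^sub>R (cis (- (v * (\<tau> - s))) * density_coeff h (int k) (s / real k))))"
    proof
      fix s
      have ind: "indicator {0..\<tau> / real k} (s / real k) = (indicator {0..\<tau>} s :: real)"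
        using k0 by (auto simp: indicator_def divide_le_cancel zero_le_divide_iff)
      show "?F (0 + (1 / real k) * s) = \<i> * (indicator {0..\<tau>} s *\<^sub>R (cis (- (v * (\<tau> - s))) * density_coeff h (int k) (s / real k)))"
      proof (cases "s \<in> {0..\<tau>}")
        case True
        then have s: "s / real k \<ge> 0" using k0 by simp
        have "fcoeff (\<lambda>x. of_real (force h (s / real k) x)) (int k) = \<i> * density_coeff h (int k) (s / real k)"
          unfolding force_coeff[OF s] fcoeff_W_odd[OF k] using k0 by simp
        moreover have "of_int (int k) * (v * (\<tau> / real k - s / real k)) = v * (\<tau> - s)"
          using k0 by (simp flip: diff_divide_distrib)
        ultimately have "?F (s / real k) = \<i> * (indicator {0..\<tau>} s *\<^sub>R (cis (- (v * (\<tau> - s))) * density_coeff h (int k) (s / real k)))"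
          by (simp only: ind mult_scaleR_right mult.left_commute)
        then show ?thesis by simp
      next
        case False
        then show ?thesis using ind by simp
      qed
    qed
    also have "(LINT s|lborel. \<i> * (indicator {0..\<tau>} s *\<^sub>R (cis (- (v * (\<tau> - s))) * density_coeff h (int k) (s / real k)))) = \<i> * memory (\<lambda>s. density_coeff h (int k) (s / real k)) \<tau> v"
      unfolding memory_def by (rule integral_mult_right_zero)
    finally show ?thesis using k0 by (simp add: scaleR_conv_of_real)
  qed
  then have "density_coeff h (int k) (\<tau> / real k) = (LINT v|lborel. cis (- (v * (of_int (int k) * (\<tau> / real k)))) * fcoeff (\<lambda>x. of_real (h0 x v)) (int k)) -
    (LINT v|lborel. of_real (deriv f0 v) * (\<i> / of_real (real k) * memory (\<lambda>s. density_coeff h (int k) (s / real k)) \<tau> v))"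
    using density_coeff_eq[OF t int0] by (simp only:)
  also have "(LINT v|lborel. of_real (deriv f0 v) * (\<i> / of_real (real k) * memory (\<lambda>s. density_coeff h (int k) (s / real k)) \<tau> v)) =
     \<i> / of_real (real k) * (LINT v|lborel. of_real (deriv f0 v) * memory (\<lambda>s. density_coeff h (int k) (s / real k)) \<tau> v)"
    by (subst integral_mult_right_zero[symmetric]) (simp only: mult.left_commute)
  also have "of_int (int k) * (\<tau> / real k) = \<tau>" using k0 by simp
  finally show ?thesis .
qed

end

section \<open>Assembly of the estimates over all modes\<close>

theorem theorem6p1:
  fixes f0 :: "real \<Rightarrow> real" and h0 :: "real \<Rightarrow> real \<Rightarrow> real"
    and a :: real and G :: "complex \<Rightarrow> complex" and H :: "complex \<Rightarrow> complex \<Rightarrow> complex"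
    and r :: nat
  assumes h0_periodic: "\<And>x v. h0 (x + 2*pi) v = h0 x v"
    and a_pos: "a > 0"
    and f0_analytic: "holomorphic_extension a f0 G"
    and h0_analytic: "holomorphic_extension2 a h0 H"
    and h0_integrable: "integrable_on_lines a H"
    and f0_growth: "deriv G \<in> O[inf at_infinity (principal (strip a))](\<lambda>z. 1 / z)"
    and penrose: "\<And>\<omega>. deriv f0 \<omega> = 0 \<Longrightarrow>
                    \<exists>P. has_cauchy_pv (\<lambda>v. deriv f0 v / (v - \<omega>)) \<omega> P \<and> P > -1"
    and r: "r \<ge> 1"
  shows "\<exists>\<delta>>0. \<exists>C>0. \<forall>h. linearized_solution f0 h0 h \<longrightarrow>
           (\<forall>t\<ge>1.
              Cr_norm r (\<lambda>x. mass_density h t x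
                  - 1 / (2*pi) * (LINT v|lborel. (LINT x:{0..2*pi}|lborel. h0 x v)))
                \<le> ennreal (C * exp (- \<delta> * t)) \<and>
              Cr_norm r (force h t) \<le> ennreal (C * exp (- \<delta> * t)))"
proof -
  obtain C where "analytic_profile (deriv G) (deriv f0) (a / 4) C"
    using profile_of_extension[OF f0_analytic a_pos f0_growth] by blast
  then interpret analytic_profile "deriv G" "deriv f0" "a / 4" C .
  note data = a_pos h0_analytic h0_integrable
  note gr = extension_deriv_real[OF f0_analytic a_pos]
  obtain M where M: "M > 0" and free: "\<And>k \<tau>. \<tau> \<ge> 0 \<Longrightarrow> norm (free_coeff h0 k \<tau>) \<le> M * exp (- (a / 2 * \<tau>))"
    using free_coeff_decay[OF data] by blast
  have a2: "a / 2 > 0" using a_pos by simp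
  obtain \<delta> K where \<delta>: "\<delta> > 0" and K: "K > 0"
    and decay: "\<forall>n q k. k \<ge> (1::real) \<longrightarrow> continuous_on {0..} q \<longrightarrow> continuous_on {0..} n \<longrightarrow>
      (\<forall>t\<ge>0. norm (n t) \<le> M * exp (- (a / 2 * t))) \<longrightarrow>
      (\<forall>t\<ge>0. q t = n t - \<i> / of_real k * (LINT v|lborel. deriv G (of_real v) * memory q t v)) \<longrightarrow>
      (\<forall>t>0. norm (q t) \<le> K * exp (- (\<delta> * t)))"
  proof -
    have "\<exists>\<delta>>0. \<exists>K>0. \<forall>n q k. k \<ge> (1::real) \<longrightarrow> continuous_on {0..} q \<longrightarrow> continuous_on {0..} n \<longrightarrow>
      (\<forall>t\<ge>0. norm (n t) \<le> M * exp (- (a / 2 * t))) \<longrightarrow>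
      (\<forall>t\<ge>0. q t = n t - \<i> / of_real k * (LINT v|lborel. deriv G (of_real v) * memory q t v)) \<longrightarrow>
      (\<forall>t>0. norm (q t) \<le> K * exp (- (\<delta> * t)))"
      by (rule volterra_decay[OF _ a2 M]) (rule penrose)
    then show ?thesis using that by (elim exE conjE)
  qed
  \<comment> \<open>Odd modes decay at the rate \<open>\<delta>\<close> of the Volterra equation,
    even modes at the rate \<open>a / 2\<close> of free transport.\<close>
  define d where "d = min \<delta> (a / 2)"
  define A where "A = max K M"
  have d: "d > 0" "d \<le> \<delta>" "d \<le> a / 2" using \<delta> a2 by (auto simp: d_def)
  have A: "A > 0" "K \<le> A" "M \<le> A" using K by (auto simp: A_def)
  define L where "L = fact r / (pi * (1 - exp (- (d / 2))) * (min (d / 4) 1) ^ r)"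
  have L: "L > 0" using d by (auto simp: L_def)
  show ?thesis
  \<comment> \<open>The other half of \<open>d\<close> is what \<open>Cr_norm_le_fcoeff\<close>
    spends on the complex neighbourhood.\<close>
  proof (rule exI[of _ "d / 2"], intro conjI exI[of _ "L * A"] allI impI)
    show "d / 2 > 0" "L * A > 0" using d L A by auto
    fix h and t :: real assume sol: "linearized_solution f0 h0 h" and t: "t \<ge> 1"
    have t0: "t \<ge> 0" using t by simp
    note S = sol h0_periodic h0_continuous[OF data]
    note int0 = integrable_fcoeff_initial[OF data]
    have coeff: "norm (density_coeff h (int k) t) \<le> A * exp (- (d * real k * t))" if k: "k \<ge> 1" for k
    proof -
      have kt: "real k * t > 0" "real k \<ge> 1" using k t by auto
      have weaken: "B * exp (- (e * (real k * t))) \<le> A * exp (- (d * real k * t))" if "d \<le> e" "0 < B" "B \<le> A" for B e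
      proof -
        have "d * (real k * t) \<le> e * (real k * t)" using that kt by (intro mult_right_mono) auto
        then show ?thesis using that by (intro mult_mono) (auto simp: mult.assoc)
      qed
      show ?thesis
      proof (cases "even k")
        case True
        have "density_coeff h (int k) t = free_coeff h0 (int k) (real k * t)"
          using density_coeff_even[OF S _ t0 int0, of "int k"] True by (simp add: free_coeff_def)
        then have "norm (density_coeff h (int k) t) \<le> M * exp (- (a / 2 * (real k * t)))"
          using free[of "real k * t"] kt by simp
        also have "\<dots> \<le> A * exp (- (d * real k * t))" using d A M by (intro weaken) auto
        finally show ?thesis .
      next
        case False
        define q where "q \<tau> = density_coeff h (int k) (\<tau> / real k)" for \<tau>
        have "norm (q (real k * t)) \<le> K * exp (- (\<delta> * (real k * t)))"
        proof (rule decay[rule_format, of "real k" q "free_coeff h0 (int k)"])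
          show "continuous_on {0..} q"
            unfolding q_def using kt
            by (intro continuous_on_compose2[OF continuous_on_density_coeff[OF S]] continuous_intros) auto
          show "continuous_on {0..} (free_coeff h0 (int k))" by (rule continuous_on_free_coeff[OF data])
          show "norm (free_coeff h0 (int k) \<tau>) \<le> M * exp (- (a / 2 * \<tau>))" if "\<tau> \<ge> 0" for \<tau> by (rule free[OF that])
          show "q \<tau> = free_coeff h0 (int k) \<tau> - \<i> / of_real (real k) * (LINT v|lborel. deriv G (of_real v) * memory q \<tau> v)" if "\<tau> \<ge> 0" for \<tau>
            using density_coeff_volterra[OF S False that int0] by (simp only: gr free_coeff_def q_def[abs_def] q_def)
        qed (use kt in auto)
        then have "norm (density_coeff h (int k) t) \<le> K * exp (- (\<delta> * (real k * t)))"
          using kt by (simp add: q_def)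
        also have "\<dots> \<le> A * exp (- (d * real k * t))" using d A K by (intro weaken) auto
        finally show ?thesis .
      qed
    qed
    define m where "m = 1 / (2*pi) * (LINT v|lborel. (LINT x:{0..2*pi}|lborel. h0 x v))"
    \<comment> \<open>Conservation of mass: the index \<open>0\<close> is even, so no force acts on
      this mode, and its transport phase is trivial.\<close>
    have mass: "density_coeff h 0 t = of_real (2 * pi * m)"
    proof -
      have "density_coeff h 0 t = (LINT v|lborel. fcoeff (\<lambda>x. of_real (h0 x v)) 0)"
        using density_coeff_even[OF S _ t0 int0, of 0] by simp
      also have "\<dots> = (LINT v|lborel. complex_of_real (LINT x:{0..2*pi}|lborel. h0 x v))"
      proof (intro Bochner_Integration.integral_cong refl)
        fix v
        show "fcoeff (\<lambda>x. of_real (h0 x v)) 0 = complex_of_real (LINT x:{0..2*pi}|lborel. h0 x v)"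
          unfolding fcoeff_def circ_def set_lebesgue_integral_def
          by (subst integral_complex_of_real[symmetric]) (simp add: scaleR_conv_of_real)
      qed
      also have "\<dots> = of_real (2 * pi * m)" unfolding m_def by (subst integral_complex_of_real) simp
      finally show ?thesis .
    qed
    \<comment> \<open>Subtracting the mean density touches the zero mode only, which it
      cancels.\<close>
    have minus_const: "fcoeff (\<lambda>x. of_real (mass_density h t x - m)) k = density_coeff h k t - of_real m * (if k = 0 then 2 * of_real pi else 0)" for k
    proof -
      have "fcoeff (\<lambda>x. of_real (mass_density h t x - m)) k =
        circ (\<lambda>x. cis (- (of_int k * x)) * of_real (mass_density h t x) - of_real m * cis (of_int (- k) * x))"
        unfolding fcoeff_def by (rule arg_cong[where f = circ], rule ext) (simp add: algebra_simps)
      also have "\<dots> = density_coeff h k t - of_real m * circ (\<lambda>x. cis (of_int (- k) * x))"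
        unfolding density_coeff_def fcoeff_def circ_mult_right[symmetric]
        by (rule circ_diff) (intro continuous_intros continuous_on_subset[OF density_continuous[OF S t0]] subset_UNIV)+
      also have "circ (\<lambda>x. cis (of_int (- k) * x)) = (if k = 0 then 2 * of_real pi else 0)"
        by (subst circ_cis) simp
      finally show ?thesis .
    qed
    have "Cr_norm r (\<lambda>x. mass_density h t x - m) \<le> ennreal (L * A * exp (- (d / 2) * t))"
      unfolding L_def
    proof (rule Cr_norm_le_fcoeff)
      show "continuous_on UNIV (\<lambda>x. mass_density h t x - m)"
        by (intro continuous_intros density_continuous[OF S t0])
      show "mass_density h t (x + 2*pi) - m = mass_density h t x - m" for x
        by (simp add: density_periodic[OF S t0])
      show "fcoeff (\<lambda>x. of_real (mass_density h t x - m)) 0 = 0"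
        unfolding minus_const mass by simp
      show "norm (fcoeff (\<lambda>x. of_real (mass_density h t x - m)) (int k)) \<le> A * exp (- (d * real k * t))" if "k \<ge> 1" for k
        using coeff[OF that] that unfolding minus_const by simp
    qed (use d A t in auto)
    then show "Cr_norm r (\<lambda>x. mass_density h t x - 1 / (2*pi) * (LINT v|lborel. (LINT x:{0..2*pi}|lborel. h0 x v)))
        \<le> ennreal (L * A * exp (- (d / 2) * t))"
      by (simp only: m_def)
    show "Cr_norm r (force h t) \<le> ennreal (L * A * exp (- (d / 2) * t))"
      unfolding L_def
    proof (rule Cr_norm_le_fcoeff)
      show "continuous_on UNIV (force h t)" by (rule force_continuous_at[OF S t0])
      show "force h t (x + 2*pi) = force h t x" for x by (rule force_periodic[OF S])
      show "fcoeff (\<lambda>x. of_real (force h t x)) 0 = 0" unfolding force_coeff[OF S t0] by simp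
      show "norm (fcoeff (\<lambda>x. of_real (force h t x)) (int k)) \<le> A * exp (- (d * real k * t))" if k: "k \<ge> 1" for k
      proof (cases "even k")
        case True
        then show ?thesis using A by (simp add: force_coeff[OF S t0] fcoeff_W_even)
      next
        case False
        have "fcoeff (\<lambda>x. of_real (force h t x)) (int k) = \<i> * density_coeff h (int k) t"
          unfolding force_coeff[OF S t0] fcoeff_W_odd[OF False] using k by simp
        then show ?thesis using coeff[OF k] by (simp add: norm_mult)
      qed
    qed (use d A t in auto)
  qed
qed

end
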